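(* For every $\delta\in(0,1)$ and every real $k>0$ there is a set $S$ of rational primes such that $$\mathsf M_S(N)\sim k(\log N)^{\delta}\qquad (N\to\infty).$$
   Context: $\mathbb P$ is the set of rational primes and $|\cdot|_p$ is the $p$-adic absolute value on $\mathbb Q$ with $|p|_p=p^{-1}$. For $S\subseteq\mathbb P$ let $R_S=\{r\in\mathbb Q: |r|_p\le 1\text{ for all }p\in\mathbb P\setminus S\}$, and let $T_S$ be the continuous endomorphism of the compact dual group $\widehat{R_S}$ dual to $r\mapsto 2r$ on the discrete group $R_S$. A closed orbit $\tau$ of length $|\tau|=n$ is a set $\{x,T_S(x),\dots,T_S^n(x)=x\}$ of cardinality $n$. Define $\mathsf M_S(N)=\sum_{|\tau|\le N}e^{-h|\tau|}$, the sum over closed orbits of $T_S$ of length at most $N$, where $h=h(T_S)$ is the topological entropy. It is known that $h(T_S)=\log 2$ and that the number of points with $T_S^nx=x$ is $(2^n-1)\prod_{p\in S}|2^n-1|_p$, so that, with $|x|_S=\prod_{p\in S}|x|_p$ and $\mu$ the Möbius function, $$\mathsf M_S(N)=\sum_{n\le N}\frac1{n2^n}\sum_{d\mid n}\mu(n/d)\,(2^d-1)\,|2^d-1|_S .$$ *)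

theory Defs
  imports
    "HOL-Analysis.Analysis"
    "HOL-Library.Landau_Symbols"
    "HOL-Computational_Algebra.Primes"
begin

definition padic_abs :: "nat \<Rightarrow> rat \<Rightarrow> real" where
  "padic_abs p r = (if r = 0 then 0 else
     (case quotient_of r of (a, b) \<Rightarrow>
       real p powi (int (multiplicity (int p) b) - int (multiplicity (int p) a))))"

definition S_integers :: "nat set \<Rightarrow> rat set" where
  "S_integers S = {r. \<forall>p. prime p \<and> p \<notin> S \<longrightarrow> padic_abs p r \<le> 1}"

(* Characters of A are taken extensional (undefined outside A), so that distinct elements
   of the set below are distinct as characters.  A is regarded as a discrete group, so
   every homomorphism to the circle is a continuous character. *)
definition characters :: "'a::ab_group_add set \<Rightarrow> ('a \<Rightarrow> complex) set" where
  "characters A = {x \<in> A \<rightarrow>\<^sub>E sphere 0 1. \<forall>r\<in>A. \<forall>s\<in>A. x (r + s) = x r * x s}"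

(* Compact subsets of a discrete group are finite, so the compact-open topology of the
   dual group is the topology of pointwise convergence. *)
definition dual_topology :: "'a::ab_group_add set \<Rightarrow> ('a \<Rightarrow> complex) topology" where
  "dual_topology A = subtopology (product_topology (\<lambda>_. euclidean) A) (characters A)"

definition dual_map :: "'a set \<Rightarrow> ('a \<Rightarrow> 'a) \<Rightarrow> ('a \<Rightarrow> complex) \<Rightarrow> 'a \<Rightarrow> complex" where
  "dual_map A \<phi> x = restrict (x \<circ> \<phi>) A"

definition open_covers :: "'x topology \<Rightarrow> 'x set set set" where
  "open_covers X = {\<U>. (\<forall>U\<in>\<U>. openin X U) \<and> \<Union>\<U> = topspace X}"

definition cover_number :: "'x topology \<Rightarrow> 'x set set \<Rightarrow> nat" where
  "cover_number X \<U> =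
     (LEAST n. \<exists>\<V>\<subseteq>\<U>. finite \<V> \<and> card \<V> = n \<and> \<Union>\<V> = topspace X)"

(* The join of the covers \<U>, T^{-1} \<U>, ..., T^{-(n-1)} \<U>. *)
definition iterated_join :: "'x topology \<Rightarrow> ('x \<Rightarrow> 'x) \<Rightarrow> 'x set set \<Rightarrow> nat \<Rightarrow> 'x set set" where
  "iterated_join X T \<U> n =
     {{x \<in> topspace X. \<forall>i<n. (T ^^ i) x \<in> f i} |f. f \<in> {..<n} \<rightarrow> \<U>}"

(* Topological entropy of a continuous self-map of a compact space, in the sense of Adler,
   Konheim and McAndrew.  The limit over n exists by subadditivity, so writing it as a
   limsup makes no difference. *)
definition top_entropy :: "'x topology \<Rightarrow> ('x \<Rightarrow> 'x) \<Rightarrow> ereal" where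
  "top_entropy X T =
     (SUP \<U>\<in>open_covers X.
        limsup (\<lambda>n. ereal (ln (real (cover_number X (iterated_join X T \<U> n))) / real n)))"

(* The case n = 0 is excluded by the cardinality condition; the length of a closed orbit
   is its cardinality. *)
definition closed_orbits :: "'x set \<Rightarrow> ('x \<Rightarrow> 'x) \<Rightarrow> 'x set set" where
  "closed_orbits X T =
     {\<tau>. \<exists>x\<in>X. \<exists>n. (T ^^ n) x = x \<and> \<tau> = {(T ^^ i) x |i. i \<le> n} \<and> card \<tau> = n}"

definition T_map :: "nat set \<Rightarrow> (rat \<Rightarrow> complex) \<Rightarrow> rat \<Rightarrow> complex" where
  "T_map S = dual_map (S_integers S) (\<lambda>r. 2 * r)"

(* The entropy of T_map S is finite (it is log 2), and there are only finitely many closed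
   orbits of each length, so neither real_of_ereal nor the sum takes a default value. *)
definition mertens_sum :: "nat set \<Rightarrow> nat \<Rightarrow> real" where
  "mertens_sum S N =
     (let h = real_of_ereal (top_entropy (dual_topology (S_integers S)) (T_map S))
      in \<Sum>\<tau> | \<tau> \<in> closed_orbits (characters (S_integers S)) (T_map S) \<and> card \<tau> \<le> N.
           exp (- h * real (card \<tau>)))"

end

theory Submission
  imports Defs "HOL-Number_Theory.Number_Theory" "HOL-Real_Asymp.Real_Asymp"
begin

text \<open>
  Up to a bounded error the Mertens sum is \<open>f\<^sub>S(N) = \<Sum>\<^bsub>n \<le> N\<^esub> |2\<^sup>n - 1|\<^sub>S / n\<close>.
  For a set \<open>A\<close> of primes let \<open>S\<close> consist of one prime divisor \<open>\<pi>(q)\<close> of each \<open>2\<^sup>q - 1\<close>,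
  \<open>q \<in> A\<close>.  Since \<open>\<pi>(q)\<close> divides \<open>2\<^sup>n - 1\<close> exactly when \<open>q\<close> divides \<open>n\<close>, the sum \<open>f\<^sub>S\<close> behaves
  like the sum of \<open>1/n\<close> over the integers \<open>n\<close> free of prime factors from \<open>A\<close>.  If
  \<open>\<Sum>\<^bsub>p \<le> x, p \<notin> A\<^esub> ln p / p = \<delta> ln x + O(1)\<close>, then writing \<open>ln n = \<Sum>\<^bsub>d dvd n\<^esub> \<Lambda>(d)\<close> in
  \<open>\<Sum>\<^bsub>n \<le> N\<^esub> |2\<^sup>n - 1|\<^sub>S ln n / n\<close> yields an approximate differential equation for \<open>f\<^sub>S\<close> as a
  function of \<open>ln N\<close>, whose solutions satisfy \<open>f\<^sub>S(N) \<sim> c(A) (ln N)\<^sup>\<delta>\<close>.  A suitable \<open>A\<close> is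
  obtained greedily from Mertens' first theorem.  Removing finitely many primes from \<open>A\<close> makes
  \<open>c(A)\<close> as large as desired, and adding a prime \<open>q\<close> multiplies it by a factor between \<open>1 - 1/q\<close>
  and \<open>1 - 1/(4q)\<close>; as the reciprocals of the primes outside \<open>A\<close> have a divergent sum, adding
  primes greedily while \<open>c(A) \<ge> k\<close> leads to the constant \<open>k\<close> exactly.
\<close>

subsection \<open>Regular growth from a logarithmic mean relation\<close>

text \<open>Two obstacles shape the proof. A multiple of \<open>q \<in> A\<close> still has positive
  weight, and expanding \<open>ln n\<close> requires knowing how weights react to a dilation
  \<open>n \<mapsto> p * n\<close> by a prime \<open>p\<close> outside \<open>A\<close>. They stay
  the same unless \<open>p\<close> is itself a chosen divisor \<pi>(r) and \<open>r\<close> divides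
  \<open>n\<close>; then \<open>p\<close> divides \<open>2^n - 1\<close>, and its multiplicity
  rises. As \<pi>(r) > r, these exceptions together cost only a convergent sum. Indexing by primes
  \<open>q\<close> matters here: the order of \<open>2\<close> modulo \<pi>(q) is then exactly
  \<open>q\<close>.

  The greedy approach to the constant may go on forever. The added primes have a convergent sum of
  reciprocals, but their sum of \<open>ln q / q\<close> is not controlled, so the density condition
  may be lost in the limit and the growth theorem does not apply to the final set. Its sums are
  squeezed instead between those of the stages, uniformly in \<open>N\<close>, with the tail of the
  reciprocals as relative error. The lower factor \<open>1 - 1/q\<close> has its own task: a refused
  prime \<open>q\<close> shows that the current constant is below
  \<open>k / (1 - 1/q)\<close>.\<close>

lemma growth_step_lower:
  fixes I f s h C e :: real
  assumes "I > 0" "f > 0" "s > 0" "0 \<le> h" "h \<le> 1" "C \<ge> 0" "e \<ge> 0"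
    and le: "e * I \<le> f * (s + C)"
  shows "ln I - e * ln (s + (C + e)) \<le> ln (I + f * h) - e * ln (s + h + (C + e))"
proof -
  define g where "g t = ln (I + f * t) - e * ln (s + t + (C + e))" for t
  have "g 0 \<le> g h"
  proof (rule DERIV_nonneg_imp_nondecreasing[OF assms(4)])
    fix t assume t: "0 \<le> t" "t \<le> h"
    have p1: "I + f * t > 0" using assms t by (simp add: add_pos_nonneg)
    have p2: "s + t + (C + e) > 0" using assms t by linarith
    have "(g has_real_derivative (f / (I + f * t) - e / (s + t + (C + e)))) (at t)"
      unfolding g_def using p1 p2 by (auto intro!: derivative_eq_intros simp: field_simps)
    moreover have "f / (I + f * t) - e / (s + t + (C + e)) \<ge> 0"
    proof -
      \<comment> \<open>The hypothesis is available at the left end of the step only. Moving right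
        by \<open>t \<le> 1\<close> raises its left side by \<open>e * (f * t)\<close>; the summand
        \<open>e\<close> in the shift \<open>C + e\<close> pays for this.\<close>
      have "e * (f * t) \<le> f * (t + e)"
      proof -
        have "e * t \<le> e * 1" using assms t by (intro mult_left_mono) auto
        hence "e * t \<le> t + e" using t by linarith
        hence "f * (e * t) \<le> f * (t + e)" using assms by (intro mult_left_mono) auto
        thus ?thesis by (simp add: mult_ac)
      qed
      hence "e * (I + f * t) \<le> f * (s + t + (C + e))" using le by (simp add: algebra_simps)
      thus ?thesis using p1 p2 by (simp add: frac_le_eq divide_simps mult.commute)
    qed
    ultimately show "\<exists>y. (g has_real_derivative y) (at t) \<and> 0 \<le> y" by blast
  qed
  thus ?thesis by (simp add: g_def add.assoc)
qed

text \<open>Along the step \<open>I\<close> is linear with slope \<open>f\<close>, and the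
  comparison of logarithmic derivatives persists from the left end because
  \<open>f * t \<le> e * (f * t)\<close>. In contrast to the lower estimate the shift stays at
  \<open>C\<close>.\<close>

lemma growth_step_upper:
  fixes I f s h C e :: real
  assumes "I > 0" "f > 0" "s > C" "0 \<le> h" "e \<ge> 1"
    and le: "f * (s - C) \<le> e * I"
  shows "ln (I + f * h) - e * ln (s + h - C) \<le> ln I - e * ln (s - C)"
proof -
  define g where "g t = e * ln (s + t - C) - ln (I + f * t)" for t
  have "g 0 \<le> g h"
  proof (rule DERIV_nonneg_imp_nondecreasing[OF assms(4)])
    fix t assume t: "0 \<le> t" "t \<le> h"
    have p1: "I + f * t > 0" using assms t by (simp add: add_pos_nonneg)
    have p2: "s + t - C > 0" using assms t by linarith
    have "(g has_real_derivative (e / (s + t - C) - f / (I + f * t))) (at t)"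
      unfolding g_def using p1 p2 by (auto intro!: derivative_eq_intros simp: field_simps)
    moreover have "e / (s + t - C) - f / (I + f * t) \<ge> 0"
    proof -
      have "1 * (f * t) \<le> e * (f * t)" using assms t by (intro mult_right_mono) auto
      hence "f * (s + t - C) \<le> e * (I + f * t)" using le by (simp add: algebra_simps)
      thus ?thesis using p1 p2 by (simp add: frac_le_eq divide_simps mult.commute)
    qed
    ultimately show "\<exists>y. (g has_real_derivative y) (at t) \<and> 0 \<le> y" by blast
  qed
  thus ?thesis by (simp add: g_def add.assoc)
qed

text \<open>On the scale \<open>s = ln N\<close> the function \<open>I N = f N * ln N - T N\<close>
  is the integral of \<open>f\<close>, and \<open>bound\<close> reads
  \<open>e * I = f * s + O(f)\<close> with \<open>e = 1 + \<delta>\<close>, so that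
  \<open>(ln I)' = e / s + O(1 / s^2)\<close>. The error is integrable, hence
  \<open>I / s powr e\<close> has a positive limit. The increasing \<open>u\<close> and the
  decreasing \<open>v\<close>, with \<open>u \<le> v\<close>, carry this out on the discrete
  steps.\<close>

lemma regular_growth:
  fixes c :: "nat \<Rightarrow> real" and \<delta> C :: real
  defines "f \<equiv> \<lambda>N. \<Sum>n=1..N. c n"
  defines "T \<equiv> \<lambda>N. \<Sum>n=1..N. c n * ln (real n)"
  assumes nonneg: "\<And>n. c n \<ge> 0" and pos: "c 1 > 0" and \<delta>: "0 \<le> \<delta>"
    and bound: "\<And>N. N \<ge> 1 \<Longrightarrow> \<bar>(1 + \<delta>) * T N - \<delta> * (f N * ln (real N))\<bar> \<le> C * f N"
  shows "\<exists>K>0. (\<lambda>N. f N / ln (real N) powr \<delta>) \<longlonglongrightarrow> K"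
proof -
  define e where "e = 1 + \<delta>"
  define L where "L N = ln (real N)" for N
  define I where "I N = f N * L N - T N" for N
  have e1: "e \<ge> 1" using \<delta> by (simp add: e_def)
  have f_ge: "f N \<ge> c 1" if "N \<ge> 1" for N
    unfolding f_def using that nonneg by (intro member_le_sum) auto
  have f_pos: "f N > 0" if "N \<ge> 1" for N using f_ge[OF that] pos by linarith
  have C0: "C \<ge> 0" using bound[of 1] f_pos[of 1]
    by (smt (verit, best) abs_ge_zero le_refl mult_neg_pos)
  have I_Suc: "I (Suc N) = I N + f N * (L (Suc N) - L N)" if "N \<ge> 1" for N
    using that by (simp add: I_def f_def T_def L_def algebra_simps)
  have h: "0 \<le> L (Suc N) - L N" "L (Suc N) - L N \<le> 1" if "N \<ge> 1" for N
  proof -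
    show "0 \<le> L (Suc N) - L N" using that by (simp add: L_def)
    have "L (Suc N) - L N = ln (1 + 1 / real N)"
      unfolding L_def using that by (subst ln_divide_pos[symmetric]) (auto simp: field_simps)
    also have "\<dots> \<le> 1 / real N" by (rule ln_add_one_self_le_self) auto
    also have "\<dots> \<le> 1" using that by simp
    finally show "L (Suc N) - L N \<le> 1" .
  qed
  have I_pos: "I N > 0" if "N \<ge> 2" for N using that
  proof (induction N rule: nat_induct_at_least)
    case base
    have "I (Suc 1) = f 1 * ln 2" by (subst I_Suc) (auto simp: I_def f_def T_def L_def)
    thus ?case using f_pos[of 1] by (simp add: numeral_2_eq_2)
  next
    case (Suc n)
    have "f n * (L (Suc n) - L n) \<ge> 0" using Suc f_pos[of n] h(1)[of n] by simp
    thus ?case using Suc by (subst I_Suc) auto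
  qed
  have I_bd: "\<bar>e * I N - f N * L N\<bar> \<le> C * f N" if "N \<ge> 1" for N
  proof -
    have "e * I N - f N * L N = - ((1 + \<delta>) * T N - \<delta> * (f N * ln (real N)))"
      by (simp add: e_def I_def L_def algebra_simps)
    thus ?thesis using bound[OF that] by linarith
  qed
  have Ltop: "filterlim L at_top sequentially" unfolding L_def by real_asymp
  then obtain N1 where N1: "\<And>N. N \<ge> N1 \<Longrightarrow> L N \<ge> C + 1"
    unfolding filterlim_at_top eventually_sequentially by meson
  \<comment> \<open>Since \<open>I 1 = 0\<close>, indices start at \<open>2\<close>; from
    \<open>N1\<close> on, the argument \<open>L N - C\<close> of the logarithm in \<open>v\<close>
    is at least \<open>1\<close>.\<close>
  define N0 where "N0 = max 2 N1"
  define u where "u n = ln (I (n + N0)) - e * ln (L (n + N0) + (C + e))" for n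
  define v where "v n = ln (I (n + N0)) - e * ln (L (n + N0) - C)" for n
  have N0: "n + N0 \<ge> 2" "n + N0 \<ge> 1" "L (n + N0) \<ge> C + 1" for n
    using N1[of "n + N0"] by (auto simp: N0_def)
  have "incseq u"
  proof (rule incseq_SucI)
    fix n
    let ?N = "n + N0"
    have "e * I ?N \<le> f ?N * (L ?N + C)" using I_bd[OF N0(2)[of n]] by (simp add: algebra_simps)
    moreover have "L ?N > 0" using N0(3)[of n] C0 by linarith
    ultimately have "ln (I ?N) - e * ln (L ?N + (C + e)) \<le> ln (I ?N + f ?N * (L (Suc ?N) - L ?N)) -
       e * ln (L ?N + (L (Suc ?N) - L ?N) + (C + e))"
      using C0 e1 I_pos[OF N0(1)[of n]] f_pos[OF N0(2)[of n]] h[OF N0(2)[of n]]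
      by (intro growth_step_lower) auto
    thus "u n \<le> u (Suc n)" using I_Suc[OF N0(2)[of n]] by (simp add: u_def)
  qed
  have "decseq v"
  proof (rule decseq_SucI)
    fix n
    let ?N = "n + N0"
    have "f ?N * (L ?N - C) \<le> e * I ?N" using I_bd[OF N0(2)[of n]] by (simp add: algebra_simps)
    moreover have "L ?N > C" using N0(3)[of n] C0 by linarith
    ultimately have "ln (I ?N + f ?N * (L (Suc ?N) - L ?N)) - e * ln (L ?N + (L (Suc ?N) - L ?N) - C)
        \<le> ln (I ?N) - e * ln (L ?N - C)"
      using C0 e1 I_pos[OF N0(1)[of n]] f_pos[OF N0(2)[of n]] h[OF N0(2)[of n]]
      by (intro growth_step_upper) auto
    thus "v (Suc n) \<le> v n" using I_Suc[OF N0(2)[of n]] by (simp add: v_def)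
  qed
  have uv: "u n \<le> v n" for n
  proof -
    have "ln (L (n + N0) - C) \<le> ln (L (n + N0) + (C + e))" using N0(3)[of n] C0 e1 by simp
    hence "e * ln (L (n + N0) - C) \<le> e * ln (L (n + N0) + (C + e))"
      using e1 by (intro mult_left_mono) auto
    thus ?thesis by (simp add: u_def v_def)
  qed
  have "u n \<le> v 0" for n using decseqD[OF \<open>decseq v\<close>, of 0 n] uv[of n] by simp
  then obtain l where l: "u \<longlonglongrightarrow> l"
    using incseq_convergent[OF \<open>incseq u\<close>] by blast
  have "(\<lambda>N. ln (I N) - e * ln (L N + (C + e))) \<longlonglongrightarrow> l"
    using l unfolding u_def by (rule LIMSEQ_offset)
  moreover have "(\<lambda>N. e * (ln (L N + (C + e)) - ln (L N))) \<longlonglongrightarrow> e * 0"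
    by (intro tendsto_mult tendsto_const, rule filterlim_compose[OF _ Ltop]) real_asymp
  ultimately have "(\<lambda>N. exp (ln (I N) - e * ln (L N + (C + e)) + e * (ln (L N + (C + e)) - ln (L N))))
        \<longlonglongrightarrow> exp (l + e * 0)" by (intro tendsto_exp tendsto_add)
  moreover have "\<forall>\<^sub>F N in sequentially. exp (ln (I N) - e * ln (L N + (C + e)) + e * (ln (L N + (C + e)) - ln (L N)))
        = I N / L N powr e"
    using eventually_ge_at_top[of N0]
  proof eventually_elim
    case (elim N)
    hence "I N > 0" "L N > 0" using I_pos[of N] N0(3)[of "N - N0"] C0 by (auto simp: N0_def)
    thus ?case by (simp add: algebra_simps exp_diff powr_def)
  qed
  ultimately have lim1: "(\<lambda>N. I N / L N powr e) \<longlonglongrightarrow> exp l"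
    using Lim_transform_eventually by fastforce
  \<comment> \<open>Dividing \<open>I_bd\<close> by \<open>f N * L N\<close> recovers
    \<open>f\<close> from its integral as \<open>e * I / L\<close>, which lowers the exponent from
    \<open>e\<close> to \<open>\<delta>\<close>.\<close>
  have lim2: "(\<lambda>N. e * I N / (f N * L N)) \<longlonglongrightarrow> 1"
  proof (rule LIM_zero_cancel, rule Lim_null_comparison)
    show "(\<lambda>N. C / L N) \<longlonglongrightarrow> 0" by (intro tendsto_divide_0[OF tendsto_const] filterlim_at_top_imp_at_infinity Ltop)
    show "\<forall>\<^sub>F N in sequentially. norm (e * I N / (f N * L N) - 1) \<le> C / L N"
      using eventually_ge_at_top[of N0]
    proof eventually_elim
      case (elim N)
      hence *: "f N > 0" "L N > 0" "N \<ge> 1" using f_pos[of N] N0(3)[of "N - N0"] C0 by (auto simp: N0_def)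
      have "e * I N / (f N * L N) - 1 = (e * I N - f N * L N) / (f N * L N)" using * by (simp add: field_simps)
      also have "norm \<dots> = \<bar>e * I N - f N * L N\<bar> / (f N * L N)" using * by (simp add: abs_mult)
      also have "\<dots> \<le> C * f N / (f N * L N)" using * I_bd by (intro divide_right_mono) auto
      also have "\<dots> = C / L N" using * by simp
      finally show ?case .
    qed
  qed
  have "(\<lambda>N. e * (I N / L N powr e) / (e * I N / (f N * L N))) \<longlonglongrightarrow> e * exp l / 1"
    by (intro tendsto_divide tendsto_mult tendsto_const lim1 lim2) auto
  moreover have "\<forall>\<^sub>F N in sequentially. e * (I N / L N powr e) / (e * I N / (f N * L N)) = f N / ln (real N) powr \<delta>"
    using eventually_ge_at_top[of N0]
  proof eventually_elim
    case (elim N)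
    hence *: "f N > 0" "L N > 0" "I N > 0" using f_pos[of N] I_pos[of N] N0(3)[of "N - N0"] C0 by (auto simp: N0_def)
    have "L N powr e = L N * L N powr \<delta>" using * by (simp add: e_def powr_add)
    thus ?case using * e1 by (simp add: field_simps L_def)
  qed
  ultimately have "(\<lambda>N. f N / ln (real N) powr \<delta>) \<longlonglongrightarrow> e * exp l / 1"
    using Lim_transform_eventually by fastforce
  thus ?thesis using e1 by (intro exI[of _ "e * exp l"]) auto
qed

subsection \<open>Mertens' first theorem\<close>

lemma sum_multiples:
  fixes g :: "nat \<Rightarrow> 'b::comm_monoid_add"
  assumes "d \<ge> 1"
  shows "(\<Sum>n | n \<in> {1..N} \<and> d dvd n. g n) = (\<Sum>j=1..N div d. g (d * j))"
proof (rule sum.reindex_bij_witness[of _ "\<lambda>j. d * j" "\<lambda>n. n div d"])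
  fix j assume "j \<in> {1..N div d}"
  hence "1 \<le> d * j" "d * j \<le> N"
    using assms by (auto simp: less_eq_div_iff_mult_less_eq mult.commute)
  thus "d * j \<in> {n \<in> {1..N}. d dvd n}" by simp
qed (use assms in \<open>auto simp: div_le_mono elim!: dvdE\<close>)

lemma sum_mult_ln_eq_sum_mangoldt:
  fixes c :: "nat \<Rightarrow> real"
  shows "(\<Sum>n=1..N. c n * ln (real n)) = (\<Sum>d=1..N. mangoldt d * (\<Sum>j=1..N div d. c (d * j)))"
proof -
  have "(\<Sum>n=1..N. c n * ln (real n)) = (\<Sum>n=1..N. \<Sum>d | d \<in> {1..N} \<and> d dvd n. mangoldt d * c n)"
  proof (rule sum.cong)
    fix n assume n: "n \<in> {1..N}"
    have "c n * ln (real n) = c n * (\<Sum>d | d dvd n. mangoldt d)"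
      using n mangoldt_sum[of n, where ?'a = real] by simp
    also have "{d. d dvd n} = {d. d \<in> {1..N} \<and> d dvd n}"
      using n by (auto dest: dvd_imp_le intro: Nat.gr0I simp: Suc_le_eq)
    finally show "c n * ln (real n) = (\<Sum>d | d \<in> {1..N} \<and> d dvd n. mangoldt d * c n)"
      by (simp add: sum_distrib_left mult.commute)
  qed simp
  also have "\<dots> = (\<Sum>d=1..N. \<Sum>n | n \<in> {1..N} \<and> d dvd n. mangoldt d * c n)"
    by (rule sum.swap_restrict) auto
  also have "\<dots> = (\<Sum>d=1..N. mangoldt d * (\<Sum>j=1..N div d. c (d * j)))"
    by (intro sum.cong refl) (simp add: sum_multiples[where N = N, simplified] sum_distrib_left)
  finally show ?thesis .
qed

text \<open>Crude, but half a power is all that is spent: \<open>ln n / n^2\<close>, and later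
  \<open>ln p / (p * r)\<close> with \<open>p > r\<close>, are thereby dominated by a convergent
  series with exponent \<open>-3/2\<close>.\<close>

lemma ln_le_two_sqrt: "ln (real n) \<le> 2 * sqrt (real n)"
proof (cases "n = 0")
  case False
  hence "ln (real n) = 2 * ln (sqrt (real n))" by (simp add: ln_sqrt)
  also have "ln (sqrt (real n)) \<le> sqrt (real n) - 1" using False by (intro ln_le_minus_one) auto
  finally show ?thesis by simp
qed auto

lemma ln_over_square_bound:
  "\<exists>C::real. \<forall>A. finite A \<longrightarrow> (\<Sum>n\<in>A. ln (real n) / real n ^ 2) \<le> C"
proof -
  have s: "summable (\<lambda>n. 2 * (real n powr (-3/2)))"
    by (intro summable_mult) (simp add: summable_real_powr_iff)
  have le: "ln (real n) / real n ^ 2 \<le> 2 * (real n powr (-3/2))" for n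
  proof (cases "n = 0")
    case False
    have "ln (real n) / real n ^ 2 \<le> 2 * sqrt (real n) / real n ^ 2"
      by (intro divide_right_mono ln_le_two_sqrt) auto
    also have "2 * sqrt (real n) / real n ^ 2 = 2 * (real n powr (1/2 - 2))"
      using False by (subst powr_diff) (simp add: powr_half_sqrt)
    finally show ?thesis by simp
  qed auto
  show ?thesis
  proof (intro exI allI impI)
    fix A :: "nat set" assume "finite A"
    have "(\<Sum>n\<in>A. ln (real n) / real n ^ 2) \<le> (\<Sum>n\<in>A. 2 * (real n powr (-3/2)))"
      by (intro sum_mono le)
    also have "\<dots> \<le> suminf (\<lambda>n. 2 * (real n powr (-3/2)))"
      by (intro sum_le_suminf s \<open>finite A\<close>) auto
    finally show "(\<Sum>n\<in>A. ln (real n) / real n ^ 2) \<le> suminf (\<lambda>n. 2 * (real n powr (-3/2)))" .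
  qed
qed

lemma sum_powers_from_2_le:
  fixes x :: real
  assumes "0 \<le> x" "x \<le> 1/2"
  shows "(\<Sum>k=2..N. x ^ k) \<le> 2 * x ^ 2"
proof (cases "2 \<le> N")
  case True
  have "(1 - x) * (\<Sum>k=2..N. x ^ k) = x ^ 2 - x ^ Suc N" by (rule sum_gp_multiplied[OF True])
  also have "\<dots> \<le> x ^ 2" using assms by simp
  finally have "(1 - x) * (\<Sum>k=2..N. x ^ k) \<le> x ^ 2" .
  moreover have "(1/2) * (\<Sum>k=2..N. x ^ k) \<le> (1 - x) * (\<Sum>k=2..N. x ^ k)"
    using assms by (intro mult_right_mono sum_nonneg) auto
  ultimately show ?thesis by linarith
qed auto

text \<open>Only powers \<open>p ^ k\<close> with \<open>k \<ge> 2\<close> contribute, and for each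
  \<open>p\<close> they form a geometric series of size \<open>O(ln p / p^2)\<close>.\<close>

lemma mangoldt_nonprime_bound:
  "\<exists>C::real. \<forall>N. (\<Sum>d | d \<in> {1..N} \<and> \<not> prime d. mangoldt d / real d) \<le> C"
proof -
  obtain C :: real where C: "\<And>A. finite A \<Longrightarrow> (\<Sum>n\<in>A. ln (real n) / real n ^ 2) \<le> C"
    using ln_over_square_bound by blast
  have "(\<Sum>d | d \<in> {1..N} \<and> \<not> prime d. mangoldt d / real d) \<le> 2 * C" for N
  proof -
    let ?P = "{p \<in> {1..N}. prime p}"
    \<comment> \<open>Exponents can be cut off at \<open>N\<close> because
      \<open>k < p ^ k \<le> N\<close>.\<close>
    let ?I = "?P \<times> {2..N}"
    have "(\<Sum>d | d \<in> {1..N} \<and> \<not> prime d. mangoldt d / real d) =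
        (\<Sum>d | d \<in> {1..N} \<and> \<not> prime d \<and> primepow d. mangoldt d / real d)"
      by (rule sum.mono_neutral_right) (auto simp: mangoldt_def)
    also have "\<dots> \<le> (\<Sum>d\<in>(\<lambda>(p,k). p ^ k) ` ?I. mangoldt d / real d)"
    proof (rule sum_mono2)
      show "{d \<in> {1..N}. \<not> prime d \<and> primepow d} \<subseteq> (\<lambda>(p, k). p ^ k) ` ?I"
      proof
        fix d assume "d \<in> {d \<in> {1..N}. \<not> prime d \<and> primepow d}"
        hence d: "d \<ge> 1" "d \<le> N" "\<not> prime d" "primepow d" by auto
        then obtain p k where pk: "prime p" "k > 0" "d = p ^ k" by (auto simp: primepow_def)
        have "k \<noteq> 1" using pk d by auto
        hence k: "k \<ge> 2" using pk by simp
        have "p \<le> d" using pk by (simp add: self_le_power prime_gt_0_nat Suc_le_eq)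
        moreover have "k < p ^ k" using prime_gt_Suc_0_nat[OF pk(1)] by (rule power_gt_expt)
        ultimately show "d \<in> (\<lambda>(p, k). p ^ k) ` ?I"
          using pk k d prime_gt_0_nat[OF pk(1)] by (intro image_eqI[of _ _ "(p, k)"]) auto
      qed
    qed (auto intro: mangoldt_nonneg divide_nonneg_nonneg)
    also have "\<dots> \<le> (\<Sum>(p,k)\<in>?I. ln (real p) * (1 / real p) ^ k)"
    proof (rule order_trans[OF sum_image_le])
      show "sum ((\<lambda>d. mangoldt d / real d) \<circ> (\<lambda>(p, k). p ^ k)) ?I
          \<le> (\<Sum>(p,k)\<in>?I. ln (real p) * (1 / real p) ^ k)"
        by (intro sum_mono) (auto simp: power_divide mangoldt_primepow)
    qed (auto intro: mangoldt_nonneg divide_nonneg_nonneg)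
    also have "\<dots> = (\<Sum>p\<in>?P. ln (real p) * (\<Sum>k=2..N. (1 / real p) ^ k))"
      by (simp add: sum.cartesian_product[symmetric] sum_distrib_left)
    also have "\<dots> \<le> (\<Sum>p\<in>?P. ln (real p) * (2 * (1 / real p) ^ 2))"
    proof (intro sum_mono mult_left_mono sum_powers_from_2_le)
      fix p assume "p \<in> ?P"
      hence "real p \<ge> 2" using prime_ge_2_nat by auto
      thus "1 / real p \<le> 1/2" "0 \<le> ln (real p)" by (auto simp: field_simps)
    qed auto
    also have "\<dots> = 2 * (\<Sum>p\<in>?P. ln (real p) / real p ^ 2)"
      by (simp add: sum_distrib_left power_divide mult_ac)
    also have "\<dots> \<le> 2 * C" using C[of ?P] by simp
    finally show ?thesis .
  qed
  thus ?thesis by blast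
qed

section \<open>Chebyshev's upper bound for the sum of \<open>ln p\<close>\<close>

lemma prod_primes_dvd:
  fixes n :: nat
  assumes "finite P" "\<And>p. p \<in> P \<Longrightarrow> prime p \<and> p dvd n"
  shows "\<Prod>P dvd n"
  using assms
proof (induction P rule: finite_induct)
  case (insert p P)
  have "coprime p (\<Prod>P)" using insert.prems insert.hyps
    by (intro prod_coprime_right) (metis insertCI primes_coprime)
  moreover have "p dvd n" "\<Prod>P dvd n" using insert by auto
  ultimately show ?case using insert.hyps by (simp add: divides_mult)
qed auto

text \<open>A prime in \<open>(m, 2m]\<close> divides \<open>(2m)!\<close> but not
  \<open>m!\<close>, hence divides the central binomial coefficient, which is at most
  \<open>4^m\<close>.\<close>

lemma chebyshev_theta_step:
  "(\<Sum>p | prime p \<and> m < p \<and> p \<le> 2 * m. ln (real p)) \<le> real (2 * m) * ln 2"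
proof -
  let ?P = "{p. prime p \<and> m < p \<and> p \<le> 2 * m}"
  have fin: "finite ?P" by (rule finite_subset[of _ "{..2*m}"]) auto
  have dvd: "p dvd (2 * m) choose m" if "p \<in> ?P" for p
  proof -
    have "fact m * fact (2 * m - m) * ((2 * m) choose m) = (fact (2 * m) :: nat)"
      by (rule binomial_fact_lemma) simp
    moreover have "p dvd (fact (2 * m) :: nat)" "\<not> p dvd (fact m :: nat)"
      using that by (auto simp: prime_dvd_fact_iff)
    ultimately have "p dvd fact m * fact m * ((2 * m) choose m)" "\<not> p dvd (fact m :: nat)" by (simp_all add: mult_2)
    thus ?thesis using that by (simp add: prime_dvd_mult_iff)
  qed
  have "\<Prod>?P dvd (2 * m) choose m"
    by (rule prod_primes_dvd) (use fin dvd in auto)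
  hence "\<Prod>?P \<le> (2 * m) choose m" by (intro dvd_imp_le) auto
  also have "\<dots> \<le> 2 ^ (2 * m)" by (rule binomial_le_pow2)
  finally have "real (\<Prod>?P) \<le> 2 ^ (2 * m)" by (metis of_nat_le_iff of_nat_numeral of_nat_power)
  moreover have "real (\<Prod>?P) > 0" by (auto intro!: prod_pos simp: prime_gt_0_nat)
  ultimately have "ln (real (\<Prod>?P)) \<le> ln (2 ^ (2 * m))" by (subst ln_le_cancel_iff) auto
  moreover have "ln (real (\<Prod>?P)) = (\<Sum>p\<in>?P. ln (real p))"
    unfolding of_nat_prod by (rule ln_prod[OF fin]) (auto simp: prime_gt_0_nat)
  ultimately show ?thesis by (simp add: ln_realpow)
qed

text \<open>Induction from \<open>n\<close> to its half, rounded up. The step yields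
  \<open>3 * ln 2 * (n + 1)\<close>, which is at most \<open>4 * ln 2 * n\<close> exactly from
  \<open>n = 3\<close> on; hence the separate small cases.\<close>

lemma chebyshev_theta_bound:
  "(\<Sum>p | p \<in> {1..n} \<and> prime p. ln (real p)) \<le> 4 * ln 2 * real n"
proof (induction n rule: less_induct)
  case (less n)
  consider "n = 0" | "n = 1" | "n = 2" | "n \<ge> 3" by linarith
  thus ?case
  proof cases
    case 3
    have "{p. p \<in> {1..n} \<and> prime p} \<subseteq> {2}" using 3 by (auto dest: prime_ge_2_nat)
    hence "(\<Sum>p | p \<in> {1..n} \<and> prime p. ln (real p)) \<le> (\<Sum>p\<in>{2}. ln (real p))"
      by (intro sum_mono2) auto
    also have "\<dots> \<le> 4 * ln 2 * real n" using 3 by simp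
    finally show ?thesis .
  next
    case 4
    define m where "m = (n + 1) div 2"
    have m: "m < n" "n \<le> 2 * m" "2 * m \<le> n + 1" using 4 by (auto simp: m_def)
    have "(\<Sum>p | p \<in> {1..n} \<and> prime p. ln (real p)) \<le>
        (\<Sum>p \<in> {p. p \<in> {1..m} \<and> prime p} \<union> {p. prime p \<and> m < p \<and> p \<le> 2 * m}. ln (real p))"
      using m by (intro sum_mono2) (auto simp: prime_gt_0_nat Suc_le_eq)
    also have "\<dots> = (\<Sum>p | p \<in> {1..m} \<and> prime p. ln (real p)) + (\<Sum>p | prime p \<and> m < p \<and> p \<le> 2 * m. ln (real p))"
      by (rule sum.union_disjoint) auto
    also have "\<dots> \<le> 4 * ln 2 * real m + real (2 * m) * ln 2"
      by (intro add_mono less.IH chebyshev_theta_step m)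
    also have "\<dots> = 3 * ln 2 * real (2 * m)" by simp
    also have "\<dots> \<le> 3 * ln 2 * (real n + 1)" using m by (intro mult_left_mono) auto
    also have "\<dots> \<le> 4 * ln 2 * real n"
    proof -
      have "ln 2 * (3 * (real n + 1)) \<le> ln 2 * (4 * real n)" using 4 by (intro mult_left_mono) auto
      thus ?thesis by (simp add: algebra_simps)
    qed
    finally show ?thesis .
  qed (auto simp: prime_gt_Suc_0_nat)
qed

lemma sum_ln_lower: "real N * ln (real N) - real N \<le> (\<Sum>n=1..N. ln (real n))"
proof (induction N)
  case (Suc N)
  show ?case
  proof (cases "N = 0")
    case False
    have "ln (real (Suc N)) - ln (real N) = ln (1 + 1 / real N)"
      using False by (subst ln_divide_pos[symmetric]) (auto simp: field_simps)
    also have "\<dots> \<le> 1 / real N" by (rule ln_add_one_self_le_self) auto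
    finally have "real N * (ln (real (Suc N)) - ln (real N)) \<le> 1"
      using False by (simp add: field_simps)
    moreover have "real (Suc N) * ln (real (Suc N)) - real (Suc N) =
      (real N * ln (real N) - real N) + ln (real (Suc N)) + (real N * (ln (real (Suc N)) - ln (real N)) - 1)"
      by (simp add: algebra_simps)
    moreover have "(\<Sum>n=1..Suc N. ln (real n)) = (\<Sum>n=1..N. ln (real n)) + ln (real (Suc N))" by simp
    ultimately show ?thesis using Suc by linarith
  qed auto
qed auto

definition prime_log_sum :: "nat set \<Rightarrow> nat \<Rightarrow> real" where
  "prime_log_sum B N = (\<Sum>p | p \<in> {1..N} \<and> prime p \<and> p \<in> B. ln (real p) / real p)"

text \<open>Both bounds come from expanding \<open>ln N!\<close> as the sum of
  \<open>mangoldt d * (N div d)\<close>. Below, \<open>N div d \<le> N / d\<close> and the proper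
  prime powers add a constant. Above, these powers are dropped, and
  \<open>N div p \<ge> N / p - 1\<close> costs the sum of \<open>ln p\<close>, which Chebyshev's
  estimate bounds by a multiple of \<open>N\<close>.\<close>

lemma mertens_first: "\<exists>C. \<forall>N\<ge>1. \<bar>prime_log_sum UNIV N - ln (real N)\<bar> \<le> C"
proof -
  obtain C0 :: real where C0: "\<And>N. (\<Sum>d | d \<in> {1..N} \<and> \<not> prime d. mangoldt d / real d) \<le> C0"
    using mangoldt_nonprime_bound by blast
  have "\<bar>prime_log_sum UNIV N - ln (real N)\<bar> \<le> max (1 + C0) (4 * ln 2)" if N: "N \<ge> 1" for N
  proof -
    let ?S = "\<Sum>n=1..N. ln (real n)"
    have S: "?S = (\<Sum>d=1..N. mangoldt d * real (N div d))"
      using sum_mult_ln_eq_sum_mangoldt[of "\<lambda>_. 1" N] by simp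
    have fl: "real (N div d) \<le> real N / real d" "real N / real d - 1 \<le> real (N div d)" if "d \<ge> 1" for d
    proof -
      show "real (N div d) \<le> real N / real d" by (rule of_nat_div_le_of_nat)
      have "N < d * (N div d + 1)" using dividend_less_times_div[of d N] that by simp
      hence "real N < real d * (real (N div d) + 1)" by (metis of_nat_less_iff of_nat_mult of_nat_add of_nat_1)
      thus "real N / real d - 1 \<le> real (N div d)" using that by (simp add: field_simps)
    qed
    have "real N * ln (real N) - real N \<le> ?S" by (rule sum_ln_lower)
    also have "?S \<le> (\<Sum>d=1..N. mangoldt d * (real N / real d))"
      unfolding S by (intro sum_mono mult_left_mono fl mangoldt_nonneg) auto
    also have "\<dots> = real N * (\<Sum>d=1..N. mangoldt d / real d)"
      by (simp add: sum_distrib_left mult_ac)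
    also have "(\<Sum>d=1..N. mangoldt d / real d) =
        (\<Sum>d | d \<in> {1..N} \<and> prime d. mangoldt d / real d) + (\<Sum>d | d \<in> {1..N} \<and> \<not> prime d. mangoldt d / real d)"
      by (subst sum.union_disjoint[symmetric]) (auto intro!: sum.cong)
    also have "(\<Sum>d | d \<in> {1..N} \<and> prime d. mangoldt d / real d) = prime_log_sum UNIV N"
      unfolding prime_log_sum_def by (intro sum.cong) auto
    finally have "real N * (ln (real N) - 1) \<le> real N * (prime_log_sum UNIV N +
        (\<Sum>d | d \<in> {1..N} \<and> \<not> prime d. mangoldt d / real d))" by (simp add: algebra_simps)
    hence lower: "ln (real N) - 1 \<le> prime_log_sum UNIV N + C0"
      using N C0[of N] by (subst (asm) mult_le_cancel_left_pos) auto
    have "real N * prime_log_sum UNIV N - (\<Sum>p | p \<in> {1..N} \<and> prime p. ln (real p))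
        = (\<Sum>p | p \<in> {1..N} \<and> prime p. ln (real p) * (real N / real p - 1))"
      unfolding prime_log_sum_def by (simp add: sum_distrib_left sum_subtractf[symmetric] algebra_simps)
    also have "\<dots> \<le> (\<Sum>p | p \<in> {1..N} \<and> prime p. mangoldt p * real (N div p))"
      by (intro sum_mono) (auto intro!: mult_left_mono fl)
    also have "\<dots> \<le> ?S" unfolding S
      by (intro sum_mono2) (auto intro!: mult_nonneg_nonneg mangoldt_nonneg)
    also have "\<dots> \<le> (\<Sum>n=1..N. ln (real N))" by (intro sum_mono) auto
    also have "\<dots> = real N * ln (real N)" by simp
    finally have "real N * prime_log_sum UNIV N \<le> real N * ln (real N) + 4 * ln 2 * real N"
      using chebyshev_theta_bound[of N] by linarith
    hence "real N * prime_log_sum UNIV N \<le> real N * (ln (real N) + 4 * ln 2)"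
      by (simp add: algebra_simps)
    hence upper: "prime_log_sum UNIV N \<le> ln (real N) + 4 * ln 2"
      using N by (subst (asm) mult_le_cancel_left_pos) auto
    show ?thesis using lower upper by linarith
  qed
  thus ?thesis by blast
qed

text \<open>Course-of-values recursion for sets: whether \<open>n\<close> belongs to the set may
  depend on the members below \<open>n\<close>, and \<open>G n\<close> collects what has been
  decided before \<open>n\<close>. Both greedy constructions are instances.\<close>

lemma greedy_set_exists:
  fixes P :: "nat \<Rightarrow> nat set \<Rightarrow> bool"
  shows "\<exists>B. \<forall>n. n \<in> B \<longleftrightarrow> P n (B \<inter> {..<n})"
proof -
  define G where "G = rec_nat {} (\<lambda>n X. if P n X then insert n X else X)"
  have G0: "G 0 = {}" and GS: "G (Suc n) = (if P n (G n) then insert n (G n) else G n)" for n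
    by (simp_all add: G_def)
  have sub: "G n \<subseteq> {..<n}" for n
    by (induction n) (auto simp: G0 GS)
  have mem: "k \<in> G n \<longleftrightarrow> k < n \<and> P k (G k)" for k n
    by (induction n) (use sub in \<open>auto simp: G0 GS less_Suc_eq\<close>)
  define B where "B = {n. P n (G n)}"
  have "B \<inter> {..<n} = G n" for n by (auto simp: B_def mem)
  thus ?thesis by (intro exI[of _ B]) (auto simp: B_def)
qed

section \<open>Sets of primes of prescribed logarithmic density\<close>

lemma prime_log_sum_Suc:
  "prime_log_sum B (Suc n) = prime_log_sum B n +
     (if prime (Suc n) \<and> Suc n \<in> B then ln (real (Suc n)) / real (Suc n) else 0)"
proof -
  have "{p. p \<in> {1..Suc n} \<and> prime p \<and> p \<in> B} = {p. p \<in> {1..n} \<and> prime p \<and> p \<in> B} \<union>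
      (if prime (Suc n) \<and> Suc n \<in> B then {Suc n} else {})"
    by (auto simp: le_Suc_eq)
  thus ?thesis by (auto simp: prime_log_sum_def)
qed

lemma prime_log_sum_0 [simp]: "prime_log_sum B 0 = 0"
  by (simp add: prime_log_sum_def)

text \<open>A prime is taken exactly when the sum so far is at most \<open>\<delta> * ln n\<close>.
  A single term is at most \<open>1\<close>, which bounds the overshoot. The deficit is counted from
  the last refused prime: there the sum was above its target, and all later primes were taken, so by
  Mertens' theorem it has since grown like \<open>ln\<close>, no slower than the target because
  \<open>\<delta> \<le> 1\<close>.\<close>

lemma prime_set_of_density_exists:
  assumes "0 \<le> \<delta>" "\<delta> \<le> 1"
  shows "\<exists>B C. \<forall>N\<ge>1. \<bar>prime_log_sum B N - \<delta> * ln (real N)\<bar> \<le> C"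
proof -
  obtain C where C: "\<And>N. N \<ge> 1 \<Longrightarrow> \<bar>prime_log_sum UNIV N - ln (real N)\<bar> \<le> C"
    using mertens_first by blast
  obtain B where B: "\<And>n. n \<in> B \<longleftrightarrow> prime n \<and> prime_log_sum (B \<inter> {..<n}) n \<le> \<delta> * ln (real n)"
    using greedy_set_exists[of "\<lambda>n X. prime n \<and> prime_log_sum X n \<le> \<delta> * ln (real n)"] by blast
  have "prime_log_sum (B \<inter> {..<Suc n}) (Suc n) = prime_log_sum B n" for n
    unfolding prime_log_sum_def by (intro sum.cong) auto
  hence B': "Suc n \<in> B \<longleftrightarrow> prime (Suc n) \<and> prime_log_sum B n \<le> \<delta> * ln (real (Suc n))" for n
    using B[of "Suc n"] by simp
  have upper: "prime_log_sum B N \<le> \<delta> * ln (real N) + 1" if "N \<ge> 1" for N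
    using that
  proof (induction N rule: nat_induct_at_least)
    case (Suc n)
    have "ln (real (Suc n)) / real (Suc n) \<le> 1"
      using ln_le_minus_one[of "real (Suc n)"] by (simp add: divide_le_eq_1)
    moreover have "\<delta> * ln (real n) \<le> \<delta> * ln (real (Suc n))"
      using Suc.hyps assms by (intro mult_left_mono) auto
    ultimately show ?case using Suc.IH B'[of n] prime_log_sum_Suc[of B n]
      by (smt (verit, best))
  qed (auto simp: prime_log_sum_Suc)
  \<comment> \<open>The witness \<open>m\<close> is the last prime refused up to \<open>N\<close>,
    or \<open>1\<close> if there is none.\<close>
  have low: "\<exists>m\<in>{1..N}. \<delta> * ln (real m) + (prime_log_sum UNIV N - prime_log_sum UNIV m) \<le> prime_log_sum B N"
    if "N \<ge> 1" for N
    using that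
  proof (induction N rule: nat_induct_at_least)
    case base
    show ?case by (auto simp: prime_log_sum_Suc)
  next
    case (Suc n)
    then obtain m where m: "m \<in> {1..n}"
      "\<delta> * ln (real m) + (prime_log_sum UNIV n - prime_log_sum UNIV m) \<le> prime_log_sum B n" by blast
    show ?case
    proof (cases "prime (Suc n) \<longrightarrow> Suc n \<in> B")
      case True
      thus ?thesis using m by (intro bexI[of _ m]) (auto simp: prime_log_sum_Suc)
    next
      case False
      thus ?thesis using B'[of n] by (intro bexI[of _ "Suc n"]) (auto simp: prime_log_sum_Suc simp del: of_nat_Suc)
    qed
  qed
  have lower: "prime_log_sum B N \<ge> \<delta> * ln (real N) - 2 * C" if N: "N \<ge> 1" for N
  proof -
    obtain m where m: "m \<in> {1..N}"
      "\<delta> * ln (real m) + (prime_log_sum UNIV N - prime_log_sum UNIV m) \<le> prime_log_sum B N"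
      using low[OF N] by blast
    have "\<delta> * (ln (real N) - ln (real m)) \<le> 1 * (ln (real N) - ln (real m))"
      using m assms by (intro mult_right_mono) auto
    thus ?thesis using m C[of N] C[of m] N by (auto simp: algebra_simps)
  qed
  have "\<bar>prime_log_sum B N - \<delta> * ln (real N)\<bar> \<le> max 1 (2 * C)" if "N \<ge> 1" for N
    using upper[OF that] lower[OF that] by linarith
  thus ?thesis by blast
qed

subsection \<open>Parts of Mersenne numbers supported on a set of primes\<close>

text \<open>For \<open>m > 0\<close> the reciprocal of this number is \<open>|m|_S\<close>. For
  \<open>m = 0\<close> the product is empty and the value is \<open>1\<close>.\<close>

definition S_part :: "nat set \<Rightarrow> nat \<Rightarrow> nat" where
  "S_part S m = (\<Prod>p\<in>{p \<in> prime_factors m. p \<in> S}. p ^ multiplicity p m)"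

lemma multiplicity_S_part:
  assumes "prime p" "m > 0"
  shows "multiplicity p (S_part S m) = (if p \<in> S then multiplicity p m else 0)"
proof -
  have "multiplicity p (S_part S m) = (if p \<in> {p \<in> prime_factors m. p \<in> S} then multiplicity p m else 0)"
    unfolding S_part_def using assms
    by (intro multiplicity_prod_prime_powers) (auto simp: in_prime_factors_iff)
  thus ?thesis using assms by (auto simp: in_prime_factors_iff not_dvd_imp_multiplicity_0)
qed

lemma S_part_pos: "S_part S m > 0"
  unfolding S_part_def by (intro prod_pos) (auto simp: in_prime_factors_iff prime_gt_0_nat)

lemma S_part_dvd: "m > 0 \<Longrightarrow> S_part S m dvd m"
  using S_part_pos[of S m] by (intro multiplicity_le_imp_dvd) (auto simp: multiplicity_S_part)

lemma S_part_dvd_mono: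
  assumes "m dvd n" "n > 0"
  shows "S_part S m dvd S_part S n"
proof (rule multiplicity_le_imp_dvd)
  fix p :: nat assume "prime p"
  moreover have "m > 0" using assms by (auto intro: Nat.gr0I)
  ultimately show "multiplicity p (S_part S m) \<le> multiplicity p (S_part S n)"
    using assms by (auto simp: multiplicity_S_part intro!: dvd_imp_multiplicity_le)
qed (use S_part_pos[of S m] in auto)

lemma S_part_dvd_subset:
  assumes "S \<subseteq> S'" "m > 0"
  shows "S_part S m dvd S_part S' m"
  using S_part_pos[of S m] assms by (intro multiplicity_le_imp_dvd) (auto simp: multiplicity_S_part)

lemma S_part_eqI:
  assumes "m > 0" "m' > 0"
    and "\<And>p. prime p \<Longrightarrow> (if p \<in> S then multiplicity p m else 0) = (if p \<in> S' then multiplicity p m' else 0)"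
  shows "S_part S m = S_part S' m'"
  using assms S_part_pos[of S m] S_part_pos[of S' m']
  by - (rule multiplicity_eq_nat, auto simp: multiplicity_S_part)

lemma coprime_cofactor_S_part:
  assumes "m > 0" "prime p" "p \<in> S"
  shows "\<not> p dvd m div S_part S m"
proof
  assume "p dvd m div S_part S m"
  then obtain k where k: "m div S_part S m = p * k" by blast
  have "m = S_part S m * (m div S_part S m)" using S_part_dvd[OF assms(1)] by simp
  hence m: "m = S_part S m * (p * k)" using k by simp
  hence "k \<noteq> 0" using assms by (intro notI) auto
  hence "multiplicity p m = multiplicity p (S_part S m) + Suc (multiplicity p k)"
    using assms S_part_pos[of S m]
    by (subst m) (simp add: prime_elem_multiplicity_mult_distrib multiplicity_times_same)
  thus False using assms by (simp add: multiplicity_S_part)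
qed

lemma prime_dvd_S_part:
  assumes "m > 0" "prime p" "p dvd S_part S m"
  shows "p \<in> S"
proof (rule ccontr)
  assume "p \<notin> S"
  hence "multiplicity p (S_part S m) = 0" using assms by (simp add: multiplicity_S_part)
  moreover have "multiplicity p (S_part S m) > 0"
    using assms S_part_pos[of S m] by (simp add: prime_multiplicity_gt_zero_iff)
  ultimately show False by simp
qed

section \<open>Mersenne numbers and their chosen prime divisors\<close>

definition mersenne :: "nat \<Rightarrow> nat" where
  "mersenne n = 2 ^ n - 1"

lemma mersenne_pos: "n \<ge> 1 \<Longrightarrow> mersenne n > 0"
  using one_less_power[of "2::nat" n] by (simp add: mersenne_def)

lemma mersenne_dvd:
  assumes "d dvd n"
  shows "mersenne d dvd mersenne n"
proof -
  obtain k where k: "n = d * k" using assms by blast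
  have "int (mersenne d) dvd int (mersenne n)"
    using power_diff_1_eq[of "2 ^ d :: int" k] by (simp add: k power_mult of_nat_diff mersenne_def)
  thus ?thesis by (simp only: int_dvd_int_iff)
qed

definition mersenne_prime_factor :: "nat \<Rightarrow> nat" where
  "mersenne_prime_factor q = (SOME p. prime p \<and> p dvd mersenne q)"

text \<open>The order of \<open>2\<close> modulo the chosen prime \<open>p\<close> divides
  \<open>q\<close> and is not \<open>1\<close>, since no prime divides \<open>2^1 - 1\<close>; as
  \<open>q\<close> is prime, the order is \<open>q\<close>. It also divides \<open>p - 1\<close>,
  whence \<open>q < p\<close>. This works for every prime divisor of \<open>2^q - 1\<close>, so the
  choice is arbitrary.\<close>

lemma mersenne_prime_factor:
  assumes "prime q"
  shows prime_mersenne_prime_factor: "prime (mersenne_prime_factor q)"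
    and mersenne_prime_factor_dvd_iff: "mersenne_prime_factor q dvd mersenne n \<longleftrightarrow> q dvd n"
    and mersenne_prime_factor_gt: "q < mersenne_prime_factor q"
proof -
  let ?p = "mersenne_prime_factor q"
  have "(2::nat) ^ 1 < 2 ^ q" using prime_gt_1_nat[OF assms] by (intro power_strict_increasing) auto
  hence "mersenne q \<noteq> 1" by (simp add: mersenne_def)
  then obtain p where "prime p" "p dvd mersenne q" using prime_factor_nat by blast
  hence p: "prime ?p \<and> ?p dvd mersenne q"
    unfolding mersenne_prime_factor_def by (rule someI[of "\<lambda>p. prime p \<and> p dvd mersenne q", OF conjI])
  thus "prime ?p" by simp
  have dvd_iff: "?p dvd mersenne n \<longleftrightarrow> ord ?p 2 dvd n" for n
    by (simp add: ord_divides[symmetric] mersenne_def cong_altdef_nat)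
  have "ord ?p 2 dvd q" using p dvd_iff by blast
  moreover have "ord ?p 2 \<noteq> 1"
    using dvd_iff[of 1] p by (auto simp: mersenne_def)
  ultimately have ord: "ord ?p 2 = q" using assms by (auto simp: prime_nat_iff)
  thus "?p dvd mersenne n \<longleftrightarrow> q dvd n" using dvd_iff by simp
  \<comment> \<open>\<open>ord\<close> takes the value \<open>0\<close> on arguments that are not
    coprime, and \<open>q\<close> is not \<open>0\<close>.\<close>
  have "coprime ?p 2" using ord assms ord_eq_0[of ?p 2] by (auto intro: ccontr)
  hence "q dvd totient ?p" using order_divides_totient[of ?p 2] ord by simp
  hence "q dvd ?p - 1" using p by (simp add: totient_prime)
  hence "q \<le> ?p - 1" using prime_gt_1_nat[of ?p] p by (intro dvd_imp_le) auto
  thus "q < ?p" using prime_gt_1_nat[of ?p] p by linarith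
qed

lemma mersenne_prime_factor_inj:
  assumes "prime q" "prime r" "mersenne_prime_factor q = mersenne_prime_factor r"
  shows "q = r"
proof -
  have "q dvd r" using assms mersenne_prime_factor_dvd_iff[of q r] mersenne_prime_factor_dvd_iff[of r r] by simp
  thus ?thesis using assms primes_dvd_imp_eq by blast
qed

text \<open>The easy case of lifting the exponent: the cofactor \<open>1 + x + ... + x^(d-1)\<close>
  is congruent to \<open>d\<close> modulo \<open>p\<close>, hence prime to \<open>p\<close>.\<close>

lemma multiplicity_power_minus_one:
  fixes p d x :: nat
  assumes "prime p" "p dvd x - 1" "\<not> p dvd d" "x > 1"
  shows "multiplicity p (x ^ d - 1) = multiplicity p (x - 1)"
proof -
  let ?s = "\<Sum>i<d. x ^ i"
  have eq: "x ^ d - 1 = (x - 1) * ?s"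
  proof -
    have "int (x ^ d - 1) = int ((x - 1) * ?s)"
      using assms power_diff_1_eq[of "int x" d] by (simp add: of_nat_diff)
    thus ?thesis by (simp only: of_nat_eq_iff)
  qed
  have "[x = 1] (mod p)" using assms by (simp add: cong_altdef_nat)
  hence "[?s = (\<Sum>i<d. 1)] (mod p)"
    by (intro cong_sum) (metis cong_pow power_one)
  hence "\<not> p dvd ?s" using assms(3) by (simp add: cong_dvd_iff)
  moreover have "?s \<noteq> 0" using \<open>\<not> p dvd ?s\<close> by (intro notI) simp
  ultimately show ?thesis using assms unfolding eq
    by (subst prime_elem_multiplicity_mult_distrib) (auto simp: not_dvd_imp_multiplicity_0)
qed

text \<open>This is \<open>|2^n - 1|_S\<close> for \<open>n \<ge> 1\<close>, and \<open>1\<close> by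
  default for \<open>n = 0\<close>.\<close>

definition orbit_weight :: "nat set \<Rightarrow> nat \<Rightarrow> real" where
  "orbit_weight S n = 1 / real (S_part S (mersenne n))"

lemma orbit_weight_pos: "orbit_weight S n > 0"
  using S_part_pos by (simp add: orbit_weight_def)

lemma orbit_weight_leI:
  assumes "S_part S (mersenne m) * k dvd S_part S' (mersenne n)"
  shows "orbit_weight S' n \<le> orbit_weight S m / real k"
proof -
  have k: "k > 0" using assms S_part_pos[of S' "mersenne n"] by (intro Nat.gr0I) auto
  have "S_part S (mersenne m) * k \<le> S_part S' (mersenne n)"
    using assms S_part_pos by (intro dvd_imp_le)
  hence "real (S_part S (mersenne m)) * real k \<le> real (S_part S' (mersenne n))"
    by (metis of_nat_le_iff of_nat_mult)
  thus ?thesis using S_part_pos[of S "mersenne m"] S_part_pos[of S' "mersenne n"] k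
    by (simp add: orbit_weight_def divide_simps mult_ac)
qed

lemma orbit_weight_antimono_dvd:
  assumes "d dvd n" "n \<ge> 1"
  shows "orbit_weight S n \<le> orbit_weight S d"
proof -
  have "mersenne d dvd mersenne n" using assms by (simp add: mersenne_dvd)
  thus ?thesis using orbit_weight_leI[of S d 1 S n] S_part_dvd_mono mersenne_pos[OF assms(2)] by simp
qed

lemma orbit_weight_antimono_subset:
  "S \<subseteq> S' \<Longrightarrow> n \<ge> 1 \<Longrightarrow> orbit_weight S' n \<le> orbit_weight S n"
  using orbit_weight_leI[of S n 1 S' n] S_part_dvd_subset[of S S'] mersenne_pos[of n] by simp

lemma orbit_weight_le_1: "orbit_weight S n \<le> 1"
  using S_part_pos[of S "mersenne n"] by (simp add: orbit_weight_def)

abbreviation mersenne_primes :: "nat set \<Rightarrow> nat set" where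
  "mersenne_primes A \<equiv> mersenne_prime_factor ` A"

text \<open>Let \<open>p\<close> be the divisor chosen for \<open>q \<in> A\<close>. If
  \<open>q\<close> does not divide \<open>j\<close>, it does not divide \<open>d * j\<close> either,
  and \<open>p\<close> divides neither Mersenne number. If it does, multiplying the exponent by
  \<open>d\<close> keeps the multiplicity of \<open>p\<close> unless \<open>p = d\<close>, which
  \<open>good\<close> excludes.\<close>

lemma orbit_weight_prime_mult_eq:
  assumes A: "\<And>q. q \<in> A \<Longrightarrow> prime q" and d: "prime d" "d \<notin> A" and j: "j \<ge> 1"
    and good: "\<not> (d \<in> mersenne_primes A \<and> d dvd mersenne j)"
  shows "orbit_weight (mersenne_primes A) (d * j) = orbit_weight (mersenne_primes A) j"
proof -
  have "S_part (mersenne_primes A) (mersenne (d * j)) = S_part (mersenne_primes A) (mersenne j)"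
  proof (rule S_part_eqI)
    fix p :: nat assume p: "prime p"
    have "multiplicity p (mersenne (d * j)) = multiplicity p (mersenne j)" if "p \<in> mersenne_primes A"
    proof -
      obtain q where q: "q \<in> A" "p = mersenne_prime_factor q" using \<open>p \<in> mersenne_primes A\<close> by (rule imageE)
      have "prime q" using A q by blast
      show ?thesis
      proof (cases "q dvd j")
        case True
        hence "p dvd mersenne j" using q \<open>prime q\<close> by (simp add: mersenne_prime_factor_dvd_iff)
        moreover from this have "\<not> p dvd d" using good that p d primes_dvd_imp_eq[of p d] by auto
        moreover have "(2::nat) ^ j > 1" using j by (intro one_less_power) auto
        ultimately show ?thesis using multiplicity_power_minus_one[of p "2 ^ j" d] p
          by (simp add: power_mult[symmetric] mult.commute mersenne_def)
      next
        case False
        moreover have "\<not> q dvd d" using q d \<open>prime q\<close> primes_dvd_imp_eq[of q d] by auto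
        ultimately have "\<not> q dvd d * j" using \<open>prime q\<close> by (simp add: prime_dvd_mult_iff)
        thus ?thesis using False q \<open>prime q\<close>
          by (simp add: not_dvd_imp_multiplicity_0 mersenne_prime_factor_dvd_iff)
      qed
    qed
    thus "(if p \<in> mersenne_primes A then multiplicity p (mersenne (d * j)) else 0) =
        (if p \<in> mersenne_primes A then multiplicity p (mersenne j) else 0)" by simp
  qed (use j d in \<open>auto intro!: mersenne_pos simp: prime_gt_0_nat Suc_le_eq\<close>)
  thus ?thesis by (simp add: orbit_weight_def)
qed

text \<open>The divisor chosen for \<open>q\<close> is new in \<open>2^(q j) - 1\<close> and coprime
  to the old \<open>S\<close>-part, so the weight is divided at least by this prime, which exceeds
  \<open>q\<close>.\<close>

lemma orbit_weight_mult_le: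
  assumes q: "prime q" "q \<in> A" "j \<ge> 1" "\<not> q dvd j"
  shows "orbit_weight (mersenne_primes A) (q * j) \<le> orbit_weight (mersenne_primes A) j / real q"
proof -
  let ?S = "mersenne_primes A" and ?p = "mersenne_prime_factor q"
  have pos: "mersenne j > 0" "mersenne (q * j) > 0"
    using q by (auto intro!: mersenne_pos simp: prime_gt_0_nat Suc_le_eq)
  have p: "prime ?p" "?p dvd mersenne (q * j)" "\<not> ?p dvd mersenne j"
    using q by (auto simp: mersenne_prime_factor_dvd_iff prime_mersenne_prime_factor simp del: One_nat_def)
  have "S_part ?S (mersenne j) dvd S_part ?S (mersenne (q * j))"
  by (rule S_part_dvd_mono[OF _ pos(2)]) (simp add: mersenne_dvd)
  moreover have "?p dvd S_part ?S (mersenne (q * j))"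
  proof -
    have "multiplicity ?p (S_part ?S (mersenne (q * j))) > 0"
      using p q pos by (simp add: multiplicity_S_part prime_multiplicity_gt_zero_iff)
    thus ?thesis using not_dvd_imp_multiplicity_0 by fastforce
  qed
  moreover have "coprime (S_part ?S (mersenne j)) ?p"
    using p S_part_dvd[OF pos(1), of ?S] prime_imp_coprime[of ?p] coprime_commute dvd_trans by metis
  ultimately have "S_part ?S (mersenne j) * ?p dvd S_part ?S (mersenne (q * j))"
    by (intro divides_mult)
  hence "orbit_weight ?S (q * j) \<le> orbit_weight ?S j / real ?p" by (rule orbit_weight_leI)
  also have "\<dots> \<le> orbit_weight ?S j / real q"
    using mersenne_prime_factor_gt[OF q(1)] orbit_weight_pos[of ?S j] prime_gt_0_nat[OF q(1)]
    by (intro divide_left_mono) auto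
  finally show ?thesis .
qed

lemma orbit_weight_insert_eq:
  assumes q: "prime q" "\<not> q dvd n" "n \<ge> 1"
  shows "orbit_weight (mersenne_primes (insert q A)) n = orbit_weight (mersenne_primes A) n"
proof -
  have "\<not> mersenne_prime_factor q dvd mersenne n" using q by (simp add: mersenne_prime_factor_dvd_iff)
  hence "S_part (mersenne_primes (insert q A)) (mersenne n) = S_part (mersenne_primes A) (mersenne n)"
    using mersenne_pos[OF q(3)] by (intro S_part_eqI) (auto simp: not_dvd_imp_multiplicity_0)
  thus ?thesis by (simp add: orbit_weight_def)
qed

text \<open>The prime joining \<open>S\<close> divides \<open>2^(q j) - 1\<close> and differs from
  all earlier ones, because the choice of divisors is injective. A fixed factor below
  \<open>1\<close> is enough for the later divergence arguments, so only \<open>p \<ge> 2\<close> is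
  kept of its size.\<close>

lemma orbit_weight_insert_le:
  assumes A: "\<And>r. r \<in> A \<Longrightarrow> prime r" and q: "prime q" "q \<notin> A" "j \<ge> 1"
  shows "orbit_weight (mersenne_primes (insert q A)) (q * j) \<le> orbit_weight (mersenne_primes A) (q * j) / 2"
proof -
  let ?S = "mersenne_primes A" and ?p = "mersenne_prime_factor q"
  let ?S' = "mersenne_primes (insert q A)" and ?m = "mersenne (q * j)"
  have pos: "?m > 0"
    using q by (auto intro!: mersenne_pos simp: prime_gt_0_nat Suc_le_eq)
  have p: "prime ?p" "?p dvd ?m"
    using q by (auto simp: mersenne_prime_factor_dvd_iff prime_mersenne_prime_factor simp del: One_nat_def)
  have notin: "?p \<notin> ?S" using mersenne_prime_factor_inj q A by blast
  have "S_part ?S ?m dvd S_part ?S' ?m" using pos by (intro S_part_dvd_subset) auto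
  moreover have "?p dvd S_part ?S' ?m"
  proof -
    have "multiplicity ?p (S_part ?S' ?m) > 0"
      using p q pos by (simp add: multiplicity_S_part prime_multiplicity_gt_zero_iff)
    thus ?thesis using not_dvd_imp_multiplicity_0 by fastforce
  qed
  moreover have "coprime (S_part ?S ?m) ?p"
    using p prime_dvd_S_part[OF pos p(1), of ?S] notin prime_imp_coprime[of ?p] coprime_commute by metis
  ultimately have "S_part ?S ?m * ?p dvd S_part ?S' ?m"
    by (intro divides_mult)
  hence "orbit_weight ?S' (q * j) \<le> orbit_weight ?S (q * j) / real ?p" by (rule orbit_weight_leI)
  also have "\<dots> \<le> orbit_weight ?S (q * j) / 2"
    using prime_ge_2_nat[OF p(1)] orbit_weight_pos[of ?S "q * j"]
    by (intro divide_left_mono) auto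
  finally show ?thesis .
qed

subsection \<open>The weighted sum and its growth\<close>

definition orbit_sum :: "nat set \<Rightarrow> nat \<Rightarrow> real" where
  "orbit_sum S N = (\<Sum>n=1..N. orbit_weight S n / real n)"

lemma orbit_sum_nonneg: "orbit_sum S N \<ge> 0"
  unfolding orbit_sum_def by (intro sum_nonneg divide_nonneg_nonneg) (auto simp: less_imp_le orbit_weight_pos)

lemma orbit_sum_mono: "M \<le> N \<Longrightarrow> orbit_sum S M \<le> orbit_sum S N"
  unfolding orbit_sum_def
  by (intro sum_mono2) (auto simp: less_imp_le orbit_weight_pos)

lemma orbit_sum_dilate_le:
  assumes "d \<ge> 1"
  shows "(\<Sum>j=1..M. orbit_weight S (d * j) / real j) \<le> orbit_sum S M"
  unfolding orbit_sum_def using assms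
  by (intro sum_mono divide_right_mono orbit_weight_antimono_dvd) auto

lemma orbit_sum_multiples_le:
  assumes "d \<ge> 1"
  shows "(\<Sum>n | n \<in> {1..N} \<and> d dvd n. orbit_weight S n / real n) \<le> orbit_sum S N / real d"
proof -
  have "(\<Sum>n | n \<in> {1..N} \<and> d dvd n. orbit_weight S n / real n) =
      (\<Sum>j=1..N div d. orbit_weight S (d * j) / real (d * j))"
    by (rule sum_multiples[OF assms])
  also have "\<dots> = (\<Sum>j=1..N div d. orbit_weight S (d * j) / real j) / real d"
    by (simp add: sum_divide_distrib mult.commute)
  also have "\<dots> \<le> orbit_sum S (N div d) / real d"
    by (intro divide_right_mono orbit_sum_dilate_le assms) auto
  also have "\<dots> \<le> orbit_sum S N / real d"
    by (intro divide_right_mono orbit_sum_mono) auto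
  finally show ?thesis .
qed

lemma orbit_sum_split_multiples:
  "orbit_sum S N = (\<Sum>n | n \<in> {1..N} \<and> d dvd n. orbit_weight S n / real n) +
     (\<Sum>n | n \<in> {1..N} \<and> \<not> d dvd n. orbit_weight S n / real n)"
  unfolding orbit_sum_def by (subst sum.union_disjoint[symmetric]) (auto intro!: sum.cong)

text \<open>The multiples of \<open>q\<close> among the \<open>j\<close> carry a share of at most
  \<open>1 / q\<close>; at all other \<open>j\<close> dilation divides the weight by
  \<open>q\<close> or more. Each part accounts for one half of \<open>2 / q\<close>.\<close>

lemma orbit_sum_dilate_mem_le:
  assumes "prime q" "q \<in> A"
  shows "(\<Sum>j=1..M. orbit_weight (mersenne_primes A) (q * j) / real j)
      \<le> 2 / real q * orbit_sum (mersenne_primes A) M"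
proof -
  let ?S = "mersenne_primes A"
  have q: "q \<ge> 1" using assms(1) by (simp add: prime_gt_0_nat Suc_le_eq)
  have "(\<Sum>j=1..M. orbit_weight ?S (q * j) / real j) =
      (\<Sum>j | j \<in> {1..M} \<and> q dvd j. orbit_weight ?S (q * j) / real j) +
      (\<Sum>j | j \<in> {1..M} \<and> \<not> q dvd j. orbit_weight ?S (q * j) / real j)"
    by (subst sum.union_disjoint[symmetric]) (auto intro!: sum.cong)
  also have "\<dots> \<le> (\<Sum>j | j \<in> {1..M} \<and> q dvd j. orbit_weight ?S j / real j) +
      (\<Sum>j | j \<in> {1..M} \<and> \<not> q dvd j. orbit_weight ?S j / real q / real j)"
    using q assms by (intro add_mono sum_mono divide_right_mono orbit_weight_antimono_dvd orbit_weight_mult_le) auto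
  also have "(\<Sum>j | j \<in> {1..M} \<and> \<not> q dvd j. orbit_weight ?S j / real q / real j) =
      (\<Sum>j | j \<in> {1..M} \<and> \<not> q dvd j. orbit_weight ?S j / real j) / real q"
    by (simp add: sum_divide_distrib mult.commute)
  also have "\<dots> \<le> orbit_sum ?S M / real q"
    unfolding orbit_sum_def
    by (intro divide_right_mono sum_mono2) (auto simp: less_imp_le orbit_weight_pos)
  also have "(\<Sum>j | j \<in> {1..M} \<and> q dvd j. orbit_weight ?S j / real j) \<le> orbit_sum ?S M / real q"
    by (rule orbit_sum_multiples_le[OF q])
  finally show ?thesis by simp
qed

lemma orbit_sum_dilate_notin_eq:
  assumes A: "\<And>q. q \<in> A \<Longrightarrow> prime q" and p: "prime p" "p \<notin> A" "p \<notin> mersenne_primes A"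
  shows "(\<Sum>j=1..M. orbit_weight (mersenne_primes A) (p * j) / real j) = orbit_sum (mersenne_primes A) M"
  unfolding orbit_sum_def
  using orbit_weight_prime_mult_eq[OF A p(1,2)] p(3) by (intro sum.cong) auto

text \<open>If \<open>p\<close> is the divisor chosen for \<open>r\<close>, dilation by
  \<open>p\<close> can change weights only at multiples of \<open>r\<close>, the indices
  \<open>n\<close> with \<open>p dvd mersenne n\<close>. These carry at most the share
  \<open>1 / r\<close> of the sum.\<close>

lemma orbit_sum_dilate_notin_ge:
  assumes A: "\<And>q. q \<in> A \<Longrightarrow> prime q" and p: "prime p" "p \<notin> A"
    and r: "r \<in> A" "p = mersenne_prime_factor r"
  shows "(\<Sum>j=1..M. orbit_weight (mersenne_primes A) (p * j) / real j)
     \<ge> orbit_sum (mersenne_primes A) M - orbit_sum (mersenne_primes A) M / real r"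
proof -
  let ?S = "mersenne_primes A"
  have "r \<ge> 1" using A[OF r(1)] by (simp add: prime_gt_0_nat Suc_le_eq)
  from orbit_sum_multiples_le[OF this, where N = M and S = ?S]
  have "orbit_sum ?S M - orbit_sum ?S M / real r \<le>
      (\<Sum>n | n \<in> {1..M} \<and> \<not> r dvd n. orbit_weight ?S n / real n)"
    using orbit_sum_split_multiples[of ?S M r] by linarith
  also have "\<dots> = (\<Sum>n | n \<in> {1..M} \<and> \<not> r dvd n. orbit_weight ?S (p * n) / real n)"
  proof (intro sum.cong refl)
    fix n assume n: "n \<in> {n \<in> {1..M}. \<not> r dvd n}"
    hence "\<not> p dvd mersenne n" using r A by (simp add: mersenne_prime_factor_dvd_iff)
    thus "orbit_weight ?S n / real n = orbit_weight ?S (p * n) / real n"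
      using orbit_weight_prime_mult_eq[OF A p, of n] n by simp
  qed
  also have "\<dots> \<le> (\<Sum>j=1..M. orbit_weight ?S (p * j) / real j)"
    by (intro sum_mono2) (auto simp: less_imp_le orbit_weight_pos)
  finally show ?thesis .
qed

text \<open>The total cost of dilations by primes that are themselves chosen divisors: the dilation
  by \<open>p\<close> chosen for \<open>r\<close> loses a share \<open>1 / r\<close> and enters with
  the coefficient \<open>ln p / p\<close>. Because \<open>p > r\<close>, each term is at most
  \<open>2 * r powr (-3/2)\<close>, uniformly in \<open>A\<close>.\<close>

lemma mersenne_prime_reciprocal_bound:
  "\<exists>C::real. \<forall>A N. (\<forall>q\<in>A. prime q) \<longrightarrow>
     (\<Sum>r | r \<in> A \<and> r \<le> N. ln (real (mersenne_prime_factor r)) / (real (mersenne_prime_factor r) * real r)) \<le> C"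
proof -
  have s: "summable (\<lambda>n. 2 * (real n powr (-3/2)))"
    by (intro summable_mult) (simp add: summable_real_powr_iff)
  show ?thesis
  proof (intro exI allI impI)
    fix A :: "nat set" and N :: nat assume A: "\<forall>q\<in>A. prime q"
    have "(\<Sum>r | r \<in> A \<and> r \<le> N. ln (real (mersenne_prime_factor r)) / (real (mersenne_prime_factor r) * real r))
       \<le> (\<Sum>r | r \<in> A \<and> r \<le> N. 2 * (real r powr (-3/2)))"
    proof (rule sum_mono)
      fix r assume r: "r \<in> {r. r \<in> A \<and> r \<le> N}"
      let ?p = "mersenne_prime_factor r"
      have "prime r" using A r by auto
      hence p: "r < ?p" "0 < r" using mersenne_prime_factor_gt by (auto simp: prime_gt_0_nat)
      have "ln (real ?p) / (real ?p * real r) \<le> 2 * sqrt (real ?p) / (real ?p * real r)"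
        by (intro divide_right_mono ln_le_two_sqrt) auto
      also have "\<dots> = 2 / (sqrt (real ?p) * real r)"
        using p by (simp add: field_simps flip: real_sqrt_mult) 
      also have "\<dots> \<le> 2 / (sqrt (real r) * real r)"
        using p by (intro divide_left_mono mult_right_mono) auto
      also have "\<dots> = 2 * (real r powr (-3/2))"
      proof -
        have "sqrt (real r) * real r = real r powr (1/2 + 1)"
          using p by (subst powr_add) (simp add: powr_half_sqrt)
        thus ?thesis by (simp add: powr_minus field_simps)
      qed
      finally show "ln (real ?p) / (real ?p * real r) \<le> 2 * (real r powr (-3/2))" .
    qed
    also have "\<dots> \<le> suminf (\<lambda>n. 2 * (real n powr (-3/2)))"
      by (intro sum_le_suminf s) auto
    finally show "(\<Sum>r | r \<in> A \<and> r \<le> N. ln (real (mersenne_prime_factor r)) / (real (mersenne_prime_factor r) * real r))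
       \<le> suminf (\<lambda>n. 2 * (real n powr (-3/2)))" .
  qed
qed

text \<open>Both sides run over the pairs with \<open>p * j \<le> N\<close>. Summing over
  \<open>p\<close> first produces the partial sums for which a density hypothesis is
  available.\<close>

lemma sum_prime_log_swap:
  fixes u :: "nat \<Rightarrow> real"
  shows "(\<Sum>p | p \<in> {1..N} \<and> prime p \<and> p \<in> B. ln (real p) / real p * (\<Sum>j=1..N div p. u j)) =
     (\<Sum>j=1..N. u j * prime_log_sum B (N div j))"
proof -
  let ?P = "{p. p \<in> {1..N} \<and> prime p \<and> p \<in> B}"
  have "(\<Sum>p\<in>?P. ln (real p) / real p * (\<Sum>j=1..N div p. u j)) =
      (\<Sum>p\<in>?P. \<Sum>j | j \<in> {1..N} \<and> p * j \<le> N. ln (real p) / real p * u j)"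
  proof (intro sum.cong refl)
    fix p assume p: "p \<in> ?P"
    hence p0: "0 < p" by auto
    have "j \<le> N" if "p * j \<le> N" for j
      by (rule order_trans[OF _ that]) (use p0 in simp)
    hence "{1..N div p} = {j. j \<in> {1..N} \<and> p * j \<le> N}"
      using p0 by (auto simp: less_eq_div_iff_mult_less_eq mult.commute)
    thus "ln (real p) / real p * (\<Sum>j=1..N div p. u j) =
       (\<Sum>j | j \<in> {1..N} \<and> p * j \<le> N. ln (real p) / real p * u j)"
      by (simp add: sum_distrib_left)
  qed
  also have "\<dots> = (\<Sum>j=1..N. \<Sum>p | p \<in> ?P \<and> p * j \<le> N. ln (real p) / real p * u j)"
    by (rule sum.swap_restrict) auto
  also have "\<dots> = (\<Sum>j=1..N. u j * prime_log_sum B (N div j))"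
  proof (intro sum.cong refl)
    fix j assume j: "j \<in> {1..N}"
    have "{p. p \<in> ?P \<and> p * j \<le> N} = {p. p \<in> {1..N div j} \<and> prime p \<and> p \<in> B}"
      using j by (auto simp: less_eq_div_iff_mult_less_eq intro: order.trans[OF _ div_le_dividend[of N j]])
    thus "(\<Sum>p | p \<in> ?P \<and> p * j \<le> N. ln (real p) / real p * u j) = u j * prime_log_sum B (N div j)"
      by (simp add: prime_log_sum_def sum_distrib_left mult.commute)
  qed
  finally show ?thesis .
qed

text \<open>In the von Mangoldt expansion \<open>d\<close> enters through the dilated sum
  \<open>g d \<le> f (N div d)\<close>. Non-primes (\<open>X\<close>) have a bounded total
  coefficient; primes in \<open>A\<close> (\<open>Y\<close>) gain a further \<open>2 / d\<close>,
  and \<open>ln d / d^2\<close> is summable; for primes outside \<open>A\<close> (\<open>Z\<close>)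
  dilation is exact apart from the chosen divisors. Each error is thus a constant times
  \<open>f N\<close>.\<close>

lemma orbit_sum_log_identity:
  assumes A: "\<And>q. q \<in> A \<Longrightarrow> prime q"
  defines "f \<equiv> orbit_sum (mersenne_primes A)"
  shows "\<exists>C. \<forall>N. \<bar>(\<Sum>n=1..N. orbit_weight (mersenne_primes A) n / real n * ln (real n)) -
       (\<Sum>p | p \<in> {1..N} \<and> prime p \<and> p \<in> - A. ln (real p) / real p * f (N div p))\<bar> \<le> C * f N"
proof -
  let ?S = "mersenne_primes A" and ?\<pi> = mersenne_prime_factor
  obtain C0 :: real where C0: "\<And>N. (\<Sum>d | d \<in> {1..N} \<and> \<not> prime d. mangoldt d / real d) \<le> C0"
    using mangoldt_nonprime_bound by blast
  obtain C1 :: real where C1: "\<And>X. finite X \<Longrightarrow> (\<Sum>n\<in>X. ln (real n) / real n ^ 2) \<le> C1"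
    using ln_over_square_bound by blast
  obtain C2 where C2: "\<And>N. (\<Sum>r | r \<in> A \<and> r \<le> N. ln (real (?\<pi> r)) / (real (?\<pi> r) * real r)) \<le> C2"
    using mersenne_prime_reciprocal_bound A by blast
  have "\<bar>(\<Sum>n=1..N. orbit_weight ?S n / real n * ln (real n)) -
       (\<Sum>p | p \<in> {1..N} \<and> prime p \<and> p \<in> - A. ln (real p) / real p * f (N div p))\<bar> \<le> (C0 + 2 * C1 + C2) * f N" for N
  proof -
    define g where "g d = (\<Sum>j=1..N div d. orbit_weight ?S (d * j) / real j)" for d
    define X where "X = {d. d \<in> {1..N} \<and> \<not> prime d}"
    define Y where "Y = {d. d \<in> {1..N} \<and> prime d \<and> d \<in> A}"
    define Z where "Z = {d. d \<in> {1..N} \<and> prime d \<and> d \<in> - A}"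
    have f0: "f M \<ge> 0" for M by (simp add: f_def orbit_sum_nonneg)
    have f_le: "f (N div d) \<le> f N" for d by (simp add: f_def orbit_sum_mono)
    have g0: "g d \<ge> 0" for d
      unfolding g_def by (intro sum_nonneg divide_nonneg_nonneg) (auto simp: less_imp_le orbit_weight_pos)
    have g_le: "g d \<le> f (N div d)" if "d \<ge> 1" for d
      unfolding g_def f_def by (rule orbit_sum_dilate_le[OF that])
    have "(\<Sum>n=1..N. orbit_weight ?S n / real n * ln (real n)) =
        (\<Sum>d=1..N. mangoldt d / real d * g d)"
      unfolding sum_mult_ln_eq_sum_mangoldt g_def
      by (intro sum.cong refl) (simp add: sum_distrib_left sum_divide_distrib)
    also have "(\<Sum>d=1..N. mangoldt d / real d * g d) = (\<Sum>d\<in>X \<union> (Y \<union> Z). mangoldt d / real d * g d)"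
      by (intro sum.cong) (auto simp: X_def Y_def Z_def)
    also have "\<dots> =
       (\<Sum>d\<in>X. mangoldt d / real d * g d) + ((\<Sum>d\<in>Y. mangoldt d / real d * g d) + (\<Sum>d\<in>Z. mangoldt d / real d * g d))"
      by (subst sum.union_disjoint; (subst sum.union_disjoint)?) (auto simp: X_def Y_def Z_def)
    also have "(\<Sum>d\<in>Y. mangoldt d / real d * g d) = (\<Sum>d\<in>Y. ln (real d) / real d * g d)"
      by (intro sum.cong) (auto simp: Y_def)
    also have "(\<Sum>d\<in>Z. mangoldt d / real d * g d) = (\<Sum>d\<in>Z. ln (real d) / real d * g d)"
      by (intro sum.cong) (auto simp: Z_def)
    finally have T: "(\<Sum>n=1..N. orbit_weight ?S n / real n * ln (real n)) =
       (\<Sum>d\<in>X. mangoldt d / real d * g d) + ((\<Sum>d\<in>Y. ln (real d) / real d * g d) + (\<Sum>d\<in>Z. ln (real d) / real d * g d))" .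
    have X0: "(\<Sum>d\<in>X. mangoldt d / real d * g d) \<ge> 0"
      by (intro sum_nonneg mult_nonneg_nonneg divide_nonneg_nonneg mangoldt_nonneg g0) auto
    have "(\<Sum>d\<in>X. mangoldt d / real d * g d) \<le> (\<Sum>d\<in>X. mangoldt d / real d * f N)"
      using g_le f_le by (intro sum_mono mult_left_mono divide_nonneg_nonneg mangoldt_nonneg)
        (auto simp: X_def intro: order_trans)
    also have "\<dots> = (\<Sum>d\<in>X. mangoldt d / real d) * f N" by (simp add: sum_distrib_right)
    also have "\<dots> \<le> C0 * f N" unfolding X_def by (intro mult_right_mono C0 f0)
    finally have X1: "(\<Sum>d\<in>X. mangoldt d / real d * g d) \<le> C0 * f N" .
    have Y0: "(\<Sum>d\<in>Y. ln (real d) / real d * g d) \<ge> 0"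
      by (intro sum_nonneg mult_nonneg_nonneg divide_nonneg_nonneg g0) (auto simp: Y_def)
    have "(\<Sum>d\<in>Y. ln (real d) / real d * g d) \<le> (\<Sum>d\<in>Y. ln (real d) / real d * (2 / real d * f N))"
    proof (intro sum_mono mult_left_mono)
      fix d assume d: "d \<in> Y"
      hence "g d \<le> 2 / real d * f (N div d)" unfolding g_def f_def
        by (intro orbit_sum_dilate_mem_le) (auto simp: Y_def)
      also have "\<dots> \<le> 2 / real d * f N" by (intro mult_left_mono f_le) auto
      finally show "g d \<le> 2 / real d * f N" .
    qed (auto simp: Y_def)
    also have "\<dots> = 2 * (\<Sum>d\<in>Y. ln (real d) / real d ^ 2) * f N"
      by (simp add: sum_distrib_left sum_distrib_right power2_eq_square mult_ac)
    also have "\<dots> \<le> 2 * C1 * f N"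
      by (intro mult_right_mono mult_left_mono C1 f0) (auto simp: Y_def)
    finally have Y1: "(\<Sum>d\<in>Y. ln (real d) / real d * g d) \<le> 2 * C1 * f N" .
    have Z0: "(\<Sum>d\<in>Z. ln (real d) / real d * g d) \<le> (\<Sum>d\<in>Z. ln (real d) / real d * f (N div d))"
      by (intro sum_mono mult_left_mono g_le) (auto simp: Z_def)
    have "(\<Sum>d\<in>Z. ln (real d) / real d * f (N div d)) - (\<Sum>d\<in>Z. ln (real d) / real d * g d) =
        (\<Sum>d\<in>Z. ln (real d) / real d * (f (N div d) - g d))"
      by (simp add: sum_subtractf algebra_simps)
    also have "\<dots> = (\<Sum>d\<in>Z \<inter> ?S. ln (real d) / real d * (f (N div d) - g d))"
    proof (rule sum.mono_neutral_right)
      show "\<forall>d\<in>Z - Z \<inter> ?S. ln (real d) / real d * (f (N div d) - g d) = 0"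
      proof
        fix d assume "d \<in> Z - Z \<inter> ?S"
        hence "prime d" "d \<notin> A" "d \<notin> ?S" by (auto simp: Z_def)
        thus "ln (real d) / real d * (f (N div d) - g d) = 0"
          using orbit_sum_dilate_notin_eq[of A, OF A] by (simp add: g_def f_def)
      qed
    qed (auto simp: Z_def)
    \<comment> \<open>The exceptional primes are indexed by the \<open>r\<close> they were chosen
      for; \<open>d \<le> N\<close> forces \<open>r \<le> N\<close> since
      \<open>r < d\<close>.\<close>
    also have "\<dots> \<le> (\<Sum>d\<in>?\<pi> ` {r. r \<in> A \<and> r \<le> N} \<inter> Z. ln (real d) / real d * (f (N div d) - g d))"
    proof (intro sum_mono2)
      show "Z \<inter> ?S \<subseteq> ?\<pi> ` {r. r \<in> A \<and> r \<le> N} \<inter> Z"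
      proof
        fix d assume "d \<in> Z \<inter> ?S"
        then obtain r where r: "r \<in> A" "d = ?\<pi> r" "d \<in> Z" by auto
        moreover have "r \<le> N" using mersenne_prime_factor_gt[OF A[OF r(1)]] r by (auto simp: Z_def)
        ultimately show "d \<in> ?\<pi> ` {r. r \<in> A \<and> r \<le> N} \<inter> Z" by auto
      qed
    qed (use g_le in \<open>auto simp: Z_def intro!: mult_nonneg_nonneg divide_nonneg_nonneg\<close>)
    also have "\<dots> = (\<Sum>d\<in>?\<pi> ` {r. r \<in> A \<and> r \<le> N \<and> ?\<pi> r \<in> Z}. ln (real d) / real d * (f (N div d) - g d))"
      by (intro sum.cong) auto
    also have "\<dots> = (\<Sum>r | r \<in> A \<and> r \<le> N \<and> ?\<pi> r \<in> Z. ln (real (?\<pi> r)) / real (?\<pi> r) * (f (N div ?\<pi> r) - g (?\<pi> r)))"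
      by (subst sum.reindex) (auto simp: inj_on_def dest: mersenne_prime_factor_inj[OF A A])
    also have "\<dots> \<le> (\<Sum>r | r \<in> A \<and> r \<le> N \<and> ?\<pi> r \<in> Z. ln (real (?\<pi> r)) / real (?\<pi> r) * (f N / real r))"
    proof (intro sum_mono mult_left_mono)
      fix r assume r: "r \<in> {r. r \<in> A \<and> r \<le> N \<and> ?\<pi> r \<in> Z}"
      hence "f (N div ?\<pi> r) - g (?\<pi> r) \<le> f (N div ?\<pi> r) / real r"
        using orbit_sum_dilate_notin_ge[where A = A and r = r and p = "?\<pi> r" and M = "N div ?\<pi> r"] A unfolding g_def f_def Z_def by auto
      also have "\<dots> \<le> f N / real r" by (intro divide_right_mono f_le) auto
      finally show "f (N div ?\<pi> r) - g (?\<pi> r) \<le> f N / real r" .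
    qed (auto simp: Z_def)
    also have "\<dots> \<le> (\<Sum>r | r \<in> A \<and> r \<le> N. ln (real (?\<pi> r)) / real (?\<pi> r) * (f N / real r))"
      using prime_mersenne_prime_factor[OF A] f0
      by (intro sum_mono2) (auto intro!: mult_nonneg_nonneg divide_nonneg_nonneg simp: prime_gt_0_nat Suc_le_eq)
    also have "\<dots> = (\<Sum>r | r \<in> A \<and> r \<le> N. ln (real (?\<pi> r)) / (real (?\<pi> r) * real r)) * f N"
      by (simp add: sum_distrib_right)
    also have "\<dots> \<le> C2 * f N" by (intro mult_right_mono C2 f0)
    finally have Z1: "(\<Sum>d\<in>Z. ln (real d) / real d * f (N div d)) - (\<Sum>d\<in>Z. ln (real d) / real d * g d) \<le> C2 * f N" .
    \<comment> \<open>The errors from \<open>X\<close>, \<open>Y\<close> and \<open>Z\<close> have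
      different signs; nonnegativity of each bound allows adding the constants in a two-sided
      estimate.\<close>
    have "C0 * f N \<ge> 0" "2 * C1 * f N \<ge> 0" "C2 * f N \<ge> 0" using X0 X1 Y0 Y1 Z0 Z1 by linarith+
    thus ?thesis using X0 X1 Y0 Y1 Z0 Z1 unfolding T Z_def[symmetric] by (simp add: algebra_simps)
  qed
  thus ?thesis by blast
qed

text \<open>With \<open>c n\<close> the weight divided by \<open>n\<close>, the sum of
  \<open>c j * ln (N / j)\<close> is \<open>f N * ln N - T N\<close>. Inserting the density gives
  \<open>T N = \<delta> * (f N * ln N - T N) + O(f N)\<close>, and collecting \<open>T N\<close> on
  the left gives the hypothesis of \<open>regular_growth\<close>.\<close>

lemma orbit_sum_regular:
  assumes A: "\<And>q. q \<in> A \<Longrightarrow> prime q" and \<delta>: "0 \<le> \<delta>"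
    and dens: "\<And>N. N \<ge> 1 \<Longrightarrow> \<bar>prime_log_sum (- A) N - \<delta> * ln (real N)\<bar> \<le> C"
  shows "\<exists>K>0. (\<lambda>N. orbit_sum (mersenne_primes A) N / ln (real N) powr \<delta>) \<longlonglongrightarrow> K"
proof -
  let ?S = "mersenne_primes A"
  define c where "c n = orbit_weight ?S n / real n" for n
  define f where "f = orbit_sum ?S"
  define T where "T N = (\<Sum>n=1..N. c n * ln (real n))" for N
  have f_eq: "f N = (\<Sum>n=1..N. c n)" for N by (simp add: f_def orbit_sum_def c_def)
  have c0: "c n \<ge> 0" for n by (simp add: c_def less_imp_le orbit_weight_pos)
  have f0: "f N \<ge> 0" for N by (simp add: f_def orbit_sum_nonneg)
  obtain C' where C': "\<And>N. \<bar>T N - (\<Sum>p | p \<in> {1..N} \<and> prime p \<and> p \<in> - A. ln (real p) / real p * f (N div p))\<bar> \<le> C' * f N"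
    using orbit_sum_log_identity[OF A] unfolding f_def T_def c_def by blast
  have "\<bar>(1 + \<delta>) * T N - \<delta> * (f N * ln (real N))\<bar> \<le> (C' + (C + \<delta>)) * f N" if N: "N \<ge> 1" for N
  proof -
    let ?R = "\<Sum>p | p \<in> {1..N} \<and> prime p \<and> p \<in> - A. ln (real p) / real p * f (N div p)"
    have "?R = (\<Sum>j=1..N. c j * prime_log_sum (- A) (N div j))"
      unfolding f_eq by (rule sum_prime_log_swap)
    moreover have "\<delta> * (f N * ln (real N) - T N) = (\<Sum>j=1..N. c j * (\<delta> * (ln (real N) - ln (real j))))"
      by (simp add: f_eq T_def sum_distrib_left sum_distrib_right sum_subtractf algebra_simps)
    ultimately have "?R - \<delta> * (f N * ln (real N) - T N) =
        (\<Sum>j=1..N. c j * (prime_log_sum (- A) (N div j) - \<delta> * (ln (real N) - ln (real j))))"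
      by (simp only: sum_subtractf right_diff_distrib)
    also have "\<bar>\<dots>\<bar> \<le> (\<Sum>j=1..N. c j * (C + \<delta>))"
    proof (rule order_trans[OF sum_abs], rule sum_mono)
      fix j assume j: "j \<in> {1..N}"
      define M where "M = N div j"
      have M: "M \<ge> 1" using j div_le_mono[of j N j] by (simp add: M_def)
      have "M * j \<le> N" by (simp add: M_def)
      hence le: "real M * real j \<le> real N" by (metis of_nat_le_iff of_nat_mult)
      \<comment> \<open>As \<open>M \<ge> 1\<close>, rounding \<open>N / j\<close> down loses less
        than a factor \<open>2\<close>, hence at most \<open>ln 2 \<le> 1\<close> in the
        logarithm.\<close>
      have "N < j * (M + 1)" using dividend_less_times_div[of j N] j by (simp add: M_def)
      also have "\<dots> \<le> j * (2 * M)" using M by simp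
      finally have lt: "real N \<le> real j * (2 * real M)" by (metis less_imp_le of_nat_le_iff of_nat_mult of_nat_numeral)
      have "ln (real M) + ln (real j) \<le> ln (real N)"
        using le M j by (subst ln_mult_pos[symmetric]) auto
      moreover have "ln (real N) \<le> ln (real j * (2 * real M))" using lt j M by (subst ln_le_cancel_iff) auto
      hence "ln (real N) \<le> ln (real j) + ln 2 + ln (real M)" using j M by (simp add: ln_mult_pos)
      moreover have "ln (2::real) \<le> 1" using ln_le_minus_one[of "2::real"] by simp
      ultimately have "\<bar>ln (real M) - (ln (real N) - ln (real j))\<bar> \<le> 1" by linarith
      hence "\<delta> * \<bar>ln (real M) - (ln (real N) - ln (real j))\<bar> \<le> \<delta> * 1" using \<delta> by (intro mult_left_mono)
      hence "\<bar>\<delta> * ln (real M) - \<delta> * (ln (real N) - ln (real j))\<bar> \<le> \<delta>"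
        using \<delta> by (simp add: abs_mult right_diff_distrib[symmetric] del: right_diff_distrib_numeral)
      hence "\<bar>prime_log_sum (- A) M - \<delta> * (ln (real N) - ln (real j))\<bar> \<le> C + \<delta>"
        using dens[OF M] by linarith
      thus "\<bar>c j * (prime_log_sum (- A) (N div j) - \<delta> * (ln (real N) - ln (real j)))\<bar> \<le> c j * (C + \<delta>)"
        using c0[of j] by (simp add: abs_mult M_def mult_left_mono)
    qed
    also have "\<dots> = (C + \<delta>) * f N" by (simp add: f_eq sum_distrib_left mult.commute)
    finally have *: "\<bar>?R - \<delta> * (f N * ln (real N) - T N)\<bar> \<le> (C + \<delta>) * f N" .
    have "(1 + \<delta>) * T N - \<delta> * (f N * ln (real N)) = (T N - ?R) + (?R - \<delta> * (f N * ln (real N) - T N))"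
      by (simp add: algebra_simps)
    thus ?thesis using * C'[of N] by (simp add: distrib_right)
  qed
  hence "\<exists>K>0. (\<lambda>N. (\<Sum>n=1..N. c n) / ln (real N) powr \<delta>) \<longlonglongrightarrow> K"
    unfolding T_def f_eq using \<delta> c0 orbit_weight_pos[of ?S 1]
    by (intro regular_growth) (auto simp: c_def)
  thus ?thesis by (simp add: orbit_sum_def c_def)
qed

subsection \<open>Prescribing the growth constant\<close>

lemma orbit_weight_cong_divisors:
  assumes A: "\<And>q. q \<in> A \<Longrightarrow> prime q" "\<And>q. q \<in> A' \<Longrightarrow> prime q"
    and eq: "\<And>q. q dvd n \<Longrightarrow> q \<in> A \<longleftrightarrow> q \<in> A'" and n: "n \<ge> 1"
  shows "orbit_weight (mersenne_primes A) n = orbit_weight (mersenne_primes A') n"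
proof -
  have "S_part (mersenne_primes A) (mersenne n) = S_part (mersenne_primes A') (mersenne n)"
  proof (rule S_part_eqI)
    fix p :: nat assume "prime p"
    have "p \<in> mersenne_primes A \<longleftrightarrow> p \<in> mersenne_primes A'" if "p dvd mersenne n"
      using that eq A by (auto simp: mersenne_prime_factor_dvd_iff)
    moreover have "multiplicity p (mersenne n) = 0" if "\<not> p dvd mersenne n"
      using that by (rule not_dvd_imp_multiplicity_0)
    ultimately show "(if p \<in> mersenne_primes A then multiplicity p (mersenne n) else 0) =
        (if p \<in> mersenne_primes A' then multiplicity p (mersenne n) else 0)"
      by (cases "p dvd mersenne n") simp_all
  qed (use n mersenne_pos in auto)
  thus ?thesis by (simp add: orbit_weight_def)
qed

text \<open>A prime \<open>q > N\<close> divides no \<open>n\<close> in the range, so its chosen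
  divisor divides none of the Mersenne numbers involved. At fixed \<open>N\<close> an infinite
  process of insertions may therefore be stopped.\<close>

lemma orbit_sum_cong_atMost:
  assumes A: "\<And>q. q \<in> A \<Longrightarrow> prime q" "\<And>q. q \<in> A' \<Longrightarrow> prime q"
    and eq: "A \<inter> {..N} = A' \<inter> {..N}"
  shows "orbit_sum (mersenne_primes A) N = orbit_sum (mersenne_primes A') N"
  unfolding orbit_sum_def
proof (intro sum.cong refl)
  fix n assume n: "n \<in> {1..N}"
  have "q \<in> A \<longleftrightarrow> q \<in> A'" if "q dvd n" for q
  proof -
    have "q \<le> N" using n that dvd_imp_le[of q n] by auto
    thus ?thesis using eq by blast
  qed
  thus "orbit_weight (mersenne_primes A) n / real n = orbit_weight (mersenne_primes A') n / real n"
    using orbit_weight_cong_divisors[OF A] n by auto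
qed

lemma orbit_sum_antimono: "S \<subseteq> S' \<Longrightarrow> orbit_sum S' N \<le> orbit_sum S N"
  unfolding orbit_sum_def by (intro sum_mono divide_right_mono orbit_weight_antimono_subset) auto

text \<open>Weights at indices not divisible by \<open>q\<close> do not change, and the multiples of
  \<open>q\<close> carry at most a share \<open>1 / q\<close> beforehand.\<close>

lemma orbit_sum_insert_ge:
  assumes A: "\<And>r. r \<in> A \<Longrightarrow> prime r" and q: "prime q"
  shows "orbit_sum (mersenne_primes (insert q A)) N
    \<ge> orbit_sum (mersenne_primes A) N - orbit_sum (mersenne_primes A) N / real q"
proof -
  let ?S = "mersenne_primes A" and ?S' = "mersenne_primes (insert q A)"
  have q1: "q \<ge> 1" using q by (simp add: prime_gt_0_nat Suc_le_eq)
  have "orbit_sum ?S N - orbit_sum ?S N / real q \<le> (\<Sum>n | n \<in> {1..N} \<and> \<not> q dvd n. orbit_weight ?S n / real n)"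
    using orbit_sum_split_multiples[of ?S N q] orbit_sum_multiples_le[OF q1, where N = N and S = ?S] by linarith
  also have "\<dots> = (\<Sum>n | n \<in> {1..N} \<and> \<not> q dvd n. orbit_weight ?S' n / real n)"
    using orbit_weight_insert_eq[OF q] by (intro sum.cong) auto
  also have "\<dots> \<le> orbit_sum ?S' N"
    unfolding orbit_sum_def by (intro sum_mono2) (auto simp: less_imp_le orbit_weight_pos)
  finally show ?thesis .
qed

text \<open>The constant \<open>4\<close> is \<open>2 * 2\<close>. At multiples of \<open>q\<close>
  the new prime at least halves the weight, and these multiples carry at least
  \<open>1 / (2 q)\<close> times the sum up to \<open>N div q\<close>. This second \<open>2\<close>
  accounts for the case that \<open>q\<close> is the divisor chosen for some
  \<open>r \<in> A\<close>, where a share \<open>1 / r \<le> 1 / 2\<close> may be lost.\<close>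

lemma orbit_sum_insert_le:
  assumes A: "\<And>r. r \<in> A \<Longrightarrow> prime r" and q: "prime q" "q \<notin> A"
  shows "orbit_sum (mersenne_primes (insert q A)) N
    \<le> orbit_sum (mersenne_primes A) N - orbit_sum (mersenne_primes A) (N div q) / (4 * real q)"
proof -
  let ?S = "mersenne_primes A" and ?S' = "mersenne_primes (insert q A)"
  let ?M = "N div q"
  have q1: "q \<ge> 1" using q by (simp add: prime_gt_0_nat Suc_le_eq)
  have half: "orbit_sum ?S ?M / 2 \<le> (\<Sum>j=1..?M. orbit_weight ?S (q * j) / real j)"
  proof (cases "q \<in> ?S")
    case True
    then obtain r where r: "r \<in> A" "q = mersenne_prime_factor r" by blast
    have "real r \<ge> 2" using prime_ge_2_nat[OF A[OF r(1)]] by simp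
    hence "orbit_sum ?S ?M / real r \<le> orbit_sum ?S ?M / 2"
      by (intro divide_left_mono orbit_sum_nonneg) auto
    moreover have "(\<Sum>j=1..?M. orbit_weight ?S (q * j) / real j) \<ge> orbit_sum ?S ?M - orbit_sum ?S ?M / real r"
      using orbit_sum_dilate_notin_ge[OF A q r] .
    ultimately show ?thesis by linarith
  next
    case False
    show ?thesis using orbit_sum_dilate_notin_eq[OF A q False, of ?M] orbit_sum_nonneg[of ?S ?M] by simp
  qed
  have "orbit_sum ?S ?M / (4 * real q) = orbit_sum ?S ?M / 2 / (2 * real q)" by simp
  also have "\<dots> \<le> (\<Sum>j=1..?M. orbit_weight ?S (q * j) / real j) / (2 * real q)"
    by (intro divide_right_mono half) auto
  also have "\<dots> = (\<Sum>j=1..?M. orbit_weight ?S (q * j) / 2 / real (q * j))"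
    by (simp add: sum_divide_distrib mult_ac)
  also have "\<dots> \<le> (\<Sum>j=1..?M. orbit_weight ?S (q * j) / real (q * j) - orbit_weight ?S' (q * j) / real (q * j))"
  proof (rule sum_mono)
    fix j assume "j \<in> {1..?M}"
    hence "orbit_weight ?S (q * j) / 2 \<le> orbit_weight ?S (q * j) - orbit_weight ?S' (q * j)"
      using orbit_weight_insert_le[OF A q, of j] by auto
    hence "orbit_weight ?S (q * j) / 2 / real (q * j) \<le> (orbit_weight ?S (q * j) - orbit_weight ?S' (q * j)) / real (q * j)"
      by (intro divide_right_mono) auto
    thus "orbit_weight ?S (q * j) / 2 / real (q * j) \<le> orbit_weight ?S (q * j) / real (q * j) - orbit_weight ?S' (q * j) / real (q * j)"
      by (simp add: diff_divide_distrib)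
  qed
  also have "\<dots> = (\<Sum>n | n \<in> {1..N} \<and> q dvd n. orbit_weight ?S n / real n) - (\<Sum>n | n \<in> {1..N} \<and> q dvd n. orbit_weight ?S' n / real n)"
    by (simp only: sum_multiples[OF q1] sum_subtractf)
  also have "\<dots> = orbit_sum ?S N - orbit_sum ?S' N"
  proof -
    have "(\<Sum>n | n \<in> {1..N} \<and> \<not> q dvd n. orbit_weight ?S n / real n) = (\<Sum>n | n \<in> {1..N} \<and> \<not> q dvd n. orbit_weight ?S' n / real n)"
      using orbit_weight_insert_eq[OF q(1)] by (intro sum.cong) auto
    thus ?thesis using orbit_sum_split_multiples[of ?S N q] orbit_sum_split_multiples[of ?S' N q] by linarith
  qed
  finally show ?thesis by linarith
qed

text \<open>Here \<open>\<delta>\<close> measures the primes outside \<open>A\<close>, those that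
  may divide the surviving integers; it becomes the exponent of the logarithm.\<close>

definition sieving_set :: "real \<Rightarrow> nat set \<Rightarrow> bool" where
  "sieving_set \<delta> A \<longleftrightarrow> (\<forall>q\<in>A. prime q) \<and> (\<exists>C. \<forall>N\<ge>1. \<bar>prime_log_sum (- A) N - \<delta> * ln (real N)\<bar> \<le> C)"

text \<open>\<open>lim\<close> is total; for sieving sets with \<open>\<delta> \<ge> 0\<close> the
  limit exists and is positive by \<open>orbit_sum_regular\<close>.\<close>

definition growth_constant :: "real \<Rightarrow> nat set \<Rightarrow> real" where
  "growth_constant \<delta> A = lim (\<lambda>N. orbit_sum (mersenne_primes A) N / ln (real N) powr \<delta>)"

lemma sieving_setD: "sieving_set \<delta> A \<Longrightarrow> q \<in> A \<Longrightarrow> prime q"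
  by (simp add: sieving_set_def)

lemma
  assumes "sieving_set \<delta> A" "0 \<le> \<delta>"
  shows growth_constant_pos: "growth_constant \<delta> A > 0"
    and growth_constant_lim: "(\<lambda>N. orbit_sum (mersenne_primes A) N / ln (real N) powr \<delta>) \<longlonglongrightarrow> growth_constant \<delta> A"
proof -
  obtain K where K: "K > 0" "(\<lambda>N. orbit_sum (mersenne_primes A) N / ln (real N) powr \<delta>) \<longlonglongrightarrow> K"
    using orbit_sum_regular[of A \<delta>] assms unfolding sieving_set_def by blast
  hence "growth_constant \<delta> A = K" unfolding growth_constant_def by (intro limI)
  thus "growth_constant \<delta> A > 0"
    "(\<lambda>N. orbit_sum (mersenne_primes A) N / ln (real N) powr \<delta>) \<longlonglongrightarrow> growth_constant \<delta> A"
    using K by auto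
qed

lemma prime_log_sum_finite_change:
  assumes "finite F" "\<And>p. p \<notin> F \<Longrightarrow> p \<in> X \<longleftrightarrow> p \<in> Y"
  shows "\<bar>prime_log_sum X N - prime_log_sum Y N\<bar> \<le> (\<Sum>p\<in>F. \<bar>ln (real p) / real p\<bar>)"
proof -
  have split: "prime_log_sum Z N = (\<Sum>p | p \<in> {1..N} \<and> prime p \<and> p \<in> Z \<and> p \<notin> F. ln (real p) / real p) +
     (\<Sum>p | p \<in> {1..N} \<and> prime p \<and> p \<in> Z \<and> p \<in> F. ln (real p) / real p)" for Z
    unfolding prime_log_sum_def by (subst sum.union_disjoint[symmetric]) (auto intro!: sum.cong)
  have eq: "(\<Sum>p | p \<in> {1..N} \<and> prime p \<and> p \<in> X \<and> p \<notin> F. ln (real p) / real p) =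
      (\<Sum>p | p \<in> {1..N} \<and> prime p \<and> p \<in> Y \<and> p \<notin> F. ln (real p) / real p)"
    using assms by (intro sum.cong) auto
  have lo: "0 \<le> (\<Sum>p | p \<in> {1..N} \<and> prime p \<and> p \<in> Z \<and> p \<in> F. ln (real p) / real p)" for Z
    by (intro sum_nonneg) auto
  have up: "(\<Sum>p | p \<in> {1..N} \<and> prime p \<and> p \<in> Z \<and> p \<in> F. ln (real p) / real p) \<le> (\<Sum>p\<in>F. \<bar>ln (real p) / real p\<bar>)" for Z
    by (rule order_trans[OF sum_mono[OF abs_ge_self] sum_mono2]) (use assms in auto)
  show ?thesis using eq split[of X] split[of Y] lo[of X] lo[of Y] up[of X] up[of Y] by linarith
qed

lemma sieving_set_finite_change:
  assumes "sieving_set \<delta> A" "finite F" "\<And>p. p \<notin> F \<Longrightarrow> p \<in> A \<longleftrightarrow> p \<in> A'" "\<And>q. q \<in> A' \<Longrightarrow> prime q"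
  shows "sieving_set \<delta> A'"
proof -
  obtain C where C: "\<And>N. N \<ge> 1 \<Longrightarrow> \<bar>prime_log_sum (- A) N - \<delta> * ln (real N)\<bar> \<le> C"
    using assms(1) by (auto simp: sieving_set_def)
  have "\<bar>prime_log_sum (- A') N - \<delta> * ln (real N)\<bar> \<le> C + (\<Sum>p\<in>F. \<bar>ln (real p) / real p\<bar>)" if "N \<ge> 1" for N
    using C[OF that] prime_log_sum_finite_change[of F "- A" "- A'" N] assms by auto
  thus ?thesis using assms(4) by (auto simp: sieving_set_def)
qed

text \<open>The insertion bounds for sums are divided by \<open>ln N powr \<delta>\<close> and
  passed to the limit. The upper one involves the sum up to \<open>N div q\<close>, which has the
  same limit because \<open>ln (N div q) / ln N\<close> tends to \<open>1\<close>.\<close>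

lemma
  assumes A: "sieving_set \<delta> A" and \<delta>: "0 \<le> \<delta>" and q: "prime q" "q \<notin> A"
  shows growth_constant_insert_ge: "growth_constant \<delta> (insert q A) \<ge> (1 - 1 / real q) * growth_constant \<delta> A"
    and growth_constant_insert_le: "growth_constant \<delta> (insert q A) \<le> (1 - 1 / (4 * real q)) * growth_constant \<delta> A"
proof -
  let ?f = "orbit_sum (mersenne_primes A)" and ?f' = "orbit_sum (mersenne_primes (insert q A))"
  let ?K = "growth_constant \<delta> A" and ?K' = "growth_constant \<delta> (insert q A)"
  let ?L = "\<lambda>N. ln (real N) powr \<delta>"
  have pr: "\<And>r. r \<in> A \<Longrightarrow> prime r" using A by (rule sieving_setD)
  have A': "sieving_set \<delta> (insert q A)"
    by (rule sieving_set_finite_change[OF A, of "{q}"]) (use q pr in auto)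
  note lim = growth_constant_lim[OF A \<delta>] and lim' = growth_constant_lim[OF A' \<delta>]
  have "(\<lambda>N. (1 - 1 / real q) * (?f N / ?L N)) \<longlonglongrightarrow> (1 - 1 / real q) * ?K"
    by (intro tendsto_mult tendsto_const lim)
  thus "?K' \<ge> (1 - 1 / real q) * ?K"
  proof (rule LIMSEQ_le[OF _ lim'])
    have "(1 - 1 / real q) * (?f N / ?L N) \<le> ?f' N / ?L N" for N
    proof -
      have "(?f N - ?f N / real q) / ?L N \<le> ?f' N / ?L N"
        by (intro divide_right_mono orbit_sum_insert_ge pr q) auto
      thus ?thesis by (simp add: algebra_simps diff_divide_distrib)
    qed
    thus "\<exists>M. \<forall>N\<ge>M. (1 - 1 / real q) * (?f N / ?L N) \<le> ?f' N / ?L N" by blast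
  qed
  have q0: "q > 0" using q by (simp add: prime_gt_0_nat)
  have divtop: "filterlim (\<lambda>N. N div q) at_top sequentially"
  proof -
    have "\<forall>\<^sub>F N in sequentially. Z \<le> N div q" for Z
      using eventually_ge_at_top[of "Z * q"]
      by eventually_elim (use q0 in \<open>simp add: less_eq_div_iff_mult_less_eq\<close>)
    thus ?thesis by (simp add: filterlim_at_top)
  qed
  have ratio: "(\<lambda>N. ln (real (N div q)) / ln (real N)) \<longlonglongrightarrow> 1"
  proof (rule tendsto_sandwich)
    have q': "real q > 0" using q0 by simp
    show "(\<lambda>N. (ln (real N) - ln (2 * real q)) / ln (real N)) \<longlonglongrightarrow> 1" by real_asymp
    show "(\<lambda>N. 1) \<longlonglongrightarrow> (1::real)" by simp
    show "\<forall>\<^sub>F N in sequentially. ln (real (N div q)) / ln (real N) \<le> 1"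
      using eventually_ge_at_top[of "2 * q"]
    proof eventually_elim
      case (elim N)
      hence "N div q > 0" "N \<ge> 2" using q0 by (auto simp: div_greater_zero_iff)
      moreover have "N div q \<le> N" by simp
      ultimately have "ln (real (N div q)) \<le> ln (real N)" "ln (real N) > 0" by (auto simp del: div_le_dividend)
      thus ?case by simp
    qed
    show "\<forall>\<^sub>F N in sequentially. (ln (real N) - ln (2 * real q)) / ln (real N) \<le> ln (real (N div q)) / ln (real N)"
      using eventually_ge_at_top[of "2 * q"]
    proof eventually_elim
      case (elim N)
      define M where "M = N div q"
      have M: "M > 0" "N \<ge> 2" using q0 elim by (auto simp: div_greater_zero_iff M_def)
      have "N < q * (M + 1)" using dividend_less_times_div[of q N] q0 by (simp add: M_def)
      also have "\<dots> \<le> q * (2 * M)" using M by simp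
      finally have "real N \<le> real q * (2 * real M)" by (metis less_imp_le of_nat_le_iff of_nat_mult of_nat_numeral)
      hence "ln (real N) \<le> ln (2 * real q * real M)" using M by (subst ln_le_cancel_iff) (auto simp: mult_ac)
      also have "\<dots> = ln (2 * real q) + ln (real M)" using M q0 by (subst ln_mult_pos) auto
      finally show ?case using M unfolding M_def[symmetric] by (intro divide_right_mono) auto
    qed
  qed
  have "(\<lambda>N. ?f (N div q) / ?L (N div q) * (ln (real (N div q)) / ln (real N)) powr \<delta>) \<longlonglongrightarrow> ?K * 1 powr \<delta>"
    by (intro tendsto_mult tendsto_powr ratio tendsto_const filterlim_compose[OF lim divtop]) auto
  moreover have "\<forall>\<^sub>F N in sequentially. ?f (N div q) / ?L (N div q) * (ln (real (N div q)) / ln (real N)) powr \<delta> = ?f (N div q) / ?L N"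
    using eventually_ge_at_top[of "2 * q"]
  proof eventually_elim
    case (elim N)
    hence "N div q \<ge> 2" using q0 by (simp add: less_eq_div_iff_mult_less_eq)
    moreover have "N \<ge> N div q" by simp
    ultimately have "N \<ge> 2" by linarith
    thus ?case using \<open>N div q \<ge> 2\<close> by (simp add: powr_divide)
  qed
  ultimately have lim2: "(\<lambda>N. ?f (N div q) / ?L N) \<longlonglongrightarrow> ?K"
    using Lim_transform_eventually by fastforce
  have "(\<lambda>N. ?f N / ?L N - (?f (N div q) / ?L N) / (4 * real q)) \<longlonglongrightarrow> ?K - ?K / (4 * real q)"
    using q0 by (intro tendsto_diff tendsto_divide tendsto_const lim lim2) auto
  hence "?K' \<le> ?K - ?K / (4 * real q)"
  proof (rule LIMSEQ_le[OF lim'])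
    have "?f' N / ?L N \<le> ?f N / ?L N - (?f (N div q) / ?L N) / (4 * real q)" for N
    proof -
      have "?f' N / ?L N \<le> (?f N - ?f (N div q) / (4 * real q)) / ?L N"
        by (intro divide_right_mono orbit_sum_insert_le pr q) auto
      thus ?thesis by (simp add: diff_divide_distrib mult.commute)
    qed
    thus "\<exists>M. \<forall>N\<ge>M. ?f' N / ?L N \<le> ?f N / ?L N - (?f (N div q) / ?L N) / (4 * real q)" by blast
  qed
  thus "?K' \<le> (1 - 1 / (4 * real q)) * ?K" by (simp add: left_diff_distrib)
qed

text \<open>If the reciprocals had bounded sums, their tail beyond some \<open>m\<close> would be
  below \<open>c / 2\<close>; with \<open>ln p \<le> ln N\<close> in the tail, the logarithmic sum
  would be at most \<open>c / 2 * ln N\<close> plus a constant.\<close>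

lemma sum_reciprocals_unbounded:
  assumes c: "c > 0" and X: "\<And>N. N \<ge> 1 \<Longrightarrow> prime_log_sum X N \<ge> c * ln (real N) - C"
  shows "\<exists>n. (\<Sum>p | p \<in> {1..n} \<and> prime p \<and> p \<in> X. 1 / real p) > b"
proof (rule ccontr)
  define s where "s n = (\<Sum>p | p \<in> {1..n} \<and> prime p \<and> p \<in> X. 1 / real p)" for n
  assume "\<not> ?thesis"
  hence le: "s n \<le> b" for n by (auto simp: s_def not_less)
  have "incseq s" unfolding s_def incseq_def by (intro allI impI sum_mono2) auto
  then obtain l where l: "s \<longlonglongrightarrow> l" "\<And>n. s n \<le> l" using incseq_convergent[of s b] le by blast
  have "\<forall>\<^sub>F n in sequentially. s n > l - c / 2" using l(1) c by (intro order_tendstoD) auto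
  then obtain m where m: "s m > l - c / 2" by (auto simp: eventually_sequentially)
  have "c * ln (real N) - C \<le> prime_log_sum X m + c / 2 * ln (real N)" if N: "N \<ge> max 1 m" for N
  proof -
    have "prime_log_sum X N = prime_log_sum X m + (\<Sum>p | p \<in> {1..N} \<and> p > m \<and> prime p \<and> p \<in> X. ln (real p) / real p)"
      unfolding prime_log_sum_def using N by (subst sum.union_disjoint[symmetric]) (auto intro!: sum.cong)
    also have "(\<Sum>p | p \<in> {1..N} \<and> p > m \<and> prime p \<and> p \<in> X. ln (real p) / real p) \<le>
        (\<Sum>p | p \<in> {1..N} \<and> p > m \<and> prime p \<and> p \<in> X. ln (real N) / real p)"
      by (intro sum_mono divide_right_mono) auto
    also have "\<dots> = ln (real N) * (\<Sum>p | p \<in> {1..N} \<and> p > m \<and> prime p \<and> p \<in> X. 1 / real p)"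
      by (simp add: sum_distrib_left)
    also have "(\<Sum>p | p \<in> {1..N} \<and> p > m \<and> prime p \<and> p \<in> X. 1 / real p) = s N - s m"
    proof -
      have "s N = s m + (\<Sum>p | p \<in> {1..N} \<and> p > m \<and> prime p \<and> p \<in> X. 1 / real p)"
        unfolding s_def using N by (subst sum.union_disjoint[symmetric]) (auto intro!: sum.cong)
      thus ?thesis by simp
    qed
    also have "ln (real N) * (s N - s m) \<le> ln (real N) * (c / 2)"
      using m l(2)[of N] N by (intro mult_left_mono) auto
    finally show ?thesis using X[of N] N by (simp add: mult.commute)
  qed
  hence bd: "c / 2 * ln (real N) \<le> prime_log_sum X m + C" if "N \<ge> max 1 m" for N
    using that by (fastforce simp: algebra_simps)
  have "filterlim (\<lambda>N. c / 2 * ln (real N)) at_top sequentially" using c by real_asymp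
  hence "\<forall>\<^sub>F N in sequentially. c / 2 * ln (real N) > prime_log_sum X m + C"
    by (rule filterlim_at_top_dense[THEN iffD1, rule_format])
  then obtain N0 where "\<And>N. N \<ge> N0 \<Longrightarrow> c / 2 * ln (real N) > prime_log_sum X m + C"
    by (auto simp: eventually_sequentially)
  from this[of "max N0 (max 1 m)"] bd[of "max N0 (max 1 m)"] show False by simp
qed

text \<open>Removing a prime \<open>p\<close> multiplies the constant by at least
  \<open>exp (1 / (4 p))\<close>. The primes of \<open>A\<close> have logarithmic density
  \<open>1 - \<delta> > 0\<close>, so their reciprocals have unbounded sums.\<close>

lemma large_growth_constant_exists:
  assumes A: "sieving_set \<delta> A" and \<delta>: "0 \<le> \<delta>" "\<delta> < 1"
  shows "\<exists>A'. sieving_set \<delta> A' \<and> growth_constant \<delta> A' \<ge> k"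
proof -
  define R where "R n = A - {..n}" for n
  have pr: "\<And>r. r \<in> A \<Longrightarrow> prime r" using A by (rule sieving_setD)
  have R: "sieving_set \<delta> (R n)" for n
    by (rule sieving_set_finite_change[OF A, of "{..n}"]) (use pr in \<open>auto simp: R_def\<close>)
  define s where "s n = (\<Sum>p | p \<in> {1..n} \<and> prime p \<and> p \<in> A. 1 / real p)" for n
  have le: "growth_constant \<delta> A \<le> exp (- s n / 4) * growth_constant \<delta> (R n)" for n
  proof (induction n)
    case 0
    have "R 0 = A" using pr by (auto simp: R_def dest: prime_gt_0_nat)
    thus ?case by (simp add: s_def)
  next
    case (Suc n)
    show ?case
    proof (cases "Suc n \<in> A")
      case True
      have eq: "R n = insert (Suc n) (R (Suc n))" using True by (auto simp: R_def)
      have "growth_constant \<delta> (R n) \<le> (1 - 1 / (4 * real (Suc n))) * growth_constant \<delta> (R (Suc n))"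
        unfolding eq using True pr by (intro growth_constant_insert_le R \<delta>) (auto simp: R_def)
      also have "\<dots> \<le> exp (- (1 / (4 * real (Suc n)))) * growth_constant \<delta> (R (Suc n))"
        using growth_constant_pos[OF R \<delta>(1), of "Suc n"] exp_ge_add_one_self[of "- (1 / (4 * real (Suc n)))"]
        by (intro mult_right_mono) auto
      finally have "exp (- s n / 4) * growth_constant \<delta> (R n) \<le>
          exp (- s n / 4) * (exp (- (1 / (4 * real (Suc n)))) * growth_constant \<delta> (R (Suc n)))"
        by (intro mult_left_mono) auto
      also have "\<dots> = exp (- s n / 4 + - (1 / (4 * real (Suc n)))) * growth_constant \<delta> (R (Suc n))"
        by (simp only: exp_add mult.assoc)
      also have "- s n / 4 + - (1 / (4 * real (Suc n))) = - s (Suc n) / 4"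
      proof -
        have "{p. p \<in> {1..Suc n} \<and> prime p \<and> p \<in> A} = insert (Suc n) {p. p \<in> {1..n} \<and> prime p \<and> p \<in> A}"
          using True pr by auto
        thus ?thesis by (simp add: s_def field_simps)
      qed
      finally show ?thesis using Suc by simp
    next
      case False
      have "R (Suc n) = R n" using False by (auto simp: R_def) (metis le_SucE)+
      moreover have "{p. p \<in> {1..Suc n} \<and> prime p \<and> p \<in> A} = {p. p \<in> {1..n} \<and> prime p \<and> p \<in> A}"
        using False by (auto simp: le_Suc_eq)
      ultimately show ?thesis using Suc by (simp add: s_def)
    qed
  qed
  obtain C1 where C1: "\<And>N. N \<ge> 1 \<Longrightarrow> \<bar>prime_log_sum UNIV N - ln (real N)\<bar> \<le> C1"
    using mertens_first by blast
  obtain C2 where C2: "\<And>N. N \<ge> 1 \<Longrightarrow> \<bar>prime_log_sum (- A) N - \<delta> * ln (real N)\<bar> \<le> C2"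
    using A by (auto simp: sieving_set_def)
  have split: "prime_log_sum UNIV N = prime_log_sum A N + prime_log_sum (- A) N" for N
    unfolding prime_log_sum_def by (subst sum.union_disjoint[symmetric]) (auto intro!: sum.cong)
  have "prime_log_sum A N \<ge> (1 - \<delta>) * ln (real N) - (C1 + C2)" if "N \<ge> 1" for N
    using split[of N] C1[OF that] C2[OF that] by (simp add: algebra_simps)
  \<comment> \<open>The sign of \<open>k\<close> is open here; \<open>max 1 k\<close> keeps the
    argument of the logarithm positive.\<close>
  from sum_reciprocals_unbounded[OF _ this] obtain n where n: "s n > 4 * ln (max 1 k / growth_constant \<delta> A)"
    using \<delta> unfolding s_def by fastforce
  have K0: "growth_constant \<delta> A > 0" by (rule growth_constant_pos[OF A \<delta>(1)])
  have "max 1 k = exp (ln (max 1 k / growth_constant \<delta> A)) * growth_constant \<delta> A"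
    using K0 by (subst exp_ln) auto
  also have "\<dots> \<le> exp (s n / 4) * growth_constant \<delta> A" using n K0 by (intro mult_right_mono iffD2[OF exp_le_cancel_iff]) auto
  also have "\<dots> \<le> exp (s n / 4) * (exp (- s n / 4) * growth_constant \<delta> (R n))"
    by (intro mult_left_mono le) auto
  also have "\<dots> = growth_constant \<delta> (R n)" by (simp add: exp_minus field_simps)
  finally show ?thesis using R by auto
qed

lemma sieving_set_exists:
  assumes "0 \<le> \<delta>" "\<delta> \<le> 1"
  shows "\<exists>A. sieving_set \<delta> A"
proof -
  obtain B C where B: "\<And>N. N \<ge> 1 \<Longrightarrow> \<bar>prime_log_sum B N - \<delta> * ln (real N)\<bar> \<le> C"
    using prime_set_of_density_exists[OF assms] by blast
  define A where "A = {p. prime p \<and> p \<notin> B}"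
  have "prime_log_sum (- A) N = prime_log_sum B N" for N
    unfolding prime_log_sum_def by (intro sum.cong) (auto simp: A_def)
  thus ?thesis using B by (intro exI[of _ A]) (auto simp: sieving_set_def A_def)
qed

text \<open>It suffices that refusals never stop, since each one brings the constant close to
  \<open>k\<close>. The constant stays at least \<open>k\<close> while each accepted prime
  \<open>q\<close> multiplies it by at most \<open>exp (- 1 / (4 q))\<close>; so the accepted
  reciprocals have a finite sum, unlike those of all primes outside \<open>A0\<close>.\<close>

lemma exact_growth_constant:
  assumes \<delta>: "0 < \<delta>" "\<delta> < 1" and k: "k > 0"
  shows "\<exists>A. (\<forall>q\<in>A. prime q) \<and>
     (\<lambda>N. orbit_sum (mersenne_primes A) N / ln (real N) powr \<delta>) \<longlonglongrightarrow> k"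
proof -
  have \<delta>0: "0 \<le> \<delta>" using \<delta> by simp
  obtain A0 where A0: "sieving_set \<delta> A0" "growth_constant \<delta> A0 \<ge> k"
    using sieving_set_exists[of \<delta>] large_growth_constant_exists[of \<delta> _ k] \<delta> by force
  have pr0: "\<And>r. r \<in> A0 \<Longrightarrow> prime r" using A0(1) by (rule sieving_setD)
  let ?P = "\<lambda>n X. prime n \<and> n \<notin> A0 \<and> growth_constant \<delta> (insert n (A0 \<union> X)) \<ge> k"
  obtain E where E: "\<And>n. n \<in> E \<longleftrightarrow> ?P n (E \<inter> {..<n})"
    using greedy_set_exists[of ?P] by auto
  have prE: "\<And>r. r \<in> E \<Longrightarrow> prime r" using E by blast
  have notin: "\<And>r. r \<in> E \<Longrightarrow> r \<notin> A0" using E by blast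
  define D where "D n = A0 \<union> (E \<inter> {..<n})" for n
  have D0: "D 0 = A0" by (simp add: D_def)
  have D_in: "D (Suc n) = insert n (D n)" if "n \<in> E" for n
    using that by (auto simp: D_def less_Suc_eq)
  have D_notin: "D (Suc n) = D n" if "n \<notin> E" for n
    using that by (auto simp: D_def less_Suc_eq)
  have prD: "\<And>r n. r \<in> D n \<Longrightarrow> prime r" using pr0 prE by (auto simp: D_def)
  have n_notin: "n \<notin> D n" if "n \<in> E" for n using notin[OF that] by (auto simp: D_def)
  have sD: "sieving_set \<delta> (D n)" for n
    by (rule sieving_set_finite_change[OF A0(1), of "{..<n}"]) (use prD in \<open>auto simp: D_def\<close>)
  define u where "u n = growth_constant \<delta> (D n)" for n
  have u_ge: "u n \<ge> k" for n
  proof (induction n)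
    case (Suc n)
    thus ?case using E[of n] D_in[of n] D_notin[of n] by (cases "n \<in> E") (auto simp: u_def D_def)
  qed (use A0 D0 in \<open>simp add: u_def\<close>)
  have u_le: "u (Suc n) \<le> (1 - (if n \<in> E then 1 / real n else 0) / 4) * u n" for n
    using growth_constant_insert_le[OF sD \<delta>0 prE n_notin, of n] D_in[of n] D_notin[of n]
    by (auto simp: u_def mult.commute)
  define s where "s n = (\<Sum>i<n. if i \<in> E then 1 / real i else 0)" for n
  have u_exp: "u n \<le> u 0 * exp (- s n / 4)" for n
  proof (induction n)
    case (Suc n)
    let ?x = "if n \<in> E then 1 / real n else 0"
    have "u (Suc n) \<le> (1 - ?x / 4) * u n" by (rule u_le)
    also have "\<dots> \<le> exp (- ?x / 4) * u n"
      using exp_ge_add_one_self[of "- ?x / 4"] u_ge[of n] k by (intro mult_right_mono) auto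
    also have "\<dots> \<le> exp (- ?x / 4) * (u 0 * exp (- s n / 4))" by (intro mult_left_mono Suc) auto
    also have "\<dots> = u 0 * exp (- s n / 4 + - ?x / 4)" by (simp only: exp_add mult_ac)
    also have "- s n / 4 + - ?x / 4 = - s (Suc n) / 4" by (simp add: s_def field_simps)
    finally show ?case .
  qed (simp add: s_def)
  have u0: "u 0 > 0" using u_ge[of 0] k by linarith
  have s_bd: "s n \<le> 4 * ln (u 0 / k)" for n
  proof -
    have "k \<le> u 0 * exp (- s n / 4)" using u_ge[of n] u_exp[of n] by linarith
    hence "exp (s n / 4) \<le> u 0 / k" using k by (simp add: exp_minus field_simps)
    hence "s n / 4 \<le> ln (u 0 / k)" using u0 k by (subst ln_ge_iff) auto
    thus ?thesis by simp
  qed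
  have s_mono: "incseq s" unfolding incseq_def s_def by (intro allI impI sum_mono2) auto
  obtain \<sigma> where \<sigma>: "s \<longlonglongrightarrow> \<sigma>" "\<And>n. s n \<le> \<sigma>"
    using incseq_convergent[OF s_mono] s_bd by blast
  have u_dec: "u n \<le> u m" if "m \<le> n" for m n
  proof -
    have "u (Suc n) \<le> 1 * u n" for n
      by (rule order_trans[OF u_le], rule mult_right_mono) (use u_ge[of n] k in auto)
    thus ?thesis using lift_Suc_antimono_le[of u m n] that by simp
  qed
  have rejected: "\<exists>q\<ge>m. prime q \<and> q \<notin> A0 \<and> q \<notin> E" for m
  proof (rule ccontr)
    assume "\<not> ?thesis"
    hence *: "q \<in> E" if "q \<ge> m" "prime q" "q \<notin> A0" for q using that by blast
    obtain C where C: "\<And>N. N \<ge> 1 \<Longrightarrow> \<bar>prime_log_sum (- A0) N - \<delta> * ln (real N)\<bar> \<le> C"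
      using A0(1) by (auto simp: sieving_set_def)
    hence "prime_log_sum (- A0) N \<ge> \<delta> * ln (real N) - C" if "N \<ge> 1" for N
      using C[OF that] by linarith
    from sum_reciprocals_unbounded[OF \<delta>(1) this]
    \<comment> \<open>The sum over \<open>p < m\<close> covers the primes below \<open>m\<close>,
      which may have been refused; its term at \<open>0\<close> is \<open>1 / 0 = 0\<close>.\<close>
    obtain n where n: "(\<Sum>p | p \<in> {1..n} \<and> prime p \<and> p \<in> - A0. 1 / real p) > (\<Sum>p<m. 1 / real p) + \<sigma>"
      by blast
    have "(\<Sum>p | p \<in> {1..n} \<and> prime p \<and> p \<in> - A0. 1 / real p) \<le>
        (\<Sum>p\<in>{..<m} \<union> {p\<in>E. p < Suc n}. 1 / real p)"
      using * by (intro sum_mono2) (auto simp: not_less)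
    also have "\<dots> \<le> (\<Sum>p<m. 1 / real p) + (\<Sum>p\<in>{p\<in>E. p < Suc n}. 1 / real p)"
      by (subst sum_Un) (auto intro!: sum_nonneg)
    also have "(\<Sum>p\<in>{p\<in>E. p < Suc n}. 1 / real p) = s (Suc n)"
      unfolding s_def by (rule sum.mono_neutral_cong_left) auto
    also have "\<dots> \<le> \<sigma>" by (rule \<sigma>)
    finally show False using n by simp
  qed
  have u_lim: "u \<longlonglongrightarrow> k"
  proof (rule order_tendstoI)
    fix y assume "y < k"
    hence "y < u n" for n using u_ge[of n] by linarith
    thus "\<forall>\<^sub>F n in sequentially. y < u n" by simp
  next
    fix y assume y: "k < y"
    have "(\<lambda>n. (1 - 1 / real n) * y) \<longlonglongrightarrow> y" by real_asymp
    hence "\<forall>\<^sub>F n in sequentially. k < (1 - 1 / real n) * y" using y by (intro order_tendstoD)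
    then obtain m where m: "\<And>n. n \<ge> m \<Longrightarrow> k < (1 - 1 / real n) * y" by (auto simp: eventually_sequentially)
    obtain q where q: "q \<ge> m" "prime q" "q \<notin> A0" "q \<notin> E" using rejected by blast
    have "(1 - 1 / real q) * u q \<le> growth_constant \<delta> (insert q (D q))"
      unfolding u_def using q by (intro growth_constant_insert_ge sD \<delta>0) (auto simp: D_def)
    also have "\<dots> < k" using E[of q] q by (auto simp: D_def not_le)
    also have "\<dots> < (1 - 1 / real q) * y" using m q by blast
    finally have "u q < y" using prime_gt_1_nat[OF q(2)] by (subst (asm) mult_less_cancel_left_pos) auto
    hence "u n < y" if "n \<ge> q" for n using u_dec[OF that] by linarith
    thus "\<forall>\<^sub>F n in sequentially. u n < y" by (auto simp: eventually_sequentially)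
  qed
  \<comment> \<open>The relative error between stage \<open>m\<close> and the limit set is at most
    \<open>\<sigma> - s m\<close> for all \<open>N\<close> at once, so \<open>N\<close> may tend to
    infinity before \<open>m\<close> does.\<close>
  define A where "A = A0 \<union> E"
  have prA: "\<And>r. r \<in> A \<Longrightarrow> prime r" using pr0 prE by (auto simp: A_def)
  define f where "f X N = orbit_sum (mersenne_primes X) N" for X N
  define L where "L N = ln (real N) powr \<delta>" for N
  have upper: "f A N \<le> f (D m) N" for m N
    unfolding f_def by (rule orbit_sum_antimono) (auto simp: A_def D_def)
  have fD_dec: "f (D n) N \<le> f (D m) N" if "m \<le> n" for m n N
    unfolding f_def by (rule orbit_sum_antimono) (use that in \<open>auto simp: D_def\<close>)
  \<comment> \<open>Losses are added rather than multiplied: inserting \<open>n\<close> removes at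
    most \<open>f (D n) N / n\<close>, and this is at most \<open>f (D m) N / n\<close>.\<close>
  have fD_ge: "f (D n) N \<ge> f (D m) N - (s n - s m) * f (D m) N" if "m \<le> n" for m n N
    using that
  proof (induction n rule: dec_induct)
    case (step n)
    show ?case
    proof (cases "n \<in> E")
      case True
      have "f (D (Suc n)) N \<ge> f (D n) N - f (D n) N / real n"
        unfolding D_in[OF True] f_def by (rule orbit_sum_insert_ge[OF prD prE[OF True]])
      moreover have "f (D n) N / real n \<le> f (D m) N / real n"
        using step.hyps by (intro divide_right_mono fD_dec) auto
      ultimately show ?thesis using step.IH True by (simp add: s_def algebra_simps)
    next
      case False
      thus ?thesis using step.IH by (simp add: s_def D_notin)
    qed
  qed auto
  have lower: "f A N \<ge> (1 - (\<sigma> - s m)) * f (D m) N" for m N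
  proof -
    \<comment> \<open>\<open>D n\<close> contains only the elements of \<open>E\<close> strictly
      below \<open>n\<close>, so \<open>Suc N\<close> is the first index guaranteed to agree with
      \<open>A\<close> up to \<open>N\<close>.\<close>
    let ?n = "max m (Suc N)"
    have "f A N = f (D ?n) N"
      unfolding f_def by (rule orbit_sum_cong_atMost[OF prA prD]) (auto simp: A_def D_def)
    also have "\<dots> \<ge> f (D m) N - (s ?n - s m) * f (D m) N" by (rule fD_ge) simp
    also have "f (D m) N - (s ?n - s m) * f (D m) N = (1 - (s ?n - s m)) * f (D m) N" by (simp add: algebra_simps)
    also have "\<dots> \<ge> (1 - (\<sigma> - s m)) * f (D m) N"
      using \<sigma>(2)[of ?n] orbit_sum_nonneg by (intro mult_right_mono) (auto simp: f_def)
    finally show ?thesis .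
  qed
  have limD: "(\<lambda>N. f (D m) N / L N) \<longlonglongrightarrow> u m" for m
    unfolding f_def L_def u_def by (rule growth_constant_lim[OF sD \<delta>0])
  have L0: "L N \<ge> 0" for N by (simp add: L_def)
  have "(\<lambda>N. f A N / L N) \<longlonglongrightarrow> k"
  proof (rule order_tendstoI)
    fix y assume y: "y < k"
    have "(\<lambda>m. (1 - (\<sigma> - s m)) * u m) \<longlonglongrightarrow> (1 - (\<sigma> - \<sigma>)) * k" by (intro tendsto_intros \<sigma> u_lim)
    hence "\<forall>\<^sub>F m in sequentially. y < (1 - (\<sigma> - s m)) * u m" using y by (intro order_tendstoD) auto
    then obtain m where m: "y < (1 - (\<sigma> - s m)) * u m" by (auto simp: eventually_sequentially)
    have "(\<lambda>N. (1 - (\<sigma> - s m)) * (f (D m) N / L N)) \<longlonglongrightarrow> (1 - (\<sigma> - s m)) * u m"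
      by (intro tendsto_mult tendsto_const limD)
    hence "\<forall>\<^sub>F N in sequentially. y < (1 - (\<sigma> - s m)) * (f (D m) N / L N)" using m by (intro order_tendstoD)
    thus "\<forall>\<^sub>F N in sequentially. y < f A N / L N"
    proof eventually_elim
      case (elim N)
      have "(1 - (\<sigma> - s m)) * f (D m) N / L N \<le> f A N / L N"
        by (intro divide_right_mono lower L0)
      thus ?case using elim by simp
    qed
  next
    fix y assume y: "k < y"
    have "\<forall>\<^sub>F m in sequentially. u m < y" using u_lim y by (intro order_tendstoD)
    then obtain m where m: "u m < y" by (auto simp: eventually_sequentially)
    have "\<forall>\<^sub>F N in sequentially. f (D m) N / L N < y" using limD m by (intro order_tendstoD)
    thus "\<forall>\<^sub>F N in sequentially. f A N / L N < y"
    proof eventually_elim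
      case (elim N)
      have "f A N / L N \<le> f (D m) N / L N" by (intro divide_right_mono upper L0)
      thus ?case using elim by simp
    qed
  qed
  thus ?thesis using prA unfolding f_def L_def by blast
qed

subsection \<open>Characters of the S-integers and periodic points\<close>

text \<open>The admissible denominators in \<open>S_integers S\<close>; equivalently, the positive
  integers that are units of this ring.\<close>

definition smooth :: "nat set \<Rightarrow> nat \<Rightarrow> bool" where
  "smooth S b \<longleftrightarrow> b > 0 \<and> (\<forall>p. prime p \<longrightarrow> p dvd b \<longrightarrow> p \<in> S)"

lemma smooth_1: "smooth S 1"
  by (auto simp: smooth_def)

lemma smooth_pos: "smooth S b \<Longrightarrow> b > 0"
  by (simp add: smooth_def)

lemma smooth_mult: "smooth S b \<Longrightarrow> smooth S c \<Longrightarrow> smooth S (b * c)"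
  by (auto simp: smooth_def prime_dvd_mult_iff)

lemma smooth_prod: "finite I \<Longrightarrow> (\<And>i. i \<in> I \<Longrightarrow> smooth S (b i)) \<Longrightarrow> smooth S (\<Prod>i\<in>I. b i)"
  by (induction I rule: finite_induct) (auto intro: smooth_mult simp: smooth_1[simplified])

lemma smooth_S_part: "m > 0 \<Longrightarrow> smooth S (S_part S m)"
  using S_part_pos prime_dvd_S_part by (auto simp: smooth_def)

lemma coprime_smooth_cofactor:
  assumes "smooth S b" "m > 0"
  shows "coprime b (m div S_part S m)"
proof (rule ccontr)
  assume "\<not> coprime b (m div S_part S m)"
  hence "gcd b (m div S_part S m) \<noteq> 1" using coprime_iff_gcd_eq_1 by blast
  then obtain p where "prime p" "p dvd gcd b (m div S_part S m)" using prime_factor_nat by blast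
  thus False using assms coprime_cofactor_S_part[of m p S] by (auto simp: smooth_def)
qed

text \<open>The condition on absolute values outside \<open>S\<close> says that the reduced
  denominator is smooth. Admitting any smooth denominator instead makes closure under the ring
  operations a matter of multiplying denominators.\<close>

lemma S_integers_iff: "r \<in> S_integers S \<longleftrightarrow> (\<exists>b. smooth S b \<and> of_nat b * r \<in> \<int>)"
proof
  obtain a d where ad: "quotient_of r = (a, d)" by (cases "quotient_of r")
  have d: "d > 0" "coprime a d" "r = of_int a / of_int d"
    using quotient_of_denom_pos[OF ad] quotient_of_coprime[OF ad] quotient_of_div[OF ad] by auto
  {
    assume r: "r \<in> S_integers S"
    have "p \<in> S" if p: "prime p" "p dvd nat d" for p
    proof (rule ccontr)
      assume "p \<notin> S"
      hence le: "padic_abs p r \<le> 1" using r p by (auto simp: S_integers_def)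
      have pd: "int p dvd d" using p d by (simp add: int_dvd_int_iff[symmetric])
      have "\<not> int p dvd a" using pd d(2) p(1)
        by (metis coprime_common_divisor not_prime_unit prime_int_nat_transfer of_nat_0_le_iff nat_int prime_nat_iff_prime)
      have "r \<noteq> 0" using \<open>\<not> int p dvd a\<close> d by auto
      have "multiplicity (int p) a = 0" using \<open>\<not> int p dvd a\<close> by (rule not_dvd_imp_multiplicity_0)
      moreover have "multiplicity (int p) d > 0"
        using pd d p by (subst prime_multiplicity_gt_zero_iff) auto
      ultimately have "padic_abs p r = real p ^ multiplicity (int p) d"
        using \<open>r \<noteq> 0\<close> ad by (simp add: padic_abs_def)
      also have "\<dots> > 1" using \<open>multiplicity (int p) d > 0\<close> prime_gt_1_nat[OF p(1)] by (intro one_less_power) auto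
      finally show False using le by simp
    qed
    moreover have "of_nat (nat d) * r = of_int a" using d by simp
    ultimately show "\<exists>b. smooth S b \<and> of_nat b * r \<in> \<int>"
      using d by (intro exI[of _ "nat d"]) (auto simp: smooth_def)
  }
  {
    assume "\<exists>b. smooth S b \<and> of_nat b * r \<in> \<int>"
    then obtain b c where b: "smooth S b" "of_nat b * r = of_int c" by (auto elim: Ints_cases)
    have "(of_int (int b * a) :: rat) = of_int (c * d)" using b d by (simp add: field_simps)
    hence "int b * a = c * d" by (simp only: of_int_eq_iff)
    hence "d dvd int b * a" by simp
    hence db: "d dvd int b" using d(2) by (simp add: coprime_dvd_mult_left_iff coprime_commute)
    have "padic_abs p r \<le> 1" if p: "prime p" "p \<notin> S" for p
    proof (cases "r = 0")
      case False
      have "\<not> p dvd b" using p b by (auto simp: smooth_def)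
      hence "\<not> int p dvd d" using db by (meson dvd_trans int_dvd_int_iff)
      hence "multiplicity (int p) d = 0" by (rule not_dvd_imp_multiplicity_0)
      hence "padic_abs p r = real p powi (- int (multiplicity (int p) a))"
        using False ad by (simp add: padic_abs_def)
      also have "\<dots> = 1 / real p ^ multiplicity (int p) a" by (simp add: power_int_minus field_simps)
      also have "\<dots> \<le> 1" using prime_ge_1_nat[OF p(1)] by (simp add: one_le_power)
      finally show ?thesis .
    qed (simp add: padic_abs_def)
    thus "r \<in> S_integers S" by (auto simp: S_integers_def)
  }
qed

lemma S_integers_of_int: "of_int n \<in> S_integers S"
  unfolding S_integers_iff using smooth_1 by (intro exI[of _ 1]) auto

lemma S_integers_1: "1 \<in> S_integers S"
  using S_integers_of_int[of 1] by simp

lemma S_integers_0: "0 \<in> S_integers S"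
  using S_integers_of_int[of 0] by simp

lemma S_integers_add:
  assumes "r \<in> S_integers S" "s \<in> S_integers S"
  shows "r + s \<in> S_integers S"
proof -
  obtain b c where bc: "smooth S b" "of_nat b * r \<in> \<int>" "smooth S c" "of_nat c * s \<in> \<int>"
    using assms by (auto simp: S_integers_iff)
  have "of_nat (b * c) * (r + s) = of_nat c * (of_nat b * r) + of_nat b * (of_nat c * s)"
    by (simp add: algebra_simps)
  also have "\<dots> \<in> \<int>" by (intro Ints_add Ints_mult[OF Ints_of_nat] bc)
  finally show ?thesis using smooth_mult[OF bc(1,3)] by (auto simp: S_integers_iff)
qed

lemma S_integers_mult_int: "r \<in> S_integers S \<Longrightarrow> of_int n * r \<in> S_integers S"
  unfolding S_integers_iff by (metis Ints_mult Ints_of_int mult.left_commute)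

lemma S_integers_mult_nat: "r \<in> S_integers S \<Longrightarrow> of_nat n * r \<in> S_integers S"
  using S_integers_mult_int[of r S "int n"] by simp

lemma S_integers_diff: "r \<in> S_integers S \<Longrightarrow> s \<in> S_integers S \<Longrightarrow> r - s \<in> S_integers S"
  using S_integers_add[of r S "- s"] S_integers_mult_int[of s S "-1"] by simp

lemma S_integers_divide:
  assumes "r \<in> S_integers S" "smooth S b"
  shows "r / of_nat b \<in> S_integers S"
proof -
  obtain c where c: "smooth S c" "of_nat c * r \<in> \<int>" using assms by (auto simp: S_integers_iff)
  have "of_nat (c * b) * (r / of_nat b) = of_nat c * r" using smooth_pos[OF assms(2)] by simp
  thus ?thesis using c smooth_mult[OF c(1) assms(2)] by (auto simp: S_integers_iff intro!: exI[of _ "c * b"])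
qed

section \<open>The dual group as a compact space\<close>

lemma topspace_dual_topology: "topspace (dual_topology A) = characters A"
  by (auto simp: dual_topology_def characters_def)

lemma continuous_map_dual_eval: "r \<in> A \<Longrightarrow> continuous_map (dual_topology A) euclidean (\<lambda>x. x r)"
  unfolding dual_topology_def
  by (intro continuous_map_from_subtopology continuous_map_product_projection)

text \<open>Inside the product of circles, compact by Tychonoff's theorem, the characters are cut
  out by closed conditions, one for each pair \<open>r\<close>, \<open>s\<close>.\<close>

lemma compact_space_dual_topology:
  assumes add: "\<And>r s. r \<in> A \<Longrightarrow> s \<in> A \<Longrightarrow> r + s \<in> A"
  shows "compact_space (dual_topology A)"
proof -
  let ?P = "product_topology (\<lambda>_. euclidean :: complex topology) A"
  have "closedin ?P {x \<in> topspace ?P. x (r + s) = x r * x s}" if "r \<in> A" "s \<in> A" for r s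
  proof (rule closedin_continuous_maps_eq)
    show "Hausdorff_space (euclidean :: complex topology)" by simp
    show "continuous_map ?P euclidean (\<lambda>x. x (r + s))"
      using that by (intro continuous_map_product_projection add)
    have "continuous_map ?P euclidean ((\<lambda>(a, b). a * b) \<circ> (\<lambda>x. (x r, x s)))"
    proof (rule continuous_map_compose)
      show "continuous_map ?P (prod_topology euclidean euclidean) (\<lambda>x. (x r, x s))"
        using that by (intro continuous_map_pairedI continuous_map_product_projection)
      show "continuous_map (prod_topology euclidean euclidean) euclidean (\<lambda>(a, b). a * b :: complex)"
        by (simp add: case_prod_unfold continuous_on_mult continuous_on_fst continuous_on_snd)
    qed
    thus "continuous_map ?P euclidean (\<lambda>x. x r * x s)" by (simp add: o_def)
  qed
  \<comment> \<open>Inserting the whole space keeps the intersected family nonempty even if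
    \<open>A\<close> is empty.\<close>
  hence "closedin ?P (\<Inter>(insert (topspace ?P) ((\<lambda>(r, s). {x \<in> topspace ?P. x (r + s) = x r * x s}) ` (A \<times> A))))"
    by (intro closedin_Inter) (auto simp del: topspace_product_topology)
  hence *: "closedin ?P (topspace ?P \<inter> (\<Inter>(r, s)\<in>A \<times> A. {x \<in> topspace ?P. x (r + s) = x r * x s}))"
    by (simp only: Inter_insert)
  have "compactin ?P (PiE A (\<lambda>_. sphere 0 1))" by (simp add: compactin_PiE)
  hence "compactin ?P (PiE A (\<lambda>_. sphere 0 1) \<inter> (topspace ?P \<inter> (\<Inter>(r, s)\<in>A \<times> A. {x \<in> topspace ?P. x (r + s) = x r * x s})))"
    using * by (rule compact_Int_closedin)
  also have "PiE A (\<lambda>_. sphere 0 1) \<inter> (topspace ?P \<inter> (\<Inter>(r, s)\<in>A \<times> A. {x \<in> topspace ?P. x (r + s) = x r * x s})) = characters A"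
    by (auto simp: characters_def)
  finally show ?thesis unfolding dual_topology_def by (rule compact_space_subtopology)
qed

lemma dist_powi_le:
  fixes z w :: complex
  assumes "norm z = 1" "norm w = 1"
  shows "dist (z powi k) (w powi k) \<le> real_of_int \<bar>k\<bar> * dist z w"
proof (cases "k \<ge> 0")
  case True
  thus ?thesis using norm_power_diff[of z w "nat k"] assms by (simp add: power_int_def dist_norm)
next
  case False
  have "z \<noteq> 0" "w \<noteq> 0" using assms by auto
  hence "norm (inverse z - inverse w) = norm (z - w)"
    using assms by (simp add: inverse_diff_inverse norm_mult norm_inverse norm_minus_commute)
  thus ?thesis using False norm_power_diff[of "inverse z" "inverse w" "nat (- k)"] assms
    by (simp add: power_int_def dist_norm norm_inverse)
qed

context
  fixes S :: "nat set"
begin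

private abbreviation "R \<equiv> S_integers S"
private abbreviation "X \<equiv> characters (S_integers S)"

lemma character_norm: "x \<in> X \<Longrightarrow> r \<in> R \<Longrightarrow> norm (x r) = 1"
  by (auto simp: characters_def)

lemma character_nonzero: "x \<in> X \<Longrightarrow> r \<in> R \<Longrightarrow> x r \<noteq> 0"
  using character_norm[of x r] by auto

lemma character_add: "x \<in> X \<Longrightarrow> r \<in> R \<Longrightarrow> s \<in> R \<Longrightarrow> x (r + s) = x r * x s"
  by (auto simp: characters_def)

lemma character_0: "x \<in> X \<Longrightarrow> x 0 = 1"
  using character_add[of x 0 0] character_nonzero[of x 0] by (auto simp: S_integers_0)

lemma character_mult_nat: "x \<in> X \<Longrightarrow> r \<in> R \<Longrightarrow> x (of_nat n * r) = x r ^ n"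
  by (induction n) (auto simp: character_0 distrib_right character_add S_integers_mult_nat)

lemma character_minus: "x \<in> X \<Longrightarrow> r \<in> R \<Longrightarrow> x (- r) = inverse (x r)"
  using character_add[of x r "- r"] S_integers_mult_int[of r S "-1"] character_0[of x]
  by (simp add: inverse_unique)

lemma character_mult_int:
  assumes "x \<in> X" "r \<in> R"
  shows "x (of_int n * r) = x r powi n"
proof (cases "n \<ge> 0")
  case True
  thus ?thesis using character_mult_nat[OF assms, of "nat n"] by (simp add: power_int_def)
next
  case False
  have "x (of_int n * r) = x (- (of_nat (nat (- n)) * r))" using False by simp
  also have "\<dots> = inverse (x (of_nat (nat (- n)) * r))"
    using assms by (intro character_minus S_integers_mult_nat)
  also have "\<dots> = x r powi n" using False assms by (simp only: character_mult_nat) (simp add: power_int_def power_inverse)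
  finally show ?thesis .
qed

lemma character_ext: "x \<in> X \<Longrightarrow> y \<in> X \<Longrightarrow> (\<And>r. r \<in> R \<Longrightarrow> x r = y r) \<Longrightarrow> x = y"
  by (rule extensionalityI[of _ R]) (auto simp: characters_def PiE_def)

lemma T_map_apply: "r \<in> R \<Longrightarrow> T_map S x r = x (2 * r)"
  by (simp add: T_map_def dual_map_def)

lemma S_integers_mult_2: "r \<in> R \<Longrightarrow> 2 * r \<in> R"
  using S_integers_mult_nat[of r S 2] by simp

lemma T_map_in: "x \<in> X \<Longrightarrow> T_map S x \<in> X"
  by (auto simp: characters_def T_map_def dual_map_def PiE_iff distrib_left S_integers_mult_2 S_integers_add)

lemma T_map_funpow_in: "x \<in> X \<Longrightarrow> (T_map S ^^ n) x \<in> X"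
  by (induction n) (auto intro: T_map_in)

lemma T_map_funpow_apply: "r \<in> R \<Longrightarrow> (T_map S ^^ n) x r = x (2 ^ n * r)"
proof (induction n arbitrary: r)
  case (Suc n)
  have "(T_map S ^^ Suc n) x r = x (2 ^ n * (2 * r))"
    using Suc by (simp add: T_map_apply S_integers_mult_2)
  also have "2 ^ n * (2 * r) = 2 ^ Suc n * r" by simp
  finally show ?case .
qed simp

lemma T_map_fixed_iff:
  assumes "x \<in> X"
  shows "(T_map S ^^ n) x = x \<longleftrightarrow> (\<forall>r\<in>R. x (of_nat (mersenne n) * r) = 1)"
proof -
  have "(T_map S ^^ n) x = x \<longleftrightarrow> (\<forall>r\<in>R. x (2 ^ n * r) = x r)"
    using character_ext[OF T_map_funpow_in[OF assms] assms, of n] by (metis T_map_funpow_apply)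
  also have "\<dots> \<longleftrightarrow> (\<forall>r\<in>R. x (of_nat (mersenne n) * r) = 1)"
  proof (intro ball_cong refl)
    fix r assume r: "r \<in> R"
    have "2 ^ n * r = of_nat (mersenne n) * r + r"
      by (simp add: mersenne_def of_nat_diff algebra_simps)
    hence "x (2 ^ n * r) = x (of_nat (mersenne n) * r) * x r"
      using character_add[OF assms S_integers_mult_nat[OF r] r] by simp
    thus "x (2 ^ n * r) = x r \<longleftrightarrow> x (of_nat (mersenne n) * r) = 1"
      using character_nonzero[OF assms r] by simp
  qed
  finally show ?thesis .
qed

text \<open>In \<open>m = s * t\<close> the \<open>S\<close>-part \<open>s\<close> is a unit of the
  ring \<open>R\<close>, so \<open>m R = t R\<close>; and \<open>t\<close> is coprime to all
  denominators, so \<open>R / t R\<close> is cyclic of order \<open>t\<close> with generator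
  \<open>1\<close>. A character trivial on \<open>m R\<close> thus amounts to its value at
  \<open>1\<close>, a \<open>t\<close>-th root of unity.\<close>

lemma annihilator_bij_betw_roots_of_unity:
  fixes m :: nat
  assumes m: "m > 0"
  defines "t \<equiv> m div S_part S m"
  shows "bij_betw (\<lambda>x. x 1) {x \<in> X. \<forall>r\<in>R. x (of_nat m * r) = 1} {z. z ^ t = 1}"
proof -
  let ?s = "S_part S m"
  have mt: "m = ?s * t" using S_part_dvd[OF m, of S] by (simp add: t_def)
  have t0: "t > 0" using mt m by (intro Nat.gr0I) auto
  have s: "smooth S ?s" "?s > 0" using smooth_S_part[OF m] S_part_pos by auto
  have killed: "x (of_nat t * r) = 1" if x: "x \<in> X" "\<forall>r\<in>R. x (of_nat m * r) = 1" and r: "r \<in> R" for x r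
  proof -
    have "x (of_nat m * (r / of_nat ?s)) = 1" using x S_integers_divide[OF r s(1)] by blast
    moreover have "(of_nat m :: rat) * (r / of_nat ?s) = of_nat t * r" using s(2) by (subst mt) simp
    ultimately show ?thesis by simp
  qed
  \<comment> \<open>Bezout's identity for \<open>t\<close> and a denominator of \<open>r\<close>:
    every class modulo \<open>t R\<close> contains an integer.\<close>
  have approx: "\<exists>k y. y \<in> R \<and> r = of_int k + of_nat t * y" if r: "r \<in> R" for r
  proof -
    obtain b a where b: "smooth S b" "of_nat b * r = of_int a" using r by (auto simp: S_integers_iff elim: Ints_cases)
    have "coprime (int b) (int t)" using coprime_smooth_cofactor[OF b(1) m] by (simp add: t_def)
    then obtain c e where ce: "int b * c + int t * e = 1"
      using bezout_int[of "int b" "int t"] by (auto simp: mult.commute)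
    have "r = of_int (int b * c + int t * e) * r" by (simp add: ce)
    also have "\<dots> = of_int c * (of_nat b * r) + of_nat t * (of_int e * r)" by (simp add: algebra_simps)
    also have "\<dots> = of_int (c * a) + of_nat t * (of_int e * r)" by (simp add: b)
    finally show ?thesis using S_integers_mult_int[OF r] by blast
  qed
  \<comment> \<open>That integer is determined modulo \<open>t\<close>, so the power of a
    \<open>t\<close>-th root of unity defined through \<open>\<kappa>\<close> does not depend on the
    choice made there.\<close>
  have unique: "int t dvd k - k'"
    if "y \<in> R" "y' \<in> R" "of_int k + of_nat t * y = of_int k' + of_nat t * y'" for k k' y y'
  proof -
    have "y' - y \<in> R" using that by (intro S_integers_diff)
    then obtain b a where b: "smooth S b" "of_nat b * (y' - y) = of_int a" by (auto simp: S_integers_iff elim: Ints_cases)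
    have "(of_int (k - k') :: rat) = of_nat t * (y' - y)" using that(3) by (simp add: algebra_simps)
    hence "(of_int (int b * (k - k')) :: rat) = of_nat b * (of_nat t * (y' - y))" by simp
    also have "\<dots> = of_nat t * (of_nat b * (y' - y))" by simp
    also have "\<dots> = of_int (int t * a)" by (simp add: b)
    finally have "int b * (k - k') = int t * a" by (simp only: of_int_eq_iff)
    hence "int t dvd int b * (k - k')" by simp
    moreover have "coprime (int t) (int b)" using coprime_smooth_cofactor[OF b(1) m] by (simp add: t_def coprime_commute)
    ultimately show ?thesis by (simp add: coprime_dvd_mult_right_iff)
  qed
  show ?thesis
    unfolding bij_betw_def
  proof
    show "inj_on (\<lambda>x. x 1) {x \<in> X. \<forall>r\<in>R. x (of_nat m * r) = 1}"
    proof (rule inj_onI)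
      fix x y assume x: "x \<in> {x \<in> X. \<forall>r\<in>R. x (of_nat m * r) = 1}"
        and y: "y \<in> {x \<in> X. \<forall>r\<in>R. x (of_nat m * r) = 1}" and eq: "x 1 = y 1"
      show "x = y"
      proof (rule character_ext)
        fix r assume "r \<in> R"
        then obtain k w where k: "w \<in> R" "r = of_int k + of_nat t * w" using approx by blast
        have "z r = z 1 powi k" if "z \<in> X" "\<forall>r\<in>R. z (of_nat m * r) = 1" for z
          using that k killed[OF that k(1)] character_mult_int[OF that(1) S_integers_1, of k]
          by (simp add: character_add S_integers_of_int S_integers_mult_nat)
        hence "x r = x 1 powi k" "y r = y 1 powi k" using x y by blast+
        thus "x r = y r" using eq by simp
      qed (use x y in auto)
    qed
    show "(\<lambda>x. x 1) ` {x \<in> X. \<forall>r\<in>R. x (of_nat m * r) = 1} = {z. z ^ t = 1}"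
    proof (intro equalityI subsetI)
      fix z :: complex assume "z \<in> (\<lambda>x. x 1) ` {x \<in> X. \<forall>r\<in>R. x (of_nat m * r) = 1}"
      then obtain x where x: "x \<in> X" "\<forall>r\<in>R. x (of_nat m * r) = 1" "z = x 1" by blast
      show "z \<in> {z. z ^ t = 1}"
        using killed[OF x(1,2) S_integers_1] character_mult_nat[OF x(1) S_integers_1, of t] x(3) by simp
    next
      fix z :: complex assume "z \<in> {z. z ^ t = 1}"
      hence z: "z ^ t = 1" by simp
      have z0: "z \<noteq> 0" using z t0 by (auto simp: power_0_left)
      have zn: "norm z = 1" using power_eq_1_iff[OF z] t0 by auto
      have z_cong: "z powi k = z powi k'" if "int t dvd k - k'" for k k'
      proof -
        obtain j where j: "k - k' = int t * j" using \<open>int t dvd k - k'\<close> by blast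
        have "z powi k = z powi (k' + int t * j)" using j by (simp add: algebra_simps)
        also have "\<dots> = z powi k' * z powi (int t * j)" using z0 by (simp add: power_int_add)
        also have "z powi (int t * j) = (z ^ t) powi j" by (simp add: power_int_mult)
        finally show ?thesis by (simp add: z)
      qed
      define \<kappa> where "\<kappa> r = (SOME k. \<exists>y\<in>R. r = of_int k + of_nat t * y)" for r :: rat
      have \<kappa>: "\<exists>y\<in>R. r = of_int (\<kappa> r) + of_nat t * y" if "r \<in> R" for r
        unfolding \<kappa>_def using approx[OF that] by (intro someI_ex[of "\<lambda>k. \<exists>y\<in>R. r = of_int k + of_nat t * y"]) auto
      define x where "x = restrict (\<lambda>r. z powi \<kappa> r) R"
      have x_eq: "x (of_int k + of_nat t * y) = z powi k" if y: "y \<in> R" for k y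
      proof -
        let ?r = "of_int k + of_nat t * y"
        have r: "?r \<in> R" using y by (intro S_integers_add S_integers_of_int S_integers_mult_nat)
        then obtain y' where "y' \<in> R" "?r = of_int (\<kappa> ?r) + of_nat t * y'" using \<kappa> by blast
        hence "z powi \<kappa> ?r = z powi k" using unique[OF _ y, of y' "\<kappa> ?r" k] by (intro z_cong) auto
        thus ?thesis using r by (simp add: x_def)
      qed
      have "x \<in> X"
        unfolding characters_def
      proof (intro CollectI conjI ballI)
        show "x \<in> R \<rightarrow>\<^sub>E sphere 0 1" using zn by (auto simp: x_def norm_power_int)
      next
        fix r s assume "r \<in> R" "s \<in> R"
        then obtain k y k' y' where *: "y \<in> R" "r = of_int k + of_nat t * y" "y' \<in> R" "s = of_int k' + of_nat t * y'"
          using approx by meson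
        have "r + s = of_int (k + k') + of_nat t * (y + y')" using * by (simp add: algebra_simps)
        hence "x (r + s) = z powi (k + k')" using x_eq[OF S_integers_add[OF *(1,3)]] by (simp only:)
        moreover have "x r = z powi k" "x s = z powi k'" unfolding *(2,4) by (intro x_eq *)+
        ultimately show "x (r + s) = x r * x s" using z0 by (simp add: power_int_add)
      qed
      moreover have "x (of_nat m * r) = 1" if r: "r \<in> R" for r
        using x_eq[OF S_integers_mult_nat[OF r, of ?s], of 0] mt by (simp add: mult_ac flip: of_nat_mult)
      moreover have "x 1 = z" using x_eq[OF S_integers_0, of 1] by simp
      ultimately show "z \<in> (\<lambda>x. x 1) ` {x \<in> X. \<forall>r\<in>R. x (of_nat m * r) = 1}" by blast
    qed
  qed
qed

lemma
  assumes n: "n \<ge> 1"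
  shows finite_periodic_points: "finite {x \<in> X. (T_map S ^^ n) x = x}"
    and card_periodic_points: "real (card {x \<in> X. (T_map S ^^ n) x = x}) = (2 ^ n - 1) * orbit_weight S n"
proof -
  let ?m = "mersenne n"
  let ?t = "?m div S_part S ?m"
  have m: "?m > 0" using mersenne_pos[OF n] .
  have "?t * S_part S ?m = ?m" using S_part_dvd[OF m] by simp
  moreover from this have "?t \<noteq> 0" using m by (metis mult_0 less_irrefl)
  ultimately have t: "?t > 0" "real ?t * real (S_part S ?m) = real ?m" by (simp_all flip: of_nat_mult)
  have eq: "{x \<in> X. (T_map S ^^ n) x = x} = {x \<in> X. \<forall>r\<in>R. x (of_nat ?m * r) = 1}"
    using T_map_fixed_iff by blast
  note bij = annihilator_bij_betw_roots_of_unity[OF m, folded eq]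
  have "finite {z :: complex. z ^ ?t = 1}" using t by (intro finite_roots_unity) auto
  thus "finite {x \<in> X. (T_map S ^^ n) x = x}" using bij_betw_finite[OF bij] by simp
  have "card {x \<in> X. (T_map S ^^ n) x = x} = ?t"
    using bij_betw_same_card[OF bij] card_roots_unity_eq[OF t(1)] by simp
  thus "real (card {x \<in> X. (T_map S ^^ n) x = x}) = (2 ^ n - 1) * orbit_weight S n"
    using t S_part_pos[of S ?m] by (simp add: orbit_weight_def field_simps) (simp add: mersenne_def of_nat_diff)
qed

subsection \<open>Topological entropy\<close>

private abbreviation "\<T> \<equiv> dual_topology (S_integers S)"

lemma S_integers_inverse_smooth: "smooth S b \<Longrightarrow> 1 / of_nat b \<in> R"
  by (intro S_integers_divide S_integers_1)

lemma character_dist_multiple: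
  assumes "x \<in> X" "y \<in> X" "r \<in> R"
  shows "dist (x (of_int k * r)) (y (of_int k * r)) \<le> real_of_int \<bar>k\<bar> * dist (x r) (y r)"
  using dist_powi_le[of "x r" "y r" k] assms by (simp add: character_mult_int character_norm)

lemma openin_dual_ball:
  assumes "r \<in> R"
  shows "openin \<T> {y \<in> X. dist (y r) c < \<epsilon>}"
  using openin_continuous_map_preimage[OF continuous_map_dual_eval[OF assms], of "ball c \<epsilon>"]
  by (simp add: topspace_dual_topology dist_commute)

text \<open>Finitely many elements of \<open>S_integers S\<close> generate a cyclic group, so a single coordinate
  suffices.\<close>

lemma dual_neighbourhood_single_coordinate:
  assumes U: "openin \<T> U" and x: "x \<in> U"
  shows "\<exists>b \<epsilon>. smooth S b \<and> \<epsilon> > 0 \<and> {y \<in> X. dist (y (1 / of_nat b)) (x (1 / of_nat b)) < \<epsilon>} \<subseteq> U"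
proof -
  obtain V where V: "openin (product_topology (\<lambda>_. euclidean) R) V" "U = V \<inter> X"
    using U unfolding dual_topology_def openin_subtopology by blast
  obtain W where W: "finite {i \<in> R. W i \<noteq> (UNIV :: complex set)}" "\<And>i. i \<in> R \<Longrightarrow> open (W i)"
      "x \<in> PiE R W" "PiE R W \<subseteq> V"
    using V x unfolding openin_product_topology_alt by (auto simp del: PiE_iff)
  define J where "J = {i \<in> R. W i \<noteq> UNIV}"
  have J: "finite J" "J \<subseteq> R" using W by (auto simp: J_def)
  have xX: "x \<in> X" using x V by blast
  have "\<exists>\<epsilon>>0. ball (x i) \<epsilon> \<subseteq> W i" if "i \<in> J" for i
  proof -
    have "open (W i)" "x i \<in> W i" using W(2,3) that J by (auto simp: PiE_iff)
    thus ?thesis by (simp add: open_contains_ball)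
  qed
  then obtain e where e: "\<And>i. i \<in> J \<Longrightarrow> e i > 0" "\<And>i. i \<in> J \<Longrightarrow> ball (x i) (e i) \<subseteq> W i" by metis
  have "\<exists>b. smooth S b \<and> of_nat b * i \<in> \<int>" if "i \<in> J" for i
    using that J S_integers_iff by blast
  then obtain \<beta> where \<beta>: "\<And>i. i \<in> J \<Longrightarrow> smooth S (\<beta> i)" "\<And>i. i \<in> J \<Longrightarrow> of_nat (\<beta> i) * i \<in> \<int>" by metis
  define b where "b = (\<Prod>i\<in>J. \<beta> i)"
  have b: "smooth S b" unfolding b_def by (intro smooth_prod J \<beta>)
  have "\<exists>a. i = of_int a * (1 / of_nat b)" if i: "i \<in> J" for i
  proof -
    obtain c where c: "of_nat (\<beta> i) * i = of_int c" using \<beta>(2)[OF i] by (auto elim: Ints_cases)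
    have "\<beta> i dvd b" unfolding b_def using J i by (intro dvd_prodI) auto
    then obtain d where d: "b = \<beta> i * d" by blast
    have "of_nat b * i = of_nat d * (of_nat (\<beta> i) * i)" by (simp add: d)
    also have "\<dots> = of_int (int d * c)" by (simp add: c)
    finally show ?thesis using smooth_pos[OF b] by (intro exI[of _ "int d * c"]) (simp add: field_simps)
  qed
  then obtain a where a: "\<And>i. i \<in> J \<Longrightarrow> i = of_int (a i) * (1 / of_nat b)" by metis
  define \<epsilon> where "\<epsilon> = Min (insert 1 ((\<lambda>i. e i / (real_of_int \<bar>a i\<bar> + 1)) ` J))"
  have \<epsilon>: "\<epsilon> > 0" unfolding \<epsilon>_def using J e(1) by (subst Min_gr_iff) (auto intro!: divide_pos_pos add_nonneg_pos)
  have \<epsilon>_le: "\<epsilon> * (real_of_int \<bar>a i\<bar> + 1) \<le> e i" if "i \<in> J" for i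
  proof -
    have "\<epsilon> \<le> e i / (real_of_int \<bar>a i\<bar> + 1)" unfolding \<epsilon>_def using J that by (intro Min_le) auto
    moreover have "real_of_int \<bar>a i\<bar> + 1 > 0" by linarith
    ultimately show ?thesis by (simp add: pos_le_divide_eq)
  qed
  have "y \<in> U" if y: "y \<in> X" "dist (y (1 / of_nat b)) (x (1 / of_nat b)) < \<epsilon>" for y
  proof -
    have "y i \<in> W i" if i: "i \<in> R" for i
    proof (cases "i \<in> J")
      case True
      have "dist (x i) (y i) \<le> real_of_int \<bar>a i\<bar> * dist (x (1 / of_nat b)) (y (1 / of_nat b))"
        using character_dist_multiple[OF xX y(1) S_integers_inverse_smooth[OF b], of "a i"] a[OF True] by simp
      also have "\<dots> \<le> real_of_int \<bar>a i\<bar> * \<epsilon>"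
        using y(2) by (intro mult_left_mono) (auto simp: dist_commute)
      also have "\<dots> < \<epsilon> * (real_of_int \<bar>a i\<bar> + 1)" using \<epsilon> by (simp add: algebra_simps)
      also have "\<dots> \<le> e i" by (rule \<epsilon>_le[OF True])
      finally show ?thesis using e(2)[OF True] by auto
    qed (use i in \<open>auto simp: J_def\<close>)
    hence "y \<in> PiE R W" using y(1) by (auto simp: characters_def PiE_iff)
    thus ?thesis using W(4) V(2) y(1) by blast
  qed
  thus ?thesis using b \<epsilon> by blast
qed

text \<open>Lebesgue's argument with balls in one coordinate: those of half radius have a finite
  subcover, and the product \<open>b\<close> of their denominators makes every coordinate involved a
  multiple of \<open>1 / b\<close>. Closeness at \<open>1 / b\<close> therefore controls all of
  them.\<close>

lemma dual_lebesgue_number: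
  assumes "\<U> \<in> open_covers \<T>"
  shows "\<exists>b \<epsilon>. smooth S b \<and> \<epsilon> > 0 \<and>
    (\<forall>x\<in>X. \<exists>U\<in>\<U>. {y \<in> X. dist (y (1 / of_nat b)) (x (1 / of_nat b)) < \<epsilon>} \<subseteq> U)"
proof -
  have U: "\<And>U. U \<in> \<U> \<Longrightarrow> openin \<T> U" "\<Union>\<U> = X"
    using assms by (auto simp: open_covers_def topspace_dual_topology)
  define B where "B b \<epsilon> x = {y \<in> X. dist (y (1 / of_nat b)) (x (1 / of_nat b)) < \<epsilon>}" for b :: nat and \<epsilon> :: real and x :: "rat \<Rightarrow> complex"
  have "\<exists>b \<epsilon>. smooth S b \<and> \<epsilon> > 0 \<and> (\<exists>U\<in>\<U>. B b \<epsilon> x \<subseteq> U)" if x: "x \<in> X" for x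
  proof -
    obtain V where V: "V \<in> \<U>" "x \<in> V" using U(2) x by (metis UnionE)
    obtain b \<epsilon> where "smooth S b" "\<epsilon> > 0" "B b \<epsilon> x \<subseteq> V"
      using dual_neighbourhood_single_coordinate[OF U(1)[OF V(1)] V(2), folded B_def] by blast
    thus ?thesis using V(1) by blast
  qed
  hence "\<forall>x\<in>X. \<exists>b \<epsilon>. smooth S b \<and> \<epsilon> > 0 \<and> (\<exists>U\<in>\<U>. B b \<epsilon> x \<subseteq> U)" by blast
  then obtain \<beta> e where \<beta>: "\<And>x. x \<in> X \<Longrightarrow> smooth S (\<beta> x)" "\<And>x. x \<in> X \<Longrightarrow> e x > 0"
      "\<And>x. x \<in> X \<Longrightarrow> \<exists>U\<in>\<U>. B (\<beta> x) (e x) x \<subseteq> U" by metis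
  have op: "openin \<T> (B (\<beta> x) (e x / 2) x)" if "x \<in> X" for x
    using \<beta>(1)[OF that] unfolding B_def by (intro openin_dual_ball S_integers_inverse_smooth)
  have "compact_space \<T>" by (intro compact_space_dual_topology S_integers_add)
  moreover have "X \<subseteq> \<Union>((\<lambda>x. B (\<beta> x) (e x / 2) x) ` X)" using \<beta>(2) by (auto simp: B_def)
  moreover have "\<forall>U\<in>(\<lambda>x. B (\<beta> x) (e x / 2) x) ` X. openin \<T> U" using op by blast
  ultimately have "\<exists>\<F>. finite \<F> \<and> \<F> \<subseteq> (\<lambda>x. B (\<beta> x) (e x / 2) x) ` X \<and> X \<subseteq> \<Union>\<F>"
    unfolding compact_space_alt topspace_dual_topology by blast
  then obtain \<F> where \<F>: "finite \<F>" "\<F> \<subseteq> (\<lambda>x. B (\<beta> x) (e x / 2) x) ` X" "X \<subseteq> \<Union>\<F>"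
    by blast
  then obtain F where F: "finite F" "F \<subseteq> X" "\<F> = (\<lambda>x. B (\<beta> x) (e x / 2) x) ` F"
    by (meson finite_subset_image)
  define b where "b = (\<Prod>x\<in>F. \<beta> x)"
  have b: "smooth S b" unfolding b_def using F \<beta>(1) by (intro smooth_prod) auto
  have "\<exists>c. 1 / of_nat (\<beta> x) = of_nat c * (1 / of_nat b :: rat)" if "x \<in> F" for x
  proof -
    have "\<beta> x dvd b" unfolding b_def using F that by (intro dvd_prodI) auto
    then obtain d where d: "b = \<beta> x * d" by blast
    thus ?thesis using smooth_pos[OF b] by (intro exI[of _ d]) (simp add: field_simps)
  qed
  then obtain c where c: "\<And>x. x \<in> F \<Longrightarrow> 1 / of_nat (\<beta> x) = of_nat (c x) * (1 / of_nat b :: rat)" by metis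
  \<comment> \<open>\<open>insert 1\<close> covers an empty \<open>F\<close>; the summand
    \<open>1\<close> in the denominator makes the later estimate strict.\<close>
  define \<epsilon> where "\<epsilon> = Min (insert 1 ((\<lambda>x. e x / 2 / (real (c x) + 1)) ` F))"
  have \<epsilon>: "\<epsilon> > 0" unfolding \<epsilon>_def using F \<beta>(2) by (subst Min_gr_iff) (auto intro!: divide_pos_pos add_nonneg_pos)
  have \<epsilon>_le: "\<epsilon> * (real (c x) + 1) \<le> e x / 2" if "x \<in> F" for x
  proof -
    have "\<epsilon> \<le> e x / 2 / (real (c x) + 1)" unfolding \<epsilon>_def using F that by (intro Min_le) auto
    thus ?thesis by (subst (asm) pos_le_divide_eq) auto
  qed
  have "\<exists>U\<in>\<U>. B b \<epsilon> x \<subseteq> U" if x: "x \<in> X" for x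
  proof -
    obtain z where z: "z \<in> F" "dist (x (1 / of_nat (\<beta> z))) (z (1 / of_nat (\<beta> z))) < e z / 2"
      using \<F>(3) F(3) x by (auto simp: B_def)
    have "B b \<epsilon> x \<subseteq> B (\<beta> z) (e z) z"
      unfolding B_def
    proof safe
      fix y assume y: "y \<in> X" "dist (y (1 / of_nat b)) (x (1 / of_nat b)) < \<epsilon>"
      have "dist (y (1 / of_nat (\<beta> z))) (x (1 / of_nat (\<beta> z))) \<le> real (c z) * dist (y (1 / of_nat b)) (x (1 / of_nat b))"
        using character_dist_multiple[OF y(1) x S_integers_inverse_smooth[OF b], of "int (c z)"] c[OF z(1)] by simp
      also have "\<dots> \<le> real (c z) * \<epsilon>" using y(2) by (intro mult_left_mono) auto
      also have "\<dots> < \<epsilon> * (real (c z) + 1)" using \<epsilon> by (simp add: algebra_simps)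
      also have "\<dots> \<le> e z / 2" by (rule \<epsilon>_le[OF z(1)])
      finally show "dist (y (1 / of_nat (\<beta> z))) (z (1 / of_nat (\<beta> z))) < e z"
        using z(2) dist_triangle[of "y (1 / of_nat (\<beta> z))" "z (1 / of_nat (\<beta> z))" "x (1 / of_nat (\<beta> z))"]
        by linarith
    qed
    thus ?thesis using \<beta>(3)[of z] z(1) F(2) by blast
  qed
  thus ?thesis using b \<epsilon> unfolding B_def by blast
qed

lemma dist_unit_le_Arg2pi:
  assumes "norm z = 1" "norm w = 1"
  shows "dist z w \<le> \<bar>Arg2pi z - Arg2pi w\<bar>"
proof -
  let ?a = "Arg2pi z" and ?b = "Arg2pi w"
  have zw: "z = exp (\<i> * of_real ?a)" "w = exp (\<i> * of_real ?b)"
    using Arg2pi_eq[of z] Arg2pi_eq[of w] assms by auto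
  have "z - w = exp (\<i> * of_real ?b) * (exp (\<i> * of_real (?a - ?b)) - 1)"
    by (subst zw(1), subst zw(2)) (simp add: exp_diff algebra_simps)
  hence "norm (z - w) = 2 * \<bar>sin ((?a - ?b) / 2)\<bar>"
    by (simp only: norm_mult dist_exp_i_1 norm_exp_i_times mult_1)
  also have "\<dots> \<le> \<bar>?a - ?b\<bar>" using abs_sin_x_le_abs_x[of "(?a - ?b) / 2"] by simp
  finally show ?thesis by (simp add: dist_norm)
qed

text \<open>\<open>T_map S\<close> doubles the angle of the value at \<open>1 / b\<close>. If the
  circle is cut into \<open>M * 2 ^ n\<close> arcs, characters with values in a common arc stay
  closer than \<open>\<epsilon>\<close> for \<open>n\<close> steps; following one representative per
  arc yields a member of the join that contains them all.\<close>

lemma dual_cover_upper: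
  assumes "\<U> \<in> open_covers \<T>"
  shows "\<exists>M\<ge>1. \<forall>n. \<exists>\<V>\<subseteq>iterated_join \<T> (T_map S) \<U> n. finite \<V> \<and> card \<V> \<le> M * 2 ^ n \<and> \<Union>\<V> = X"
proof -
  obtain b \<epsilon> where b: "smooth S b" "\<epsilon> > 0"
    and leb: "\<And>x. x \<in> X \<Longrightarrow> \<exists>U\<in>\<U>. {y \<in> X. dist (y (1 / of_nat b)) (x (1 / of_nat b)) < \<epsilon>} \<subseteq> U"
    using dual_lebesgue_number[OF assms] by blast
  from leb have "\<forall>x\<in>X. \<exists>U. U \<in> \<U> \<and> {y \<in> X. dist (y (1 / of_nat b)) (x (1 / of_nat b)) < \<epsilon>} \<subseteq> U" by blast
  then obtain u where u: "\<And>x. x \<in> X \<Longrightarrow> u x \<in> \<U>" "\<And>x. x \<in> X \<Longrightarrow> {y \<in> X. dist (y (1 / of_nat b)) (x (1 / of_nat b)) < \<epsilon>} \<subseteq> u x"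
    unfolding bchoice_iff by blast
  let ?r = "1 / of_nat b :: rat"
  have r: "?r \<in> R" by (rule S_integers_inverse_smooth[OF b(1)])
  \<comment> \<open>Arcs of length \<open>2 * pi / (M * 2 ^ n)\<close> grow to at most
    \<open>2 * pi / M < \<epsilon>\<close> in fewer than \<open>n\<close> doublings.\<close>
  obtain M :: nat where M: "real M > 2 * pi / \<epsilon>" using reals_Archimedean2 by blast
  have "2 * pi / \<epsilon> > 0" using b(2) by simp
  hence "real M > 0" using M by linarith
  hence M0: "M \<ge> 1" by simp
  have "\<exists>\<V>\<subseteq>iterated_join \<T> (T_map S) \<U> n. finite \<V> \<and> card \<V> \<le> M * 2 ^ n \<and> \<Union>\<V> = X" for n
  proof -
    define K where "K = M * 2 ^ n"
    have K0: "K > 0" using M0 by (simp add: K_def)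
    define g where "g x = nat \<lfloor>Arg2pi (x ?r) * real K / (2 * pi)\<rfloor>" for x :: "rat \<Rightarrow> complex"
    have g_lt: "g x < K" for x
    proof -
      have "Arg2pi (x ?r) * real K < 2 * pi * real K" using K0 Arg2pi_lt_2pi by (intro mult_strict_right_mono) auto
      hence "Arg2pi (x ?r) * real K / (2 * pi) < real K" by (simp add: field_simps)
      thus ?thesis using K0 unfolding g_def by (simp add: nat_less_iff floor_less_iff Arg2pi_ge_0)
    qed
    have g_eq: "\<bar>Arg2pi (x ?r) - Arg2pi (y ?r)\<bar> \<le> 2 * pi / real K" if "g x = g y" for x y
    proof -
      let ?p = "Arg2pi (x ?r) * real K / (2 * pi)" and ?q = "Arg2pi (y ?r) * real K / (2 * pi)"
      have "?p \<ge> 0" "?q \<ge> 0" by (simp_all add: Arg2pi_ge_0)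
      hence "\<lfloor>?p\<rfloor> = \<lfloor>?q\<rfloor>" using that unfolding g_def by (simp add: eq_nat_nat_iff)
      hence "\<bar>?p - ?q\<bar> \<le> 1" by linarith
      moreover have "?p - ?q = (Arg2pi (x ?r) - Arg2pi (y ?r)) * (real K / (2 * pi))" by (simp add: field_simps)
      ultimately have "\<bar>Arg2pi (x ?r) - Arg2pi (y ?r)\<bar> * (real K / (2 * pi)) \<le> 1" by (simp add: abs_mult)
      thus ?thesis using K0 by (simp add: field_simps)
    qed
    define rep where "rep l = (SOME x. x \<in> X \<and> g x = l)" for l
    have rep: "rep (g x) \<in> X" "g (rep (g x)) = g x" if "x \<in> X" for x
      using someI[of "\<lambda>y. y \<in> X \<and> g y = g x" x] that unfolding rep_def by auto
    define cell where "cell l = {x \<in> X. \<forall>i<n. (T_map S ^^ i) x \<in> u ((T_map S ^^ i) (rep l))}" for l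
    have "x \<in> cell (g x)" if x: "x \<in> X" for x
    proof -
      have "(T_map S ^^ i) x \<in> u ((T_map S ^^ i) (rep (g x)))" if i: "i < n" for i
      proof -
        let ?y = "rep (g x)"
        have y: "?y \<in> X" by (rule rep[OF x])
        have "dist ((T_map S ^^ i) x ?r) ((T_map S ^^ i) ?y ?r) \<le> 2 ^ i * dist (x ?r) (?y ?r)"
          using character_dist_multiple[OF x y r, of "2 ^ i"] T_map_funpow_apply[OF r, of i] by simp
        also have "\<dots> \<le> 2 ^ i * (2 * pi / real K)"
          using dist_unit_le_Arg2pi[of "x ?r" "?y ?r"] g_eq[of x ?y] rep(2)[OF x] character_norm[OF x r] character_norm[OF y r]
          by (intro mult_left_mono) auto
        also have "\<dots> \<le> 2 ^ n * (2 * pi / real K)"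
          using i by (intro mult_right_mono power_increasing) auto
        also have "\<dots> = 2 * pi / real M" by (simp add: K_def)
        also have "\<dots> < \<epsilon>" using M b(2) M0 by (simp add: field_simps)
        finally have "dist ((T_map S ^^ i) x ?r) ((T_map S ^^ i) ?y ?r) < \<epsilon>" .
        thus ?thesis using u(2)[OF T_map_funpow_in[OF y], of i] T_map_funpow_in[OF x, of i] by blast
      qed
      thus ?thesis using x by (simp add: cell_def)
    qed
    hence cover: "\<Union>(cell ` g ` X) = X" by (auto simp: cell_def)
    have "cell (g x) \<in> iterated_join \<T> (T_map S) \<U> n" if "x \<in> X" for x
    proof -
      have "(\<lambda>i. u ((T_map S ^^ i) (rep (g x)))) \<in> {..<n} \<rightarrow> \<U>"
        using u(1) T_map_funpow_in rep(1)[OF that] by auto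
      thus ?thesis unfolding iterated_join_def cell_def topspace_dual_topology
        by (intro CollectI exI[of _ "\<lambda>i. u ((T_map S ^^ i) (rep (g x)))"] conjI refl)
    qed
    moreover have "g ` X \<subseteq> {..<K}" using g_lt by auto
    hence "finite (g ` X)" "card (g ` X) \<le> K" using finite_subset card_mono[of "{..<K}" "g ` X"] by auto
    hence "finite (cell ` g ` X)" "card (cell ` g ` X) \<le> K" using card_image_le[of "g ` X" cell] by auto
    ultimately show ?thesis using cover unfolding K_def by (intro exI[of _ "cell ` g ` X"]) auto
  qed
  thus ?thesis using M0 by blast
qed

text \<open>Finite subcovers of the join exist, so the \<open>LEAST\<close> in
  \<open>cover_number\<close> is attained.\<close>

lemma dual_cover_number:
  assumes "\<U> \<in> open_covers \<T>"
  shows "\<exists>\<V>\<subseteq>iterated_join \<T> (T_map S) \<U> n. finite \<V> \<and> card \<V> = cover_number \<T> (iterated_join \<T> (T_map S) \<U> n) \<and> \<Union>\<V> = X"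
proof -
  let ?Q = "\<lambda>m. \<exists>\<V>\<subseteq>iterated_join \<T> (T_map S) \<U> n. finite \<V> \<and> card \<V> = m \<and> \<Union>\<V> = X"
  have "\<exists>m. ?Q m" using dual_cover_upper[OF assms] by blast
  hence "?Q (LEAST m. ?Q m)" by (rule LeastI_ex)
  thus ?thesis by (simp add: cover_number_def topspace_dual_topology)
qed

lemma limsup_cover_number_le:
  assumes "\<U> \<in> open_covers \<T>"
  shows "limsup (\<lambda>n. ereal (ln (real (cover_number \<T> (iterated_join \<T> (T_map S) \<U> n))) / real n)) \<le> ereal (ln 2)"
proof -
  obtain M where M: "M \<ge> 1" "\<And>n. \<exists>\<V>\<subseteq>iterated_join \<T> (T_map S) \<U> n. finite \<V> \<and> card \<V> \<le> M * 2 ^ n \<and> \<Union>\<V> = X"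
    using dual_cover_upper[OF assms] by blast
  have le: "cover_number \<T> (iterated_join \<T> (T_map S) \<U> n) \<le> M * 2 ^ n" for n
  proof -
    obtain \<V> where \<V>: "\<V> \<subseteq> iterated_join \<T> (T_map S) \<U> n" "finite \<V>" "card \<V> \<le> M * 2 ^ n" "\<Union>\<V> = X"
      using M(2)[of n] by metis
    have "cover_number \<T> (iterated_join \<T> (T_map S) \<U> n) \<le> card \<V>"
      unfolding cover_number_def topspace_dual_topology using \<V> by (intro Least_le) blast
    thus ?thesis using \<V>(3) by linarith
  qed
  have "limsup (\<lambda>n. ereal (ln (real (cover_number \<T> (iterated_join \<T> (T_map S) \<U> n))) / real n))
      \<le> limsup (\<lambda>n. ereal (ln (real M) / real n + ln 2))"
  proof (rule Limsup_mono)
    show "\<forall>\<^sub>F n in sequentially. ereal (ln (real (cover_number \<T> (iterated_join \<T> (T_map S) \<U> n))) / real n)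
        \<le> ereal (ln (real M) / real n + ln 2)"
      using eventually_gt_at_top[of 0]
    proof eventually_elim
      case (elim n)
      let ?c = "cover_number \<T> (iterated_join \<T> (T_map S) \<U> n)"
      have "real ?c \<le> real M * 2 ^ n" using le[of n] by (metis of_nat_le_iff of_nat_mult of_nat_numeral of_nat_power)
      \<comment> \<open>The value \<open>?c = 0\<close> is covered by
        \<open>ln 0 = 0\<close>.\<close>
      hence "ln (real ?c) \<le> ln (real M * 2 ^ n)"
        using M(1) by (cases "?c = 0") (auto intro!: ln_ge_zero mult_ge1_I simp: one_le_power)
      also have "\<dots> = ln (real M) + real n * ln 2" using M(1) by (subst ln_mult_pos) (auto simp: ln_realpow)
      finally have "ln (real ?c) / real n \<le> (ln (real M) + real n * ln 2) / real n" by (intro divide_right_mono) auto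
      thus ?case using elim by (simp add: add_divide_distrib)
    qed
  qed
  also have "(\<lambda>n. ereal (ln (real M) / real n + ln 2)) \<longlonglongrightarrow> ereal (ln 2)"
    by (intro tendsto_intros) real_asymp
  hence "limsup (\<lambda>n. ereal (ln (real M) / real n + ln 2)) = ereal (ln 2)"
    by (intro lim_imp_Limsup) auto
  finally show ?thesis .
qed

lemma exponential_character: "restrict (\<lambda>r. cis (\<theta> * of_rat r)) R \<in> X"
  by (auto simp: characters_def S_integers_add of_rat_add distrib_left cis_mult)

text \<open>The characters \<open>r \<mapsto> exp (2 pi i j r / 2^n)\<close> with
  \<open>j < 2^n\<close> lie in pairwise different members of the join. If \<open>j' - j\<close> is
  \<open>2^w\<close> times an odd number, their values at \<open>1\<close> are antipodal after
  \<open>n - 1 - w\<close> doublings, hence at distance \<open>2\<close>, whereas two characters in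
  one member of \<open>\<U>\<close> differ by less than \<open>1\<close> there.\<close>

lemma dual_entropy_lower:
  defines "\<U> \<equiv> {{x \<in> X. dist (x 1) c < 1 / 2} | c. c \<in> sphere 0 1}"
  shows "\<U> \<in> open_covers \<T>" and "2 ^ n \<le> cover_number \<T> (iterated_join \<T> (T_map S) \<U> n)"
proof -
  have "x \<in> \<Union>\<U>" if "x \<in> X" for x
    using that character_norm[OF that S_integers_1] unfolding \<U>_def
    by (intro UnionI[of "{y \<in> X. dist (y 1) (x 1) < 1 / 2}"]) auto
  moreover have "U \<subseteq> X" "openin \<T> U" if "U \<in> \<U>" for U
    using that openin_dual_ball[OF S_integers_1] unfolding \<U>_def by blast+
  ultimately show \<U>: "\<U> \<in> open_covers \<T>"
    unfolding open_covers_def topspace_dual_topology by blast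
  obtain \<V> where \<V>: "\<V> \<subseteq> iterated_join \<T> (T_map S) \<U> n" "finite \<V>"
      "card \<V> = cover_number \<T> (iterated_join \<T> (T_map S) \<U> n)" "\<Union>\<V> = X"
    using dual_cover_number[OF \<U>, of n] by metis
  define P where "P j = restrict (\<lambda>r. cis (2 * pi * real j / 2 ^ n * of_rat r)) R" for j :: nat
  have PX: "P j \<in> X" for j unfolding P_def by (rule exponential_character)
  have PT: "(T_map S ^^ i) (P j) 1 = cis (2 * pi * real j / 2 ^ n * 2 ^ i)" for i j
  proof -
    have "(2::rat) ^ i \<in> R" using S_integers_of_int[of "2 ^ i"] by simp
    thus ?thesis by (simp add: T_map_funpow_apply S_integers_1 P_def of_rat_power)
  qed
  have "\<exists>V\<in>\<V>. P j \<in> V" for j using \<V>(4) PX by blast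
  then obtain v where v: "\<And>j. v j \<in> \<V>" "\<And>j. P j \<in> v j" by metis
  have sep: "v j \<noteq> v j'" if "j < j'" "j' < 2 ^ n" for j j'
  proof
    assume eq: "v j = v j'"
    define d where "d = j' - j"
    have d: "0 < d" "d < 2 ^ n" "j' = j + d" using that by (auto simp: d_def)
    obtain o' where o': "d = 2 ^ multiplicity 2 d * o'" "\<not> 2 dvd o'"
      using multiplicity_decompose'[of d 2] d by auto
    define w where "w = multiplicity 2 d"
    have "2 ^ w dvd d" unfolding w_def by (rule multiplicity_dvd)
    hence "(2::nat) ^ w \<le> d" using d by (intro dvd_imp_le)
    hence "(2::nat) ^ w < 2 ^ n" using d by linarith
    hence w: "w < n" by simp
    define i where "i = n - 1 - w"
    have i: "i < n" "n = i + w + 1" using w by (auto simp: i_def)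
    obtain m where m: "o' = 2 * m + 1" using o'(2) by (auto elim: oddE)
    have "2 * pi * real j' / 2 ^ n * 2 ^ i = 2 * pi * real j / 2 ^ n * 2 ^ i + 2 * pi * real d / 2 ^ n * 2 ^ i"
      by (simp add: d(3) add_divide_distrib distrib_left distrib_right)
    also have "2 * pi * real d / 2 ^ n * 2 ^ i = pi + 2 * pi * real m"
    proof -
      have "real d = 2 ^ w * (2 * real m + 1)" using o'(1) m unfolding w_def[symmetric] by (simp add: algebra_simps)
      thus ?thesis unfolding i(2) by (simp add: power_add field_simps)
    qed
    finally have "cis (2 * pi * real j' / 2 ^ n * 2 ^ i) = cis (2 * pi * real j / 2 ^ n * 2 ^ i) * (cis pi * cis (2 * pi * real m))"
      by (simp only: cis_mult[symmetric])
    also have "cis (2 * pi * real m) = 1" by (rule cis_multiple_2pi) auto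
    finally have opp: "(T_map S ^^ i) (P j') 1 = - (T_map S ^^ i) (P j) 1" by (simp add: PT)
    have "v j \<in> iterated_join \<T> (T_map S) \<U> n" using v(1) \<V>(1) by blast
    then obtain f where f: "f \<in> {..<n} \<rightarrow> \<U>" "v j = {x \<in> topspace \<T>. \<forall>i<n. (T_map S ^^ i) x \<in> f i}"
      unfolding iterated_join_def by blast
    have "(T_map S ^^ i) (P j) \<in> f i" "(T_map S ^^ i) (P j') \<in> f i" using v(2)[of j] v(2)[of j'] eq f(2) i(1) by auto
    moreover obtain c where "f i = {x \<in> X. dist (x 1) c < 1 / 2}" using f(1) i(1) by (auto simp: \<U>_def)
    ultimately have "dist ((T_map S ^^ i) (P j) 1) c < 1 / 2" "dist ((T_map S ^^ i) (P j') 1) c < 1 / 2" by auto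
    hence "dist ((T_map S ^^ i) (P j) 1) ((T_map S ^^ i) (P j') 1) < 1"
      using dist_triangle2[of "(T_map S ^^ i) (P j) 1" "(T_map S ^^ i) (P j') 1" c] by linarith
    moreover have "dist ((T_map S ^^ i) (P j) 1) ((T_map S ^^ i) (P j') 1) = norm (2 * (T_map S ^^ i) (P j) 1)"
      unfolding opp dist_norm by simp
    moreover have "norm ((T_map S ^^ i) (P j) 1) = 1"
      using character_norm[OF T_map_funpow_in[OF PX] S_integers_1] .
    ultimately show False by (simp add: norm_mult)
  qed
  have "inj_on v {..<2 ^ n}"
    by (rule linorder_inj_onI) (use sep in auto)
  hence "card {..<(2::nat) ^ n} \<le> card \<V>" using v(1) \<V>(2) by (intro card_inj_on_le[of v]) auto
  thus "2 ^ n \<le> cover_number \<T> (iterated_join \<T> (T_map S) \<U> n)" using \<V>(3) by simp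
qed

lemma top_entropy_T_map: "top_entropy \<T> (T_map S) = ereal (ln 2)"
proof (rule antisym)
  show "top_entropy \<T> (T_map S) \<le> ereal (ln 2)"
    unfolding top_entropy_def by (intro SUP_least limsup_cover_number_le)
  let ?U = "{{x \<in> X. dist (x 1) c < 1 / 2} | c. c \<in> sphere 0 1}"
  have "ereal (ln 2) = limsup (\<lambda>n. ereal (ln 2))" by (simp add: Limsup_const)
  also have "\<dots> \<le> limsup (\<lambda>n. ereal (ln (real (cover_number \<T> (iterated_join \<T> (T_map S) ?U n))) / real n))"
  proof (rule Limsup_mono)
    show "\<forall>\<^sub>F n in sequentially. ereal (ln 2) \<le> ereal (ln (real (cover_number \<T> (iterated_join \<T> (T_map S) ?U n))) / real n)"
      using eventually_gt_at_top[of 0]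
    proof eventually_elim
      case (elim n)
      let ?c = "cover_number \<T> (iterated_join \<T> (T_map S) ?U n)"
      have "real (2 ^ n) \<le> real ?c" unfolding of_nat_le_iff by (rule dual_entropy_lower(2))
      hence le: "2 ^ n \<le> real ?c" by simp
      have "ln (2 ^ n) \<le> ln (real ?c)"
      proof (rule ln_mono)
        show "(2::real) ^ n \<le> real ?c" by (rule le)
      qed simp
      thus ?case using elim by (simp add: ln_realpow field_simps)
    qed
  qed
  also have "\<dots> \<le> top_entropy \<T> (T_map S)"
    unfolding top_entropy_def by (rule SUP_upper[OF dual_entropy_lower(1)])
  finally show "ereal (ln 2) \<le> top_entropy \<T> (T_map S)" .
qed

end

subsection \<open>Closed orbits\<close>

lemma orbit_eq_range:
  assumes "(T ^^ n) x = x" "n \<ge> 1"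
  shows "{(T ^^ i) x | i. i \<le> n} = range (\<lambda>i. (T ^^ i) x)"
proof (intro equalityI subsetI)
  fix y assume "y \<in> range (\<lambda>i. (T ^^ i) x)"
  then obtain i where "y = (T ^^ i) x" by blast
  hence "y = (T ^^ (i mod n)) x" using funpow_mod_eq[OF assms(1)] by simp
  moreover have "i mod n \<le> n" using assms(2) by (simp add: less_imp_le)
  ultimately show "y \<in> {(T ^^ i) x | i. i \<le> n}" by blast
qed auto

lemma orbit_range_shift:
  assumes "(T ^^ n) x = x" "n \<ge> 1"
  shows "range (\<lambda>i. (T ^^ i) ((T ^^ j) x)) = range (\<lambda>i. (T ^^ i) x)"
proof (intro equalityI subsetI)
  fix y assume "y \<in> range (\<lambda>i. (T ^^ i) ((T ^^ j) x))"
  thus "y \<in> range (\<lambda>i. (T ^^ i) x)" by (auto simp: funpow_add[symmetric, THEN fun_cong, unfolded o_def])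
next
  fix y assume "y \<in> range (\<lambda>i. (T ^^ i) x)"
  then obtain i where i: "y = (T ^^ i) x" by blast
  \<comment> \<open>From \<open>(T ^^ j) x\<close>, another \<open>j * n - j\<close> steps lead back
    to \<open>x\<close>, since \<open>j * n\<close> is a multiple of the period.\<close>
  have "j \<le> j * n" using assms(2) by simp
  hence "i + (j * n - j) + j = i + j * n" by linarith
  hence "(i + (j * n - j) + j) mod n = i mod n" by (simp only: mod_mult_self1)
  hence "(T ^^ (i + (j * n - j) + j)) x = (T ^^ i) x"
    using funpow_mod_eq[OF assms(1), of "i + (j * n - j) + j"] funpow_mod_eq[OF assms(1), of i] by simp
  hence "y = (T ^^ (i + (j * n - j))) ((T ^^ j) x)" by (simp only: i funpow_add o_apply)
  thus "y \<in> range (\<lambda>i. (T ^^ i) ((T ^^ j) x))" by blast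
qed

lemma closed_orbits_card_pos: "\<tau> \<in> closed_orbits X T \<Longrightarrow> card \<tau> \<ge> 1"
  unfolding closed_orbits_def by (fastforce intro: Suc_leI Nat.gr0I)

text \<open>Any of its points generates a closed orbit; consequently orbits that meet
  coincide.\<close>

lemma closed_orbit_repr:
  assumes "\<tau> \<in> closed_orbits X T" "y \<in> \<tau>"
  shows "\<tau> = range (\<lambda>i. (T ^^ i) y)"
proof -
  obtain x n where x: "(T ^^ n) x = x" "\<tau> = {(T ^^ i) x | i. i \<le> n}" "card \<tau> = n"
    using assms(1) by (auto simp: closed_orbits_def)
  have "n \<ge> 1" using closed_orbits_card_pos[OF assms(1)] x(3) by simp
  moreover obtain j where "y = (T ^^ j) x" using assms(2) x(2) by blast
  ultimately show ?thesis using orbit_eq_range[OF x(1)] orbit_range_shift[OF x(1)] x(2) by simp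
qed

lemma closed_orbit_periodic:
  assumes T: "\<And>x. x \<in> X \<Longrightarrow> T x \<in> X" and "\<tau> \<in> closed_orbits X T" "y \<in> \<tau>"
  shows "y \<in> X \<and> (T ^^ card \<tau>) y = y"
proof -
  obtain x n where x: "x \<in> X" "(T ^^ n) x = x" "\<tau> = {(T ^^ i) x | i. i \<le> n}" "card \<tau> = n"
    using assms(2) by (auto simp: closed_orbits_def)
  obtain j where j: "y = (T ^^ j) x" using assms(3) x(3) by blast
  have "(T ^^ i) x \<in> X" for i using x(1) T by (induction i) auto
  moreover have "(T ^^ n) ((T ^^ j) x) = (T ^^ j) ((T ^^ n) x)"
    by (simp only: funpow_add[symmetric, THEN fun_cong, unfolded o_def] add.commute)
  ultimately show ?thesis using j x by simp
qed

lemma card_closed_orbits_le: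
  assumes T: "\<And>x. x \<in> X \<Longrightarrow> T x \<in> X" and fin: "finite {x \<in> X. (T ^^ n) x = x}"
  shows "finite {\<tau> \<in> closed_orbits X T. card \<tau> = n}"
    and "n * card {\<tau> \<in> closed_orbits X T. card \<tau> = n} = card (\<Union>{\<tau> \<in> closed_orbits X T. card \<tau> = n})"
    and "n * card {\<tau> \<in> closed_orbits X T. card \<tau> = n} \<le> card {x \<in> X. (T ^^ n) x = x}"
proof -
  let ?C = "{\<tau> \<in> closed_orbits X T. card \<tau> = n}"
  have sub: "\<Union>?C \<subseteq> {x \<in> X. (T ^^ n) x = x}"
    using closed_orbit_periodic[where X = X and T = T] T by blast
  hence "?C \<subseteq> Pow {x \<in> X. (T ^^ n) x = x}" by blast
  thus finC: "finite ?C" using fin by (meson finite_Pow_iff finite_subset)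
  have finU: "finite (\<Union>?C)" by (rule finite_subset[OF sub fin])
  show eq: "n * card ?C = card (\<Union>?C)"
  proof (rule card_partition[OF finC finU])
    fix c1 c2 assume c: "c1 \<in> ?C" "c2 \<in> ?C" "c1 \<noteq> c2"
    show "c1 \<inter> c2 = {}"
    proof (rule ccontr)
      assume "c1 \<inter> c2 \<noteq> {}"
      then obtain y where "y \<in> c1" "y \<in> c2" by blast
      thus False using closed_orbit_repr[of c1 X T y] closed_orbit_repr[of c2 X T y] c by auto
    qed
  qed auto
  show "n * card ?C \<le> card {x \<in> X. (T ^^ n) x = x}"
    unfolding eq by (rule card_mono[OF fin sub])
qed

text \<open>A substitute for Moebius inversion: the least period divides \<open>n\<close>, so it is
  either \<open>n\<close>, giving a closed orbit of that length, or at most \<open>n div 2\<close>.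
  Points of the second kind are few enough to be counted crudely.\<close>

lemma periodic_points_subset:
  assumes n: "n \<ge> 1"
  shows "{x \<in> X. (T ^^ n) x = x} \<subseteq>
    \<Union>{\<tau> \<in> closed_orbits X T. card \<tau> = n} \<union> (\<Union>d\<in>{1..n div 2}. {x \<in> X. (T ^^ d) x = x})"
proof
  fix x assume "x \<in> {x \<in> X. (T ^^ n) x = x}"
  hence x: "x \<in> X" "(T ^^ n) x = x" by auto
  define m where "m = (LEAST m. m \<ge> 1 \<and> (T ^^ m) x = x)"
  have m: "m \<ge> 1" "(T ^^ m) x = x"
    using LeastI[of "\<lambda>m. m \<ge> 1 \<and> (T ^^ m) x = x" n] n x unfolding m_def by auto
  have least: "m \<le> d" if "d \<ge> 1" "(T ^^ d) x = x" for d
    unfolding m_def using that by (intro Least_le) auto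
  have "(T ^^ (n mod m)) x = x" using funpow_mod_eq[OF m(2), of n] x by simp
  moreover have "n mod m < m" using m by simp
  ultimately have "n mod m = 0" using least[of "n mod m"] by (cases "n mod m = 0") auto
  then obtain k where k: "n = m * k" by auto
  show "x \<in> \<Union>{\<tau> \<in> closed_orbits X T. card \<tau> = n} \<union> (\<Union>d\<in>{1..n div 2}. {x \<in> X. (T ^^ d) x = x})"
  proof (cases "m = n")
    case True
    let ?\<tau> = "{(T ^^ i) x | i. i \<le> n}"
    have inj: "inj_on (\<lambda>i. (T ^^ i) x) {..<n}"
    proof (rule linorder_inj_onI)
      fix i j assume ij: "i < j" "i \<in> {..<n}" "j \<in> {..<n}"
      show "(T ^^ i) x \<noteq> (T ^^ j) x"
      proof
        assume "(T ^^ i) x = (T ^^ j) x"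
        hence "(T ^^ (n - j)) ((T ^^ i) x) = (T ^^ (n - j)) ((T ^^ j) x)" by simp
        hence "(T ^^ (n - j + i)) x = (T ^^ (n - j + j)) x" by (simp only: funpow_add o_apply)
        hence "(T ^^ (n - j + i)) x = x" using ij x by simp
        hence "n \<le> n - j + i" using least[of "n - j + i"] ij True by auto
        thus False using ij by auto
      qed
    qed auto
    have "?\<tau> = (\<lambda>i. (T ^^ i) x) ` {..<n}"
    proof (intro equalityI subsetI)
      fix y assume "y \<in> ?\<tau>"
      then obtain i where i: "i \<le> n" "y = (T ^^ i) x" by blast
      hence "y = (T ^^ (i mod n)) x" using funpow_mod_eq[OF x(2)] by simp
      thus "y \<in> (\<lambda>i. (T ^^ i) x) ` {..<n}" using n by auto
    qed auto
    hence card: "card ?\<tau> = n" using card_image[OF inj] by simp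
    hence "?\<tau> \<in> closed_orbits X T" unfolding closed_orbits_def using x by blast
    moreover have "x \<in> ?\<tau>" by (intro CollectI exI[of _ 0]) simp
    ultimately show ?thesis using card by blast
  next
    case False
    hence "k \<noteq> 1" "k \<noteq> 0" using k n by auto
    hence "m * 2 \<le> n" unfolding k by (intro mult_le_mono2) simp
    hence "m \<in> {1..n div 2}" using m by auto
    thus ?thesis using x(1) m by blast
  qed
qed

lemma sum_powers_of_two_le: "(\<Sum>d=1..m. (2::real) ^ d) \<le> 2 * 2 ^ m"
  by (induction m) auto

text \<open>Points of period at most \<open>n div 2\<close> number at most
  \<open>2 * 2^(n div 2)\<close>, and replacing \<open>2^n - 1\<close> by \<open>2^n\<close> costs
  at most \<open>1\<close>. The total error \<open>3 * 2^(n div 2)\<close> is geometrically small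
  against \<open>2^n\<close>.\<close>

lemma closed_orbit_count:
  fixes S :: "nat set"
  assumes n: "n \<ge> 1"
  defines "C \<equiv> {\<tau> \<in> closed_orbits (characters (S_integers S)) (T_map S). card \<tau> = n}"
  shows "finite C" and "\<bar>real (card C) / 2 ^ n - orbit_weight S n / real n\<bar> \<le> 3 * (sqrt 2 / 2) ^ n"
proof -
  let ?X = "characters (S_integers S)" and ?T = "T_map S"
  let ?P = "\<lambda>d. {x \<in> ?X. (?T ^^ d) x = x}"
  note fin = finite_periodic_points[of n S, OF n]
  show "finite C" unfolding C_def using card_closed_orbits_le(1)[OF T_map_in fin] by simp
  have up: "n * card C \<le> card (?P n)" and eq: "n * card C = card (\<Union>C)"
    unfolding C_def using card_closed_orbits_le(2,3)[OF T_map_in fin] by simp_all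
  have finU: "finite (\<Union>C)"
  proof (rule finite_subset[OF _ fin])
    show "\<Union>C \<subseteq> ?P n" using closed_orbit_periodic[where X = ?X and T = ?T] T_map_in unfolding C_def by blast
  qed
  have "card (?P n) \<le> card (\<Union>C \<union> (\<Union>d\<in>{1..n div 2}. ?P d))"
    using finU finite_periodic_points unfolding C_def
    by (intro card_mono periodic_points_subset n) auto
  also have "\<dots> \<le> card (\<Union>C) + card (\<Union>d\<in>{1..n div 2}. ?P d)" by (rule card_Un_le)
  also have "card (\<Union>d\<in>{1..n div 2}. ?P d) \<le> (\<Sum>d=1..n div 2. card (?P d))"
    by (rule card_UN_le) simp
  finally have "real (card (?P n)) \<le> real (n * card C) + (\<Sum>d=1..n div 2. real (card (?P d)))"
    unfolding eq by (simp flip: of_nat_sum of_nat_add)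
  also have "(\<Sum>d=1..n div 2. real (card (?P d))) \<le> (\<Sum>d=1..n div 2. 2 ^ d)"
  proof (rule sum_mono)
    fix d assume "d \<in> {1..n div 2}"
    hence "real (card (?P d)) = (2 ^ d - 1) * orbit_weight S d" by (intro card_periodic_points) auto
    also have "\<dots> \<le> (2 ^ d - 1) * 1" by (intro mult_left_mono orbit_weight_le_1) auto
    also have "\<dots> \<le> (2::real) ^ d" by simp
    finally show "real (card (?P d)) \<le> 2 ^ d" .
  qed
  also have "\<dots> \<le> 2 * 2 ^ (n div 2)" by (rule sum_powers_of_two_le)
  finally have lo: "real (card (?P n)) \<le> real n * real (card C) + 2 * 2 ^ (n div 2)" by simp
  have P: "real (card (?P n)) = (2 ^ n - 1) * orbit_weight S n" by (rule card_periodic_points[OF n])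
  let ?h = "(2::real) ^ (n div 2)"
  have h1: "?h \<ge> 1" by simp
  have "\<bar>real n * real (card C) - 2 ^ n * orbit_weight S n\<bar> \<le> 3 * ?h"
  proof -
    have "real n * real (card C) \<le> real (card (?P n))" using up by (simp flip: of_nat_mult)
    moreover have "0 \<le> orbit_weight S n" "orbit_weight S n \<le> 1"
      using orbit_weight_pos[of S n] orbit_weight_le_1[of S n] by auto
    moreover have "real (card (?P n)) = 2 ^ n * orbit_weight S n - orbit_weight S n"
      using P by (simp add: left_diff_distrib)
    ultimately show ?thesis using lo h1 by linarith
  qed
  also have "3 * ?h \<le> 3 * sqrt 2 ^ n"
  proof -
    have "?h = sqrt 2 ^ (2 * (n div 2))" by (simp add: power_mult)
    also have "\<dots> \<le> sqrt 2 ^ n" by (intro power_increasing) auto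
    finally show ?thesis by simp
  qed
  finally have *: "\<bar>real n * real (card C) - 2 ^ n * orbit_weight S n\<bar> \<le> 3 * sqrt 2 ^ n" .
  have "\<bar>real (card C) / 2 ^ n - orbit_weight S n / real n\<bar> =
      \<bar>real n * real (card C) - 2 ^ n * orbit_weight S n\<bar> / (real n * 2 ^ n)"
  proof -
    have "real (card C) / 2 ^ n - orbit_weight S n / real n =
      (real n * real (card C) - 2 ^ n * orbit_weight S n) / (real n * 2 ^ n)"
      using n by (simp add: field_simps)
    thus ?thesis by (simp add: abs_divide)
  qed
  also have "\<dots> \<le> 3 * sqrt 2 ^ n / (real n * 2 ^ n)" by (intro divide_right_mono *) auto
  also have "\<dots> \<le> 3 * sqrt 2 ^ n / (1 * 2 ^ n)"
    using n by (intro divide_left_mono mult_right_mono) auto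
  also have "\<dots> = 3 * (sqrt 2 / 2) ^ n" by (simp add: power_divide)
  finally show "\<bar>real (card C) / 2 ^ n - orbit_weight S n / real n\<bar> \<le> 3 * (sqrt 2 / 2) ^ n" .
qed

text \<open>With entropy \<open>ln 2\<close> an orbit of length \<open>n\<close> has weight
  \<open>2^(-n)\<close>. Finiteness of the set of orbits is what permits grouping by length.\<close>

lemma mertens_sum_eq:
  "mertens_sum S N = (\<Sum>n=1..N. real (card {\<tau> \<in> closed_orbits (characters (S_integers S)) (T_map S). card \<tau> = n}) / 2 ^ n)"
proof -
  let ?O = "closed_orbits (characters (S_integers S)) (T_map S)"
  let ?A = "{\<tau>. \<tau> \<in> ?O \<and> card \<tau> \<le> N}"
  have fin: "finite ?A"
  proof (rule finite_subset)
    show "?A \<subseteq> (\<Union>n\<in>{1..N}. {\<tau> \<in> ?O. card \<tau> = n})" using closed_orbits_card_pos by fastforce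
    show "finite (\<Union>n\<in>{1..N}. {\<tau> \<in> ?O. card \<tau> = n})" using closed_orbit_count(1)[of _ S] by auto
  qed
  have "mertens_sum S N = (\<Sum>\<tau>\<in>?A. exp (- ln 2 * real (card \<tau>)))"
    by (simp add: mertens_sum_def top_entropy_T_map)
  also have "\<dots> = (\<Sum>n=1..N. \<Sum>\<tau>\<in>{\<tau> \<in> ?A. card \<tau> = n}. exp (- ln 2 * real (card \<tau>)))"
    by (rule sum.group[symmetric]) (use fin closed_orbits_card_pos in auto)
  also have "\<dots> = (\<Sum>n=1..N. real (card {\<tau> \<in> ?O. card \<tau> = n}) / 2 ^ n)"
  proof (rule sum.cong[OF refl])
    fix n assume n: "n \<in> {1..N}"
    have "(\<Sum>\<tau>\<in>{\<tau> \<in> ?A. card \<tau> = n}. exp (- ln 2 * real (card \<tau>))) = (\<Sum>\<tau>\<in>{\<tau> \<in> ?O. card \<tau> = n}. 1 / 2 ^ n)"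
    proof (rule sum.cong)
      show "{\<tau> \<in> ?A. card \<tau> = n} = {\<tau> \<in> ?O. card \<tau> = n}" using n by auto
      fix \<tau> assume "\<tau> \<in> {\<tau> \<in> ?O. card \<tau> = n}"
      hence "exp (- ln 2 * real (card \<tau>)) = inverse (exp (real n * ln 2))"
        by (simp add: exp_minus[symmetric] mult.commute)
      also have "exp (real n * ln 2) = (2::real) ^ n" by (simp add: exp_of_nat_mult)
      finally show "exp (- ln 2 * real (card \<tau>)) = 1 / 2 ^ n" by (simp add: inverse_eq_divide)
    qed
    thus "(\<Sum>\<tau>\<in>{\<tau> \<in> ?A. card \<tau> = n}. exp (- ln 2 * real (card \<tau>))) = real (card {\<tau> \<in> ?O. card \<tau> = n}) / 2 ^ n"
      by simp
  qed
  finally show ?thesis .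
qed

lemma mertens_sum_orbit_sum_bounded: "\<exists>C. \<forall>N. \<bar>mertens_sum S N - orbit_sum S N\<bar> \<le> C"
proof -
  let ?r = "sqrt 2 / 2 :: real"
  have r: "norm ?r < 1" using real_sqrt_less_mono[of 2 4] by simp
  have s: "summable (\<lambda>n. 3 * ?r ^ n)" by (intro summable_mult summable_geometric r)
  show ?thesis
  proof (intro exI allI)
    fix N
    have "\<bar>mertens_sum S N - orbit_sum S N\<bar> \<le> (\<Sum>n=1..N. 3 * ?r ^ n)"
      unfolding mertens_sum_eq orbit_sum_def sum_subtractf[symmetric]
      by (rule order_trans[OF sum_abs], rule sum_mono, rule closed_orbit_count) auto
    also have "\<dots> \<le> suminf (\<lambda>n. 3 * ?r ^ n)" by (intro sum_le_suminf s) auto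
    finally show "\<bar>mertens_sum S N - orbit_sum S N\<bar> \<le> suminf (\<lambda>n. 3 * ?r ^ n)" .
  qed
qed

theorem theorem4:
  fixes \<delta> k :: real
  assumes "0 < \<delta>" and "\<delta> < 1" and "0 < k"
  shows "\<exists>S \<subseteq> {p :: nat. prime p}.
    (\<lambda>N. mertens_sum S N) \<sim>[at_top] (\<lambda>N. k * ln (real N) powr \<delta>)"
proof -
  obtain A where A: "\<And>q. q \<in> A \<Longrightarrow> prime q"
    and lim: "(\<lambda>N. orbit_sum (mersenne_primes A) N / ln (real N) powr \<delta>) \<longlonglongrightarrow> k"
    using exact_growth_constant[OF assms] by blast
  let ?S = "mersenne_primes A"
  obtain C where C: "\<And>N. \<bar>mertens_sum ?S N - orbit_sum ?S N\<bar> \<le> C"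
    using mertens_sum_orbit_sum_bounded by blast
  \<comment> \<open>Here \<open>\<delta> > 0\<close> enters: a bounded error is negligible because
    \<open>ln N powr \<delta>\<close> is unbounded.\<close>
  have "(\<lambda>N. (mertens_sum ?S N - orbit_sum ?S N) / ln (real N) powr \<delta>) \<longlonglongrightarrow> 0"
  proof (rule Lim_null_comparison)
    show "\<forall>\<^sub>F N in sequentially. norm ((mertens_sum ?S N - orbit_sum ?S N) / ln (real N) powr \<delta>) \<le> C / ln (real N) powr \<delta>"
      using C by (intro always_eventually allI) (auto simp: abs_divide intro: divide_right_mono)
    show "(\<lambda>N. C / ln (real N) powr \<delta>) \<longlonglongrightarrow> 0" using assms(1) by real_asymp
  qed
  from tendsto_add[OF this lim]
  have "(\<lambda>N. mertens_sum ?S N / ln (real N) powr \<delta>) \<longlonglongrightarrow> k" by (simp add: diff_divide_distrib)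
  hence "(\<lambda>N. mertens_sum ?S N / ln (real N) powr \<delta> / k) \<longlonglongrightarrow> k / k"
    using assms(3) by (intro tendsto_divide tendsto_const) auto
  hence "(\<lambda>N. mertens_sum ?S N / (k * ln (real N) powr \<delta>)) \<longlonglongrightarrow> 1"
    using assms(3) by (simp add: mult.commute)
  hence "(\<lambda>N. mertens_sum ?S N) \<sim>[at_top] (\<lambda>N. k * ln (real N) powr \<delta>)" by (rule asymp_equivI')
  moreover have "?S \<subseteq> {p. prime p}" using prime_mersenne_prime_factor[OF A] by blast
  ultimately show ?thesis by blast
qed

end
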